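(* Let $n=2m$, let $D$ be the open $SL(m,\mathbb{H})$-orbit in the manifold $Z$ of complete flags in $\mathbb{C}^{n}$, and let $C_0\subset D$ be its base cycle. Let $\mathcal{S}_{C_0}$ be the set of Iwasawa–Schubert varieties $S_w$ ($w\in\Sigma_n$) with $\dim S_w+\dim C_0=\dim Z$ and $S_w\cap C_0\ne\emptyset$. Then $S_w\in\mathcal{S}_{C_0}$ if and only if $w$ satisfies the strictly pairing condition. In particular, in this case $w$ satisfies the spacing condition and $|w|=m^2-m$.
   Context: Let $\mathbf{j}:\mathbb{C}^{2m}\to\mathbb{C}^{2m}$, $\mathbf{j}(v)=J\bar v$ with $J=\begin{pmatrix}0&I_m\\-I_m&0\end{pmatrix}$, so $\mathbf{j}(e_i)=-e_{m+i}$ for $1\le i\le m$. $G=SL(2m,\mathbb{C})$, $G_0=SL(m,\mathbb{H})=\{X\in G:\mathbf{j}X=X\mathbf{j}\}$, $K_0=SU(2m)\cap G_0=Sp(m)$. $G_0$ has exactly one open orbit $D$ in $Z$. The base cycle $C_0$ is the unique $K_0$-orbit in $D$ that is a complex submanifold; equivalently the set of flags in $D$ with $\dim(V_i\cap V_j^\perp)$ maximal for all $i,j$, with $\perp$ taken for $\omega(v,w)=v^tJw$. Let $(u_1,\dots,u_n)=(e_1,\mathbf{j}(e_1),e_2,\mathbf{j}(e_2),\dots,e_m,\mathbf{j}(e_m))$ and let $B_I\subset G$ be the (Iwasawa–)Borel subgroup stabilizing the complete flag of this ordered basis. For $w\in\Sigma_n$ in one-line notation, $V_w$ is the complete flag with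 $k$-th subspace $\langle u_{w(1)},\dots,u_{w(k)}\rangle$, and the Iwasawa–Schubert variety $S_w$ is the closure of $B_I.V_w$. $|w|=\dim S_w$ is the number of inversions of $w$. Write $w=k_1\dots k_ml_m\dots l_1$. Spacing condition: for every $1\le i\le m$, either $l_i<k_i$, or $k_i$ is odd and $l_i=k_i+1$. Strictly pairing condition: for every $1\le i\le m$, $k_i$ is odd and $l_i=k_i+1$. *)

theory Defs
  imports "HOL-Analysis.Analysis"
begin

text \<open>
  The ambient space is \<open>\<complex>\<^sup>n\<close> with \<open>n = 2m\<close> and \<open>m = CARD('m)\<close>. Its coordinates are indexed by
  \<open>'m + 'm\<close>: the left summand carries \<open>e\<^sub>1, \<dots>, e\<^sub>m\<close> and the right one \<open>e\<^sub>m\<^sub>+\<^sub>1, \<dots>, e\<^sub>2\<^sub>m\<close>, so that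
  block matrices are written with respect to the summands. Linear algebra over \<open>\<complex>\<close> is that of
  the interpretation \<open>vec\<close> (\<open>vec.subspace\<close>, \<open>vec.span\<close>, \<open>vec.dim\<close>); the unqualified \<open>subspace\<close>,
  \<open>span\<close>, \<open>dim\<close> would be those over \<open>\<real>\<close>.
\<close>

type_synonym 'm cvec = "complex ^ ('m + 'm)"
type_synonym 'm cmat = "complex ^ ('m + 'm) ^ ('m + 'm)"
type_synonym 'm flag = "nat \<Rightarrow> 'm cvec set"


subsection \<open>The quaternionic structure and the groups\<close>

definition J_mat :: "'m::finite cmat" where
  "J_mat = (\<chi> a b. case (a, b) of
      (Inl i, Inr k) \<Rightarrow> if i = k then 1 else 0
    | (Inr i, Inl k) \<Rightarrow> if i = k then - 1 else 0
    | _ \<Rightarrow> 0)"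

definition cnj_vec :: "complex ^ 'n \<Rightarrow> complex ^ 'n" where
  "cnj_vec v = (\<chi> a. cnj (v $ a))"

definition jmap :: "'m::finite cvec \<Rightarrow> 'm cvec" where
  "jmap v = J_mat *v cnj_vec v"

definition omega :: "'m::finite cvec \<Rightarrow> 'm cvec \<Rightarrow> complex" where
  "omega v w = (\<Sum>a\<in>UNIV. v $ a * (J_mat *v w) $ a)"

definition perp :: "'m::finite cvec set \<Rightarrow> 'm cvec set" where
  "perp W = {v. \<forall>w\<in>W. omega v w = 0}"

definition SL :: "'m::finite cmat set" where
  "SL = {X. det X = 1}"

definition SL_quat :: "'m::finite cmat set" where
  "SL_quat = {X \<in> SL. \<forall>v. jmap (X *v v) = X *v jmap v}"


subsection \<open>Complete flags\<close>

text \<open>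
  A complete flag is the sequence of its subspaces \<open>F 0, F 1, \<dots>, F n\<close>, extended by
  \<open>F k = UNIV\<close> for \<open>k > n\<close> so that equality of flags is equality of functions.
\<close>

definition complete_flags :: "'m::finite flag set" where
  "complete_flags = {F. mono F \<and> (\<forall>k. vec.subspace (F k) \<and> vec.dim (F k) = min k (2 * CARD('m)))}"

definition flag_of_basis :: "(nat \<Rightarrow> 'm::finite cvec) \<Rightarrow> 'm flag" where
  "flag_of_basis b k = vec.span (b ` {1..min k (2 * CARD('m))})"

definition act :: "'m::finite cmat \<Rightarrow> 'm flag \<Rightarrow> 'm flag" where
  "act X F k = (*v) X ` F k"

definition orbit :: "'m::finite cmat set \<Rightarrow> 'm flag \<Rightarrow> 'm flag set" where
  "orbit H F = (\<lambda>X. act X F) ` H"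

definition e_vec :: "nat \<Rightarrow> 'm::{finite,linorder} cvec" where
  "e_vec i = axis (Inl (sorted_list_of_set (UNIV :: 'm set) ! (i - 1))) 1"

text \<open>The ordered basis \<open>(u\<^sub>1, \<dots>, u\<^sub>n) = (e\<^sub>1, j e\<^sub>1, \<dots>, e\<^sub>m, j e\<^sub>m)\<close>, numbered from 1.\<close>

definition u_vec :: "nat \<Rightarrow> 'm::{finite,linorder} cvec" where
  "u_vec i = (if odd i then e_vec ((i + 1) div 2) else jmap (e_vec (i div 2)))"

definition iwasawa_flag :: "'m::{finite,linorder} flag" where
  "iwasawa_flag = flag_of_basis u_vec"

definition iwasawa_borel :: "'m::{finite,linorder} cmat set" where
  "iwasawa_borel = {X \<in> SL. act X iwasawa_flag = iwasawa_flag}"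

text \<open>
  The topology of the flag manifold as the quotient of \<open>SL(2m,\<complex>)\<close> by the Borel subgroup
  \<open>iwasawa_borel\<close>, i.e. the final topology for the orbit map.
\<close>

definition flag_topology :: "'m::{finite,linorder} flag topology" where
  "flag_topology = topology (\<lambda>U. U \<subseteq> complete_flags \<and>
     openin (top_of_set SL) {X \<in> SL. act X iwasawa_flag \<in> U})"

lemma openin_flag_topology:
  "openin flag_topology U \<longleftrightarrow>
     U \<subseteq> (complete_flags :: 'm::{finite,linorder} flag set) \<and>
     openin (top_of_set SL) {X \<in> SL. act X iwasawa_flag \<in> U}"
proof -
  let ?P = "\<lambda>U. {X \<in> SL. act X (iwasawa_flag :: 'm flag) \<in> U}"
  have Int: "?P (S \<inter> T) = ?P S \<inter> ?P T" for S T
    by auto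
  have Un: "?P (\<Union>\<K>) = \<Union> (?P ` \<K>)" for \<K>
    by auto
  have "istopology (\<lambda>U. U \<subseteq> (complete_flags :: 'm flag set) \<and> openin (top_of_set SL) (?P U))"
    unfolding istopology_def Int Un by (auto intro!: openin_Int openin_Union)
  then show ?thesis
    by (simp add: flag_topology_def topology_inverse')
qed


subsection \<open>Complex dimension\<close>

text \<open>
  The flag manifold, the base cycle and the Schubert varieties are measured by one notion of
  dimension: a subset \<open>A\<close> has complex dimension \<open>d\<close> if some dense, relatively open subset of it
  (e.g. the smooth locus of an irreducible variety) is locally homeomorphic to open subsets of
  \<open>\<complex>\<^sup>d\<close>. Since dimension is a topological invariant, continuous charts suffice.
\<close>

definition complex_space :: "nat \<Rightarrow> (nat \<Rightarrow> complex) topology" where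
  "complex_space d = product_topology (\<lambda>_. euclidean) {..<d}"

definition locally_complex :: "nat \<Rightarrow> 'a topology \<Rightarrow> bool" where
  "locally_complex d X \<longleftrightarrow> (\<forall>x\<in>topspace X. \<exists>U V. openin X U \<and> x \<in> U \<and>
     openin (complex_space d) V \<and>
     subtopology X U homeomorphic_space subtopology (complex_space d) V)"

definition has_complex_dim :: "'a topology \<Rightarrow> 'a set \<Rightarrow> nat \<Rightarrow> bool" where
  "has_complex_dim X A d \<longleftrightarrow> (\<exists>M. openin (subtopology X A) M \<and> A \<subseteq> X closure_of M \<and>
     locally_complex d (subtopology X M))"

definition complex_dim :: "'a topology \<Rightarrow> 'a set \<Rightarrow> nat" where
  "complex_dim X A = (THE d. has_complex_dim X A d)"


subsection \<open>Open orbits, base cycle and Iwasawa--Schubert varieties\<close>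

definition open_quat_orbit :: "'m::{finite,linorder} flag set \<Rightarrow> bool" where
  "open_quat_orbit D \<longleftrightarrow> (\<exists>F\<in>complete_flags. D = orbit SL_quat F) \<and> openin flag_topology D"

definition base_cycle :: "'m::finite flag set \<Rightarrow> 'm flag set" where
  "base_cycle D = {F \<in> D. \<forall>F'\<in>D. \<forall>i j.
     vec.dim (F' i \<inter> perp (F' j)) \<le> vec.dim (F i \<inter> perp (F j))}"

definition schubert :: "(nat \<Rightarrow> nat) \<Rightarrow> 'm::{finite,linorder} flag set" where
  "schubert w = flag_topology closure_of orbit iwasawa_borel (flag_of_basis (u_vec \<circ> w))"

definition complementary_schubert :: "'m::{finite,linorder} flag set \<Rightarrow> 'm flag set set" where
  "complementary_schubert C = {S. \<exists>w. w permutes {1..2 * CARD('m)} \<and> S = schubert w \<and>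
     complex_dim flag_topology S + complex_dim flag_topology C
       = complex_dim flag_topology (complete_flags :: 'm flag set) \<and>
     S \<inter> C \<noteq> {}}"


subsection \<open>Conditions on permutations\<close>

text \<open>
  A permutation \<open>w\<close> of \<open>{1..2m}\<close> with one-line notation \<open>k\<^sub>1 \<dots> k\<^sub>m l\<^sub>m \<dots> l\<^sub>1\<close>
  has \<open>k\<^sub>i = w i\<close> and \<open>l\<^sub>i = w (2m + 1 - i)\<close>.
\<close>

definition spacing :: "nat \<Rightarrow> (nat \<Rightarrow> nat) \<Rightarrow> bool" where
  "spacing m w \<longleftrightarrow> (\<forall>i\<in>{1..m}. w (2 * m + 1 - i) < w i \<or>
     odd (w i) \<and> w (2 * m + 1 - i) = w i + 1)"

definition strictly_pairing :: "nat \<Rightarrow> (nat \<Rightarrow> nat) \<Rightarrow> bool" where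
  "strictly_pairing m w \<longleftrightarrow> (\<forall>i\<in>{1..m}. odd (w i) \<and> w (2 * m + 1 - i) = w i + 1)"

definition inversions :: "nat \<Rightarrow> (nat \<Rightarrow> nat) \<Rightarrow> nat" where
  "inversions n w = card {(p, q). 1 \<le> p \<and> p < q \<and> q \<le> n \<and> w q < w p}"

end

(*
  A strictly pairing permutation attains a minimum. Let V = (V_p) be a flag of the cell B_I.V_w and E the Iwasawa
  flag, whose even steps are j-stable. If V lies in D, i.e. if V_p and j(V_{n-p}) meet trivially, then so do
  their intersections with E_{2k}; comparing dimensions, the rank numbers r_w(p, 2k) of w satisfy
  r_w(p, 2k) + r_w(n-p, 2k) <= 2k. Forgetting the order within the pairs {2k-1, 2k} turns w into a word x
  with letters 1, 1, ..., m, m, and the inequality says that the reversed word lies below x in Bruhat order. Hence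
  inv(reverse x) <= inv(x), with equality only if x is a palindrome; as the two numbers add up to
  2(m^2 - m), it follows that |w| >= inv(x) >= m^2 - m, with equality exactly for strictly pairing w.
  Since D is open, S_w meets C_0 only if the cell itself meets D.

  D is the set of all transversal flags: these are dense, and SL(m,H) acts transitively on them because the
  lines V_i cap j(V_{n+1-i}), i <= m, are spanned by a quaternionic basis and quaternionic matrices have
  positive determinant. C_0 is then the set of isotropic flags, of dimension m^2. All dimensions are read off
  in one affine chart around V_w, in which the cell of w and the isotropic flags are graphs of continuous functions.
*)

theory Submission
  imports Defs "HOL-Homology.Invariance_of_Domain"
begin

subsection \<open>Words, inversions and Bruhat order\<close>

text \<open>Only the even steps of E are j-stable, so transversality controls the ranks of w at even
  thresholds alone. This is why the combinatorics runs on words with repeated letters, and why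
  Bruhat comparison is proved for words, by exchanges that each raise the inversion number. The
  total 2(m^2 - m) counts all m(2m - 1) pairs of places except the m pairs carrying equal letters.
  An inversion of w is an inversion of x or a pair 2k, 2k - 1 in this order; excluding the latter is
  what puts the odd value of each mirrored pair first, which the palindrome property alone does not
  give. The bound m^2 - m is also dim Z - dim C_0 = m(2m - 1) - m^2. Dimension is a topological
  notion here, so its uniqueness rests on invariance of domain, and each value has to be exhibited
  by a dense open piece locally homeomorphic to some C^d: the cell inside its closure, and for Z and
  C_0 the whole space, one chart domain being moved everywhere by a transitive group.\<close>

definition prefix_count :: "(nat \<Rightarrow> nat) \<Rightarrow> nat \<Rightarrow> nat \<Rightarrow> nat" where
  "prefix_count x p k = card {i \<in> {1..p}. x i \<le> k}"

definition inversion_set :: "nat \<Rightarrow> (nat \<Rightarrow> nat) \<Rightarrow> (nat \<times> nat) set" where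
  "inversion_set n x = {(p, q). 1 \<le> p \<and> p < q \<and> q \<le> n \<and> x q < x p}"

lemma inversions_eq_card: "inversions n x = card (inversion_set n x)"
  by (simp add: inversions_def inversion_set_def)

lemma inversion_set_subset: "inversion_set n x \<subseteq> {1..n} \<times> {1..n}"
  by (auto simp: inversion_set_def)

lemma finite_inversion_set [simp]: "finite (inversion_set n x)"
  by (rule finite_subset[OF inversion_set_subset]) auto

lemma inversions_le: "inversions n x \<le> n * n"
  using card_mono[OF _ inversion_set_subset, of n x] by (simp add: inversions_eq_card)

text \<open>Exchanging the two places maps inversions of \<open>x\<close> to inversions of the new
  word, except for pairs whose order the exchange reverses; these remain inversions where they are,
  since the entry at \<open>p\<close> grows and the one at \<open>q\<close> shrinks. The rule is its
  own inverse, hence injective, and it misses the new inversion (p, q).\<close>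

lemma inversions_swap_less:
  assumes "1 \<le> p" "p < q" "q \<le> n" "x p < x q"
  shows "inversions n x < inversions n (x(p := x q, q := x p))"
proof -
  let ?t = "id(p := q, q := p)" and ?x = "x(p := x q, q := x p)"
  let ?f = "\<lambda>(a, b). if ?t a < ?t b then (?t a, ?t b) else (a, b)"
  have xt: "?x (?t c) = x c" for c
    using assms by simp
  have range: "?t c \<in> {1..n}" if "c \<in> {1..n}" for c
    using assms that by simp
  have "?f ` inversion_set n x \<subseteq> inversion_set n ?x - {(p, q)}"
  proof (rule image_subsetI)
    fix ab
    assume "ab \<in> inversion_set n x"
    then obtain a b where ab: "ab = (a, b)" "1 \<le> a" "a < b" "b \<le> n" "x b < x a"
      by (auto simp: inversion_set_def)
    show "?f ab \<in> inversion_set n ?x - {(p, q)}"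
    proof (cases "?t a < ?t b")
      case True
      moreover have "(?t a, ?t b) \<noteq> (p, q)"
        using ab assms by (auto split: if_splits)
      moreover have "1 \<le> ?t a" "?t b \<le> n"
        using ab range[of a] range[of b] by simp_all
      then have "(?t a, ?t b) \<in> inversion_set n ?x"
        unfolding inversion_set_def mem_Collect_eq prod.case xt using True ab(5) by blast
      ultimately show ?thesis
        unfolding ab(1) by simp
    next
      case False
      then consider "a = p" "b < q" | "b = q" "p < a" | "a = p" "b = q"
        using ab(3) assms(2) by (fastforce split: if_splits)
      then have "(a, b) \<in> inversion_set n ?x" "(a, b) \<noteq> (p, q)"
        using ab assms by (cases; simp add: inversion_set_def)+
      with False show ?thesis
        unfolding ab(1) by simp
    qed
  qed
  moreover have "(p, q) \<in> inversion_set n ?x"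
    using assms by (auto simp: inversion_set_def)
  moreover have "inj_on ?f (inversion_set n x)"
  proof (rule inj_on_inverseI[where g = ?f])
    fix ab
    assume "ab \<in> inversion_set n x"
    then obtain a b where ab: "ab = (a, b)" "a < b"
      by (auto simp: inversion_set_def)
    have "?t (?t c) = c" for c
      using assms by simp
    then show "?f (?f ab) = ab"
      unfolding ab(1) using ab(2) by (cases "?t a < ?t b") (simp_all only: prod.case if_True if_False)
  qed
  ultimately have "card (inversion_set n x) \<le> card (inversion_set n ?x - {(p, q)})"
    by (intro card_inj_on_le[of ?f]) auto
  also have "\<dots> < card (inversion_set n ?x)"
    using \<open>(p, q) \<in> _\<close> by (intro psubset_card_mono) auto
  finally show ?thesis
    by (simp add: inversions_eq_card)
qed

lemma prefix_count_split:
  assumes "k \<le> l"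
  shows "prefix_count x p l = prefix_count x p k + card {i \<in> {1..p}. k < x i \<and> x i \<le> l}"
proof -
  have "{i \<in> {1..p}. x i \<le> l} = {i \<in> {1..p}. x i \<le> k} \<union> {i \<in> {1..p}. k < x i \<and> x i \<le> l}"
    using assms by auto
  then show ?thesis
    unfolding prefix_count_def by (simp add: card_Un_disjoint disjoint_iff)
qed

lemma prefix_count_cong:
  "(\<And>i. i \<in> {1..p} \<Longrightarrow> x i = y i) \<Longrightarrow> prefix_count x p k = prefix_count y p k"
  unfolding prefix_count_def by (rule arg_cong[where f = card]) auto

lemma prefix_count_Suc:
  "prefix_count x (Suc p) k = prefix_count x p k + (if x (Suc p) \<le> k then 1 else 0)"
proof -
  have "{i \<in> {1..Suc p}. x i \<le> k} =
      {i \<in> {1..p}. x i \<le> k} \<union> (if x (Suc p) \<le> k then {Suc p} else {})"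
    by (auto simp: le_Suc_eq)
  then show ?thesis
    unfolding prefix_count_def by (auto simp: card_Un_disjoint)
qed

lemma prefix_count_swap:
  assumes "1 \<le> p" "p < q" "x p < x q"
  shows "prefix_count (x(p := x q, q := x p)) i k =
    prefix_count x i k - (if p \<le> i \<and> i < q \<and> x p \<le> k \<and> k < x q then 1 else 0)"
proof (induction i)
  case 0
  then show ?case
    by (auto simp: prefix_count_def)
next
  case (Suc i)
  \<comment> \<open>Keeps the truncated subtraction exact.\<close>
  have pos: "0 < prefix_count x i k" if "p \<le> i" "x p \<le> k"
    using that assms unfolding prefix_count_def by (auto simp: card_gt_0_iff)
  have "(x(p := x q, q := x p)) (Suc i) = (if Suc i = p then x q else if Suc i = q then x p else x (Suc i))"
    using assms by auto
  then show ?case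
    unfolding prefix_count_Suc Suc using pos assms by (auto split: if_splits simp del: fun_upd_apply)
qed

text \<open>
  The step of a saturated chain in Bruhat order: at the first place \<open>p\<close> where \<open>x\<close> and \<open>y\<close> differ,
  exchanging \<open>x p\<close> with the next entry in \<open>(x p, y p]\<close> keeps \<open>x\<close> below \<open>y\<close>.
\<close>

lemma bruhat_step:
  assumes dom: "\<And>i k. i \<le> n \<Longrightarrow> prefix_count y i k \<le> prefix_count x i k"
    and total: "\<And>k. prefix_count y n k = prefix_count x n k"
    and neq: "\<exists>i\<in>{1..n}. x i \<noteq> y i"
  obtains p q where "1 \<le> p" "p < q" "q \<le> n" "x p < x q"
    "\<And>i k. i \<le> n \<Longrightarrow> prefix_count y i k \<le> prefix_count (x(p := x q, q := x p)) i k"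
proof -
  define p where "p = (LEAST i. i \<in> {1..n} \<and> x i \<noteq> y i)"
  have p: "p \<in> {1..n}" "x p \<noteq> y p"
    using LeastI_ex[of "\<lambda>i. i \<in> {1..n} \<and> x i \<noteq> y i", folded p_def] neq by blast+
  have least: "x i = y i" if "1 \<le> i" "i < p" for i
    using not_less_Least[of i "\<lambda>i. i \<in> {1..n} \<and> x i \<noteq> y i", folded p_def] that p(1) by auto
  obtain r where r: "p = Suc r"
    using p(1) by (cases p) auto
  \<comment> \<open>Equal counts before \<open>p\<close>, so dominance at threshold
    \<open>y p\<close> forces \<open>x p\<close> to be at most \<open>y p\<close>.\<close>
  have "prefix_count x r k = prefix_count y r k" for k
    by (rule prefix_count_cong) (use least r in auto)
  then have less: "x p < y p"
    using dom[of p "y p"] p by (auto simp: r prefix_count_Suc split: if_splits)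
  \<comment> \<open>Compare the entries in \<open>(k, y p]\<close>: up to place \<open>i\<close>,
    \<open>x\<close> has only those before \<open>p\<close>, which it shares with \<open>y\<close>,
    while \<open>y\<close> also has the one at \<open>p\<close>. With dominance at threshold
    \<open>y p\<close> this makes the inequality at \<open>k\<close> strict, leaving room for the
    loss caused by the exchange.\<close>
  have key: "prefix_count y i k + 1 \<le> prefix_count x i k"
    if i: "p \<le> i" "i \<le> n" and free: "\<And>j. p < j \<Longrightarrow> j \<le> i \<Longrightarrow> \<not> (x p < x j \<and> x j \<le> y p)"
      and k: "x p \<le> k" "k < y p" for i k
  proof -
    let ?X = "{j \<in> {1..i}. k < x j \<and> x j \<le> y p}" and ?Y = "{j \<in> {1..i}. k < y j \<and> y j \<le> y p}"
    have "insert p ?X \<subseteq> ?Y"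
    proof
      fix j
      assume "j \<in> insert p ?X"
      then show "j \<in> ?Y"
        using i k p free[of j] least[of j] by (cases j p rule: linorder_cases) auto
    qed
    then have "card (insert p ?X) \<le> card ?Y"
      by (intro card_mono) auto
    moreover have "card (insert p ?X) = card ?X + 1"
      using k by simp
    ultimately have "card ?X + 1 \<le> card ?Y"
      by simp
    with prefix_count_split[of k "y p" x i] prefix_count_split[of k "y p" y i] dom[of i "y p"] i k
    show ?thesis
      by simp
  qed
  define Q where "Q j \<longleftrightarrow> p < j \<and> j \<le> n \<and> x p < x j \<and> x j \<le> y p" for j
  \<comment> \<open>Otherwise \<open>key\<close> holds up to place \<open>n\<close>, against the
    equality of the totals.\<close>
  have "\<exists>j. Q j"
  proof (rule ccontr)
    assume "\<nexists>j. Q j"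
    then have "prefix_count y n (x p) + 1 \<le> prefix_count x n (x p)"
      using p less by (intro key) (auto simp: Q_def)
    then show False
      using total[of "x p"] by simp
  qed
  define q where "q = (LEAST j. Q j)"
  have q: "Q q"
    unfolding q_def using \<open>\<exists>j. Q j\<close> by (rule LeastI_ex)
  have nQ: "\<not> Q j" if "j < q" for j
    using that unfolding q_def by (rule not_less_Least)
  have "prefix_count y i k \<le> prefix_count (x(p := x q, q := x p)) i k" if "i \<le> n" for i k
  proof (cases "p \<le> i \<and> i < q \<and> x p \<le> k \<and> k < x q")
    case True
    have "prefix_count y i k + 1 \<le> prefix_count x i k"
    proof (rule key)
      fix j
      assume "p < j" "j \<le> i"
      then show "\<not> (x p < x j \<and> x j \<le> y p)"
        using nQ[of j] True that unfolding Q_def by auto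
    qed (use True that q in \<open>auto simp: Q_def\<close>)
    with True show ?thesis
      using p q by (subst prefix_count_swap) (auto simp: Q_def)
  next
    case False
    then show ?thesis
      using p q dom[OF that] by (subst prefix_count_swap) (auto simp: Q_def)
  qed
  with p q show ?thesis
    by (intro that[of p q]) (auto simp: Q_def)
qed

text \<open>Larger prefix counts mean smaller in Bruhat order. Each exchange raises the inversion
  number, which is bounded by \<open>n * n\<close>, so the chain starting at \<open>x\<close> ends
  at \<open>y\<close>; a chain of positive length gives a strict inequality.\<close>

lemma inversions_bruhat_mono:
  assumes "\<And>i k. i \<le> n \<Longrightarrow> prefix_count y i k \<le> prefix_count x i k"
    and "\<And>k. prefix_count y n k = prefix_count x n k"
  shows "inversions n x \<le> inversions n y \<and>
    (inversions n x = inversions n y \<longrightarrow> (\<forall>i\<in>{1..n}. x i = y i))"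
  using assms
proof (induction "n * n - inversions n x" arbitrary: x rule: less_induct)
  case less
  show ?case
  proof (cases "\<forall>i\<in>{1..n}. x i = y i")
    case True
    then have "inversion_set n x = inversion_set n y"
      by (auto simp: inversion_set_def)
    with True show ?thesis
      by (simp add: inversions_eq_card)
  next
    case False
    then obtain p q where pq: "1 \<le> p" "p < q" "q \<le> n" "x p < x q"
      and dom: "\<And>i k. i \<le> n \<Longrightarrow> prefix_count y i k \<le> prefix_count (x(p := x q, q := x p)) i k"
      using bruhat_step[of n y x] less.prems by blast
    have inv: "inversions n x < inversions n (x(p := x q, q := x p))"
      using pq by (rule inversions_swap_less)
    have "inversions n (x(p := x q, q := x p)) \<le> inversions n y"
    proof (rule less.hyps[THEN conjunct1])
      show "n * n - inversions n (x(p := x q, q := x p)) < n * n - inversions n x"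
        using inv inversions_le[of n "x(p := x q, q := x p)"] by linarith
      show "prefix_count y n k = prefix_count (x(p := x q, q := x p)) n k" for k
        using pq less.prems(2) by (subst prefix_count_swap) auto
    qed (rule dom)
    with inv show ?thesis
      by simp
  qed
qed

lemma card_increasing_pairs: "card {(p, q). 1 \<le> p \<and> p < q \<and> q \<le> (n::nat)} = n * (n - 1) div 2"
proof (induction n)
  case 0
  have empty: "{(p, q). 1 \<le> p \<and> p < q \<and> q \<le> (0::nat)} = {}"
    by auto
  show ?case
    unfolding empty by simp
next
  case (Suc n)
  have fin: "finite {(p, q). 1 \<le> p \<and> p < q \<and> q \<le> (n::nat)}"
    by (rule finite_subset[of _ "{1..n} \<times> {1..n}"]) auto
  have "{(p, q). 1 \<le> p \<and> p < q \<and> q \<le> Suc n} =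
      {(p, q). 1 \<le> p \<and> p < q \<and> q \<le> n} \<union> {1..n} \<times> {Suc n}"
    by auto
  then have "card {(p, q). 1 \<le> p \<and> p < q \<and> q \<le> Suc n} = n * (n - 1) div 2 + n"
    using fin Suc by (simp add: card_Un_disjoint disjoint_iff)
  also have "\<dots> = Suc n * (Suc n - 1) div 2"
    by (cases n) (auto simp: algebra_simps)
  finally show ?case .
qed

text \<open>
  The pairs of the Iwasawa basis are the fibres of \<open>i \<mapsto> (i + 1) div 2\<close>; a permutation gives a word
  in which each letter of \<open>{1..m}\<close> occurs twice.
\<close>

context
  fixes m :: nat and w :: "nat \<Rightarrow> nat"
  assumes w: "w permutes {1..2 * m}"
begin

private definition x :: "nat \<Rightarrow> nat" where "x i = (w i + 1) div 2"
private definition y :: "nat \<Rightarrow> nat" where "y i = x (2 * m + 1 - i)"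

private lemma w_in: "i \<in> {1..2 * m} \<Longrightarrow> w i \<in> {1..2 * m}"
  using permutes_in_image[OF w] by blast

private lemma w_inj: "w i = w j \<longleftrightarrow> i = j"
  using permutes_inj[OF w] by (auto dest: injD)

private lemma x_le_iff: "x i \<le> k \<longleftrightarrow> w i \<le> 2 * k"
  by (auto simp: x_def)

text \<open>Letter \<open>k\<close> sits exactly at the places of 2k - 1 and 2k, so each letter
  contributes one pair.\<close>

private lemma card_same_letter: "card {(p, q). 1 \<le> p \<and> p < q \<and> q \<le> 2 * m \<and> x p = x q} = m"
proof -
  let ?v = "inv_into UNIV w"
  have v: "?v j \<in> {1..2 * m} \<longleftrightarrow> j \<in> {1..2 * m}" for j
    using permutes_in_image[OF permutes_inv[OF w]] .
  have wv: "w (?v j) = j" "?v (w j) = j" for j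
    using permutes_inverses[OF w] by auto
  let ?f = "\<lambda>k. (min (?v (2 * k - 1)) (?v (2 * k)), max (?v (2 * k - 1)) (?v (2 * k)))"
  have xv: "x (?v (2 * k - 1)) = k" "x (?v (2 * k)) = k" if "k \<in> {1..m}" for k
    using that by (auto simp: x_def wv)
  have "bij_betw ?f {1..m} {(p, q). 1 \<le> p \<and> p < q \<and> q \<le> 2 * m \<and> x p = x q}"
  proof (rule bij_betw_byWitness[where f' = "\<lambda>(p, q). x p"])
    show "\<forall>k\<in>{1..m}. (\<lambda>(p, q). x p) (?f k) = k"
      using xv by (auto simp: min_def)
    show "?f ` {1..m} \<subseteq> {(p, q). 1 \<le> p \<and> p < q \<and> q \<le> 2 * m \<and> x p = x q}"
    proof (intro subsetI)
      fix pq
      assume "pq \<in> ?f ` {1..m}"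
      then obtain k where k: "k \<in> {1..m}" and pq: "pq = ?f k"
        by blast
      have "?v (2 * k - 1) \<noteq> ?v (2 * k)"
        using wv(1)[of "2 * k - 1"] wv(1)[of "2 * k"] k by auto
      moreover have "?v (2 * k - 1) \<in> {1..2 * m}" "?v (2 * k) \<in> {1..2 * m}"
        unfolding v using k by auto
      ultimately show "pq \<in> {(p, q). 1 \<le> p \<and> p < q \<and> q \<le> 2 * m \<and> x p = x q}"
        using xv[OF k] pq by (auto simp: min_def max_def split: if_splits)
    qed
    show "(\<lambda>(p, q). x p) ` {(p, q). 1 \<le> p \<and> p < q \<and> q \<le> 2 * m \<and> x p = x q} \<subseteq> {1..m}"
    proof
      fix k
      assume "k \<in> (\<lambda>(p, q). x p) ` {(p, q). 1 \<le> p \<and> p < q \<and> q \<le> 2 * m \<and> x p = x q}"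
      then obtain p q where "k = x p" "1 \<le> p" "p < q" "q \<le> 2 * m"
        by auto
      then show "k \<in> {1..m}"
        using w_in[of p] by (auto simp: x_def)
    qed
    show "\<forall>pq\<in>{(p, q). 1 \<le> p \<and> p < q \<and> q \<le> 2 * m \<and> x p = x q}. ?f ((\<lambda>(p, q). x p) pq) = pq"
    proof
      fix pq
      assume "pq \<in> {(p, q). 1 \<le> p \<and> p < q \<and> q \<le> 2 * m \<and> x p = x q}"
      then obtain p q where pq: "pq = (p, q)" and *: "1 \<le> p" "p < q" "q \<le> 2 * m" "x p = x q"
        by blast
      then have "w p \<in> {1..2 * m}" "w q \<in> {1..2 * m}" "w p \<noteq> w q"
        using w_in[of p] w_in[of q] by (auto simp: w_inj)
      then have "w p = 2 * x p - 1 \<and> w q = 2 * x p \<or> w q = 2 * x p - 1 \<and> w p = 2 * x p"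
        using *(4) unfolding x_def by auto
      then have "?v (2 * x p - 1) = p \<and> ?v (2 * x p) = q \<or> ?v (2 * x p - 1) = q \<and> ?v (2 * x p) = p"
        using wv by metis
      then show "?f ((\<lambda>(p, q). x p) pq) = pq"
        using *(2) pq by (auto simp: min_def max_def)
    qed
  qed
  then show ?thesis
    by (simp add: bij_betw_same_card[symmetric])
qed

text \<open>A pair of places is an inversion of \<open>x\<close>, or after reflection one of the
  reversal \<open>y\<close>, or it carries equal letters; and m(2m - 1) - m = 2(m^2 - m).\<close>

private lemma inversions_word_add: "inversions (2 * m) x + inversions (2 * m) y = 2 * (m\<^sup>2 - m)"
proof -
  let ?n = "2 * m"
  let ?lt = "{(p, q). 1 \<le> p \<and> p < q \<and> q \<le> ?n \<and> x p < x q}"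
  let ?eq = "{(p, q). 1 \<le> p \<and> p < q \<and> q \<le> ?n \<and> x p = x q}"
  let ?f = "\<lambda>(p, q). (?n + 1 - q, ?n + 1 - p)"
  have fin: "finite ?lt" "finite ?eq"
    by (rule finite_subset[of _ "{1..?n} \<times> {1..?n}"]; auto)+
  have "bij_betw ?f (inversion_set ?n y) ?lt"
    by (rule bij_betw_byWitness[where f' = ?f]) (auto simp: inversion_set_def y_def)
  then have y: "card (inversion_set ?n y) = card ?lt"
    by (rule bij_betw_same_card)
  have "{(p, q). 1 \<le> p \<and> p < q \<and> q \<le> ?n} = inversion_set ?n x \<union> ?lt \<union> ?eq"
    by (auto simp: inversion_set_def)
  then have "?n * (?n - 1) div 2 = card (inversion_set ?n x \<union> ?lt \<union> ?eq)"
    using card_increasing_pairs[of ?n] by simp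
  also have "\<dots> = card (inversion_set ?n x) + card ?lt + card ?eq"
  proof -
    have "inversion_set ?n x \<inter> ?lt = {}" "(inversion_set ?n x \<union> ?lt) \<inter> ?eq = {}"
      by (auto simp: inversion_set_def)
    then show ?thesis
      by (simp only: card_Un_disjoint fin finite_inversion_set finite_UnI)
  qed
  finally have "inversions ?n x + inversions ?n y = ?n * (?n - 1) div 2 - m"
    using card_same_letter y by (simp add: inversions_eq_card)
  also have "\<dots> = 2 * (m\<^sup>2 - m)"
    by (cases m) (auto simp: power2_eq_square algebra_simps)
  finally show ?thesis .
qed

private lemma word_subset: "inversion_set (2 * m) x \<subseteq> inversion_set (2 * m) w"
  by (auto simp: inversion_set_def x_def)

text \<open>The word is a palindrome here, so its two inversion numbers agree and are half of their
  sum. Within a letter the odd value comes first, so \<open>w\<close> has no further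
  inversions.\<close>

lemma inversions_strictly_pairing:
  assumes sp: "strictly_pairing m w"
  shows "inversions (2 * m) w = m\<^sup>2 - m"
proof -
  have mirror: "x (2 * m + 1 - i) = x i" if "i \<in> {1..m}" for i
    using sp that unfolding strictly_pairing_def x_def by auto
  have "y i = x i" if "i \<in> {1..2 * m}" for i
  proof (cases "i \<le> m")
    case False
    then have "2 * m + 1 - i \<in> {1..m}" "2 * m + 1 - (2 * m + 1 - i) = i"
      using that by auto
    then show ?thesis
      using mirror[of "2 * m + 1 - i"] by (simp add: y_def)
  qed (use mirror that in \<open>auto simp: y_def\<close>)
  then have "inversion_set (2 * m) x = inversion_set (2 * m) y"
    by (auto simp: inversion_set_def)
  then have xval: "inversions (2 * m) x = m\<^sup>2 - m"
    using inversions_word_add by (simp add: inversions_eq_card)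
  have "inversion_set (2 * m) w \<subseteq> inversion_set (2 * m) x"
  proof
    fix pq
    assume "pq \<in> inversion_set (2 * m) w"
    then obtain p q where pq: "pq = (p, q)" "1 \<le> p" "p < q" "q \<le> 2 * m" "w q < w p"
      by (auto simp: inversion_set_def)
    \<comment> \<open>With equal letters the even value would stand first, at \<open>p\<close>. But
      even values fill the right half and their odd partners the left half, so \<open>q\<close> = 2m
      + 1 - p would precede \<open>p\<close>.\<close>
    have "x p \<noteq> x q"
    proof
      assume eq: "x p = x q"
      then have "even (w p)"
        using pq(5) unfolding x_def by presburger
      then have "p > m"
        using sp pq unfolding strictly_pairing_def by (meson atLeastAtMost_iff not_le_imp_less)
      then have "2 * m + 1 - p \<in> {1..m}" "2 * m + 1 - (2 * m + 1 - p) = p"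
        using pq by auto
      then have "odd (w (2 * m + 1 - p))" "w p = w (2 * m + 1 - p) + 1"
        using sp unfolding strictly_pairing_def by fastforce+
      then have "w q = w (2 * m + 1 - p)"
        using eq pq(5) unfolding x_def by presburger
      then show False
        using \<open>p > m\<close> pq by (simp add: w_inj)
    qed
    then show "pq \<in> inversion_set (2 * m) x"
      using pq unfolding inversion_set_def x_def by auto
  qed
  with word_subset xval show ?thesis
    by (metis inversions_eq_card subset_antisym)
qed

text \<open>The total count at threshold 2k is 2k, so the hypothesis bounds the prefix counts of
  \<open>x\<close> by those of its reversal, the complement of a prefix being a reversed
  prefix.\<close>

lemma inversions_ge_if_symmetric_ranks:
  assumes rank: "\<And>p k. p \<le> 2 * m \<Longrightarrow> k \<le> m \<Longrightarrow>
      prefix_count w p (2 * k) + prefix_count w (2 * m - p) (2 * k) \<le> 2 * k"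
  shows "m\<^sup>2 - m \<le> inversions (2 * m) w"
    and "inversions (2 * m) w = m\<^sup>2 - m \<Longrightarrow> strictly_pairing m w"
proof -
  let ?n = "2 * m"
  have xw: "prefix_count x p k = prefix_count w p (2 * k)" for p k
    unfolding prefix_count_def x_le_iff ..
  have total: "prefix_count w ?n (2 * k) = 2 * k" if "k \<le> m" for k
  proof -
    have "w ` {i \<in> {1..?n}. w i \<le> 2 * k} = {1..2 * k}"
    proof (intro subset_antisym subsetI)
      fix j
      assume j: "j \<in> {1..2 * k}"
      then have "j \<in> w ` {1..?n}"
        using permutes_image[OF w] that by auto
      with j show "j \<in> w ` {i \<in> {1..?n}. w i \<le> 2 * k}"
        by auto
    qed (use w_in in force)
    then show ?thesis
      unfolding prefix_count_def
      by (metis (no_types, lifting) card_atLeastAtMost card_image diff_Suc_1 inj_on_def w_inj)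
  qed
  have y_count: "prefix_count y p k + prefix_count x (?n - p) k = prefix_count x ?n k" if "p \<le> ?n" for p k
  proof -
    let ?A = "{i \<in> {1..p}. y i \<le> k}" and ?B = "{i \<in> {?n + 1 - p..?n}. x i \<le> k}"
    have "bij_betw (\<lambda>i. ?n + 1 - i) ?A ?B"
      by (rule bij_betw_byWitness[where f' = "\<lambda>i. ?n + 1 - i"]) (use that in \<open>auto simp: y_def\<close>)
    then have "prefix_count y p k = card ?B"
      unfolding prefix_count_def by (rule bij_betw_same_card)
    moreover have "{i \<in> {1..?n}. x i \<le> k} = ?B \<union> {i \<in> {1..?n - p}. x i \<le> k}"
      using that by auto
    moreover have "card (?B \<union> {i \<in> {1..?n - p}. x i \<le> k}) = card ?B + card {i \<in> {1..?n - p}. x i \<le> k}"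
      by (intro card_Un_disjoint) auto
    ultimately show ?thesis
      unfolding prefix_count_def by simp
  qed
  have all: "prefix_count z p k = p" if "\<And>i. i \<in> {1..p} \<Longrightarrow> z i \<le> k" for z p k
  proof -
    have "{i \<in> {1..p}. z i \<le> k} = {1..p}"
      using that by auto
    then show ?thesis
      by (simp add: prefix_count_def)
  qed
  have x_le: "x i \<le> m" if "i \<in> {1..?n}" for i
    using w_in[OF that] by (auto simp: x_le_iff)
  have dom: "prefix_count x p k \<le> prefix_count y p k" if "p \<le> ?n" for p k
  proof (cases "k \<le> m")
    case True
    then show ?thesis
      using rank[OF that True] y_count[OF that, of k] total[OF True] by (simp add: xw)
  next
    case False
    \<comment> \<open>Letters are at most \<open>m\<close>, so larger thresholds count every
      place.\<close>
    have "prefix_count x p k = p" "prefix_count y p k = p"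
      using False that by (intro all order.trans[OF x_le]; force simp: y_def intro!: order.trans[OF x_le])+
    then show ?thesis
      by simp
  qed
  have tot: "prefix_count x ?n k = prefix_count y ?n k" for k
    using y_count[of ?n k] by (simp add: prefix_count_def)
  note mono = inversions_bruhat_mono[of ?n x y, OF dom tot]
  have wx: "inversions ?n x \<le> inversions ?n w"
    unfolding inversions_eq_card by (intro card_mono word_subset) auto
  show "m\<^sup>2 - m \<le> inversions ?n w"
    using mono wx inversions_word_add by linarith
  \<comment> \<open>Equality throughout: \<open>x\<close> is its own reversal and every inversion of
    \<open>w\<close> is one of \<open>x\<close>, so mirrored places carry the two values of one
    letter in increasing order.\<close>
  assume eq: "inversions ?n w = m\<^sup>2 - m"
  then have "inversions ?n x = inversions ?n y" "inversions ?n x = inversions ?n w"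
    using mono wx inversions_word_add by linarith+
  then have xy: "\<forall>i\<in>{1..?n}. y i = x i" and "inversion_set ?n x = inversion_set ?n w"
    using mono card_subset_eq[OF _ word_subset] by (auto simp: inversions_eq_card)
  show "strictly_pairing m w"
    unfolding strictly_pairing_def
  proof
    fix i
    assume i: "i \<in> {1..m}"
    let ?j = "?n + 1 - i"
    have "x ?j = x i"
      using xy i by (auto simp: y_def)
    moreover have "(i, ?j) \<notin> inversion_set ?n w"
      using \<open>x ?j = x i\<close> \<open>inversion_set ?n x = _\<close>[symmetric] by (auto simp: inversion_set_def)
    then have "w i \<le> w ?j"
      using i by (auto simp: inversion_set_def)
    moreover have "w i \<noteq> w ?j"
      using i by (auto simp: w_inj)
    ultimately show "odd (w i) \<and> w ?j = w i + 1"
      unfolding x_def by presburger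
  qed
qed

end

subsection \<open>Uniqueness of the complex dimension\<close>

lemma topspace_complex_space: "topspace (complex_space d) = PiE {..<d} (\<lambda>_. UNIV)"
  by (simp add: complex_space_def)

text \<open>Real and imaginary parts are interleaved as coordinates 2i and 2i + 1, to bring in
  invariance of domain for \<open>Euclidean_space\<close>. Points of the latter are padded with 0,
  those of \<open>complex_space\<close> with \<open>undefined\<close>.\<close>

lemma homeomorphic_complex_space_Euclidean_space:
  "complex_space d homeomorphic_space Euclidean_space (2 * d)"
proof -
  let ?f = "\<lambda>(x::nat \<Rightarrow> complex) i. if i < 2 * d then (if even i then Re (x (i div 2)) else Im (x (i div 2))) else 0"
  let ?g = "\<lambda>(y::nat \<Rightarrow> real). \<lambda>i\<in>{..<d}. Complex (y (2 * i)) (y (2 * i + 1))"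
  have proj: "continuous_map (complex_space d) euclidean (\<lambda>x. x i)" if "i < d" for i
    unfolding complex_space_def using that by (intro continuous_map_product_projection) auto
  have f: "continuous_map (complex_space d) (Euclidean_space (2 * d)) ?f"
    unfolding continuous_map_componentwise_Euclidean_space
  proof (intro allI impI)
    fix i
    assume "i < 2 * d"
    then have c: "continuous_map (complex_space d) euclidean (\<lambda>x. x (i div 2))"
      by (intro proj) auto
    have "continuous_map (complex_space d) euclideanreal (Re \<circ> (\<lambda>x. x (i div 2)))"
      "continuous_map (complex_space d) euclideanreal (Im \<circ> (\<lambda>x. x (i div 2)))"
      by (rule continuous_map_compose[OF c], simp add: continuous_on_Re continuous_on_Im continuous_on_id)+
    then show "continuous_map (complex_space d) euclideanreal
        (\<lambda>x. if even i then Re (x (i div 2)) else Im (x (i div 2)))"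
      by (auto simp: o_def)
  qed
  have coord: "continuous_map (Euclidean_space (2 * d)) euclideanreal (\<lambda>y. y i)" for i
    unfolding Euclidean_space_def
    by (rule continuous_map_from_subtopology, rule continuous_map_product_projection) auto
  have g: "continuous_map (Euclidean_space (2 * d)) (complex_space d) ?g"
    unfolding complex_space_def continuous_map_componentwise
  proof (intro conjI ballI)
    fix i
    assume "i \<in> {..<d}"
    have "continuous_map (Euclidean_space (2 * d)) euclidean
        (\<lambda>y. of_real (y (2 * i)) + \<i> * of_real (y (2 * i + 1)) :: complex)"
    proof -
      have "continuous_on UNIV (\<lambda>z. of_real z :: complex)" "continuous_on UNIV (\<lambda>z. \<i> * of_real z)"
        by (rule continuous_on_mult_left continuous_on_of_real continuous_on_id)+
      then have "continuous_map (Euclidean_space (2 * d)) euclidean (\<lambda>y. of_real (y j) :: complex)"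
        "continuous_map (Euclidean_space (2 * d)) euclidean (\<lambda>y. \<i> * of_real (y j))" for j
        using continuous_map_compose[OF coord[of j], of euclidean "\<lambda>z. of_real z :: complex"]
          continuous_map_compose[OF coord[of j], of euclidean "\<lambda>z. \<i> * of_real z :: complex"]
        by (simp_all add: o_def)
      then show ?thesis
        by (intro continuous_map_add)
    qed
    then show "continuous_map (Euclidean_space (2 * d)) euclidean (\<lambda>y. ?g y i)"
      using \<open>i \<in> _\<close> by (simp add: Complex_eq)
  qed auto
  have "homeomorphic_maps (complex_space d) (Euclidean_space (2 * d)) ?f ?g"
    unfolding homeomorphic_maps_def
  proof (intro conjI ballI f g)
    fix x
    assume "x \<in> topspace (complex_space d)"
    then show "?g (?f x) = x"
      by (auto simp: topspace_complex_space fun_eq_iff PiE_def extensional_def)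
  next
    fix y
    assume "y \<in> topspace (Euclidean_space (2 * d))"
    then have y0: "y i = 0" if "i \<ge> 2 * d" for i
      using that by (auto simp: topspace_Euclidean_space)
    show "?f (?g y) = y"
    proof
      fix i
      show "?f (?g y) i = y i"
        using y0[of i] by (cases "i < 2 * d") (auto elim!: evenE oddE)
    qed
  qed
  then show ?thesis
    by (rule homeomorphic_maps_imp_homeomorphic_space)
qed

text \<open>If n < m, the image lies in the coordinate subspace R^n of R^m and is yet open in R^m by
  invariance of domain; a line in the direction of the last coordinate would meet it in a single
  point.\<close>

lemma homeomorphic_open_Euclidean_space_dim_le:
  assumes "openin (Euclidean_space m) U" "openin (Euclidean_space n) V" "U \<noteq> {}"
    and hom: "subtopology (Euclidean_space m) U homeomorphic_space subtopology (Euclidean_space n) V"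
  shows "m \<le> n"
proof (rule ccontr)
  assume "\<not> m \<le> n"
  then have nm: "n < m"
    by simp
  obtain f where f: "homeomorphic_map (subtopology (Euclidean_space m) U) (subtopology (Euclidean_space n) V) f"
    using hom homeomorphic_space by blast
  have Usub: "U \<subseteq> topspace (Euclidean_space m)"
    using assms(1) openin_subset by blast
  have sub: "Euclidean_space n = subtopology (Euclidean_space m) (topspace (Euclidean_space n))"
    by (metis Euclidean_space_def nm less_imp_le inf.absorb_iff2 subset_Euclidean_space subtopology_subtopology
        topspace_Euclidean_space)
  have cn: "continuous_map (subtopology (Euclidean_space m) U) (Euclidean_space n) f"
    using f homeomorphic_imp_continuous_map continuous_map_into_fulltopology by blast
  then have "continuous_map (subtopology (Euclidean_space m) U) (Euclidean_space m) f"
    by (metis sub continuous_map_into_fulltopology)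
  moreover have "inj_on f U"
    using homeomorphic_imp_injective_map[OF f] Usub by (simp add: Int_absorb1)
  ultimately have op: "openin (Euclidean_space m) (f ` U)"
    using assms(1) invariance_of_domain_Euclidean_space by blast
  obtain u where "u \<in> U"
    using assms(3) by blast
  define y where "y = f u"
  have y0: "z i = 0" if "z \<in> f ` U" "i \<ge> n" for z i
    using continuous_map_image_subset_topspace[OF cn] that Usub
    by (force simp: topspace_Euclidean_space Int_absorb1)
  have fm: "z (m - 1) = 0" if "z \<in> f ` U" for z
    using y0[OF that] nm by simp
  let ?h = "\<lambda>t::real. \<lambda>i. if i < m then (if i = m - 1 then t else y i) else 0"
  have "continuous_map euclideanreal (Euclidean_space m) ?h"
    unfolding continuous_map_componentwise_Euclidean_space by (auto intro: continuous_intros)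
  then have "open {t. ?h t \<in> f ` U}"
    using openin_continuous_map_preimage[of euclideanreal "Euclidean_space m" ?h, OF _ op] by simp
  moreover have "{t. ?h t \<in> f ` U} = {0}"
  proof (intro subset_antisym subsetI)
    fix t
    assume "t \<in> {t. ?h t \<in> f ` U}"
    then have "?h t (m - 1) = 0"
      using fm by blast
    then show "t \<in> {0}"
      using nm by simp
  next
    fix t :: real
    assume "t \<in> {0}"
    have y: "y \<in> f ` U"
      using \<open>u \<in> U\<close> by (simp add: y_def)
    have "?h t i = y i" for i
      using y0[OF y, of i] nm \<open>t \<in> {0}\<close> by (cases "i < n") auto
    then have "?h t = y"
      by (rule ext)
    with y show "t \<in> {t. ?h t \<in> f ` U}"
      by simp
  qed
  ultimately have "open {0::real}"
    by simp
  then show False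
    using not_open_singleton by blast
qed

lemma homeomorphic_open_complex_space_dim_eq:
  assumes U: "openin (complex_space d) U" and V: "openin (complex_space e) V" and ne: "U \<noteq> {}"
    and hom: "subtopology (complex_space d) U homeomorphic_space subtopology (complex_space e) V"
  shows "d = e"
proof -
  have transfer: "\<exists>W. openin (Euclidean_space (2 * d)) W \<and> (W \<noteq> {} \<longleftrightarrow> U \<noteq> {}) \<and>
      subtopology (complex_space d) U homeomorphic_space subtopology (Euclidean_space (2 * d)) W"
    if U: "openin (complex_space d) U" for d U
  proof -
    obtain f where f: "homeomorphic_map (complex_space d) (Euclidean_space (2 * d)) f"
      using homeomorphic_complex_space_Euclidean_space homeomorphic_space by blast
    have "homeomorphic_map (subtopology (complex_space d) U) (subtopology (Euclidean_space (2 * d)) (f ` U)) f"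
      using openin_subset[OF U] homeomorphic_imp_surjective_map[OF f]
      by (intro homeomorphic_map_subtopologies[OF f]) blast
    moreover have "openin (Euclidean_space (2 * d)) (f ` U)"
      using homeomorphic_map_openness_eq[OF f] U by blast
    ultimately show ?thesis
      using homeomorphic_map_imp_homeomorphic_space by blast
  qed
  obtain W W' where W: "openin (Euclidean_space (2 * d)) W" "W \<noteq> {}"
      "subtopology (complex_space d) U homeomorphic_space subtopology (Euclidean_space (2 * d)) W"
    and W': "openin (Euclidean_space (2 * e)) W'" "W' \<noteq> {} \<longleftrightarrow> V \<noteq> {}"
      "subtopology (complex_space e) V homeomorphic_space subtopology (Euclidean_space (2 * e)) W'"
    using transfer[OF U] transfer[OF V] ne by blast
  have WW: "subtopology (Euclidean_space (2 * d)) W homeomorphic_space subtopology (Euclidean_space (2 * e)) W'"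
    using homeomorphic_space_trans[OF W(3)[unfolded homeomorphic_space_sym[of "subtopology (complex_space d) U"]]
        homeomorphic_space_trans[OF hom W'(3)]] .
  have "topspace (subtopology (Euclidean_space (2 * d)) W) \<noteq> {}"
    using W(2) openin_subset[OF W(1)] by auto
  then have "subtopology (Euclidean_space (2 * e)) W' \<noteq> trivial_topology"
    using homeomorphic_empty_space[OF WW] by (metis null_topspace_iff_trivial)
  then have "W' \<noteq> {}"
    by auto
  have "2 * d \<le> 2 * e"
    using W(1) W'(1) W(2) WW by (rule homeomorphic_open_Euclidean_space_dim_le)
  moreover have "2 * e \<le> 2 * d"
    using W'(1) W(1) \<open>W' \<noteq> {}\<close> WW[unfolded homeomorphic_space_sym[of "subtopology (Euclidean_space (2 * d)) W"]]
    by (rule homeomorphic_open_Euclidean_space_dim_le)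
  ultimately show ?thesis
    by simp
qed

lemma homeomorphic_complex_open_subset:
  assumes V: "openin (complex_space d) V"
    and hom: "subtopology X U homeomorphic_space subtopology (complex_space d) V"
    and U: "openin X U" and W: "openin X W" "W \<subseteq> U"
  obtains V' where "openin (complex_space d) V'"
    "subtopology X W homeomorphic_space subtopology (complex_space d) V'"
proof -
  obtain f where f: "homeomorphic_map (subtopology X U) (subtopology (complex_space d) V) f"
    using hom homeomorphic_space by blast
  have ts: "topspace (subtopology X U) = U" "topspace (subtopology (complex_space d) V) = V"
    using openin_subset[OF U] openin_subset[OF V] by auto
  have "openin (subtopology X U) W"
    using W U openin_open_subtopology by blast
  then have "openin (subtopology (complex_space d) V) (f ` W)"
    by (simp only: homeomorphic_map_openness_eq[OF f, of W])
  then have op: "openin (complex_space d) (f ` W)" and sub: "f ` W \<subseteq> V"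
    by (simp_all only: openin_open_subtopology[OF V])
  have UW: "topspace (subtopology X U) \<inter> W = W" "topspace (subtopology (complex_space d) V) \<inter> f ` W = f ` W"
    unfolding ts using W sub by blast+
  have "homeomorphic_map (subtopology (subtopology X U) W)
      (subtopology (subtopology (complex_space d) V) (f ` W)) f"
    by (rule homeomorphic_map_subtopologies[OF f]) (simp only: UW)
  then have "homeomorphic_map (subtopology X W) (subtopology (complex_space d) (f ` W)) f"
    using sub W(2) by (simp only: subtopology_subtopology Int_absorb1)
  then have "subtopology X W homeomorphic_space subtopology (complex_space d) (f ` W)"
    by (rule homeomorphic_map_imp_homeomorphic_space)
  with op show ?thesis
    by (rule that)
qed

lemma locally_complex_open_subtopology:
  assumes loc: "locally_complex d X" and W: "openin X W"
  shows "locally_complex d (subtopology X W)"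
  unfolding locally_complex_def
proof
  fix x
  assume "x \<in> topspace (subtopology X W)"
  then have x: "x \<in> topspace X" "x \<in> W"
    by auto
  then obtain U V where U: "openin X U" "x \<in> U" "openin (complex_space d) V"
    "subtopology X U homeomorphic_space subtopology (complex_space d) V"
    using loc unfolding locally_complex_def by blast
  obtain V' where "openin (complex_space d) V'"
    "subtopology X (U \<inter> W) homeomorphic_space subtopology (complex_space d) V'"
    using homeomorphic_complex_open_subset[OF U(3,4,1), of "U \<inter> W"] U(1) W by blast
  moreover have "openin (subtopology X W) (U \<inter> W)" "x \<in> U \<inter> W" "W \<inter> (U \<inter> W) = U \<inter> W"
    using U(1,2) x(2) openin_subtopology_Int by auto
  ultimately show "\<exists>U V. openin (subtopology X W) U \<and> x \<in> U \<and> openin (complex_space d) V \<and>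
      subtopology (subtopology X W) U homeomorphic_space subtopology (complex_space d) V"
    unfolding subtopology_subtopology by metis
qed

text \<open>On the intersection of two charts at \<open>x\<close>, nonempty open pieces of both
  model spaces are homeomorphic.\<close>

lemma locally_complex_dim_unique:
  assumes d: "locally_complex d X" and e: "locally_complex e X" and x: "x \<in> topspace X"
  shows "d = e"
proof -
  obtain U V where U: "openin X U" "x \<in> U" "openin (complex_space d) V"
    "subtopology X U homeomorphic_space subtopology (complex_space d) V"
    using d x unfolding locally_complex_def by blast
  obtain U' V' where U': "openin X U'" "x \<in> U'" "openin (complex_space e) V'"
    "subtopology X U' homeomorphic_space subtopology (complex_space e) V'"
    using e x unfolding locally_complex_def by blast
  let ?W = "U \<inter> U'"
  have W: "openin X ?W"
    using U U' by blast
  obtain T where T: "openin (complex_space d) T"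
    "subtopology X ?W homeomorphic_space subtopology (complex_space d) T"
    using homeomorphic_complex_open_subset[OF U(3,4,1) W] by blast
  obtain T' where T': "openin (complex_space e) T'"
    "subtopology X ?W homeomorphic_space subtopology (complex_space e) T'"
    using homeomorphic_complex_open_subset[OF U'(3,4,1) W] by blast
  have "x \<in> topspace (subtopology X ?W)"
    using U U' x by simp
  then have "subtopology X ?W \<noteq> trivial_topology"
    by (metis empty_iff null_topspace_iff_trivial)
  then have "T \<noteq> {}"
    using homeomorphic_empty_space[OF T(2)] by auto
  then show ?thesis
    using homeomorphic_open_complex_space_dim_eq[OF T(1) T'(1)] T(2) T'(2)
      homeomorphic_space_sym homeomorphic_space_trans by blast
qed

text \<open>Two dense relatively open pieces of \<open>A\<close> meet, and their intersection is
  open in each, so it carries both dimensions.\<close>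

lemma has_complex_dim_unique:
  assumes A: "A \<subseteq> topspace X" "A \<noteq> {}" and d: "has_complex_dim X A d" and e: "has_complex_dim X A e"
  shows "d = e"
proof -
  obtain M where M: "openin (subtopology X A) M" "A \<subseteq> X closure_of M" "locally_complex d (subtopology X M)"
    using d unfolding has_complex_dim_def by blast
  obtain N where N: "openin (subtopology X A) N" "A \<subseteq> X closure_of N" "locally_complex e (subtopology X N)"
    using e unfolding has_complex_dim_def by blast
  obtain P where P: "openin X P" "M = P \<inter> A"
    using M(1) unfolding openin_subtopology by blast
  obtain Q where Q: "openin X Q" "N = Q \<inter> A"
    using N(1) unfolding openin_subtopology by blast
  have "M \<noteq> {}"
    using A(2) M(2) by auto
  then obtain a where "a \<in> P" "a \<in> X closure_of N"
    using P N(2) by auto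
  then obtain x where x: "x \<in> M" "x \<in> N"
    using P Q unfolding in_closure_of by blast
  have "openin (subtopology X M) (M \<inter> N)" "openin (subtopology X N) (M \<inter> N)"
    unfolding openin_subtopology using P Q by blast+
  then have "locally_complex d (subtopology (subtopology X M) (M \<inter> N))"
    "locally_complex e (subtopology (subtopology X N) (M \<inter> N))"
    using locally_complex_open_subtopology[OF M(3)] locally_complex_open_subtopology[OF N(3)] by simp_all
  moreover have "M \<inter> (M \<inter> N) = M \<inter> N" "N \<inter> (M \<inter> N) = M \<inter> N"
    by blast+
  ultimately have "locally_complex d (subtopology X (M \<inter> N))" "locally_complex e (subtopology X (M \<inter> N))"
    unfolding subtopology_subtopology by simp_all
  moreover have "x \<in> topspace (subtopology X (M \<inter> N))"
    using x P A by auto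
  ultimately show ?thesis
    by (rule locally_complex_dim_unique)
qed

lemma complex_dim_eqI:
  "\<lbrakk>has_complex_dim X A d; A \<subseteq> topspace X; A \<noteq> {}\<rbrakk> \<Longrightarrow> complex_dim X A = d"
  unfolding complex_dim_def using has_complex_dim_unique by blast

subsection \<open>Linear algebra in the Iwasawa basis\<close>

text \<open>Up to sign the Iwasawa basis is the standard one: \<open>u_vec j\<close> is
  \<open>u_sign j\<close> times the unit vector at \<open>u_index j\<close>, the sign coming from
  j(e_i) = -e_{m+i}. As the sign is its own inverse, \<open>u_coord\<close> reads off coordinates
  with the same factor.\<close>

definition u_index :: "nat \<Rightarrow> 'm::{finite,linorder} + 'm" where
  "u_index j = (if odd j then Inl (sorted_list_of_set UNIV ! ((j + 1) div 2 - 1))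
    else Inr (sorted_list_of_set UNIV ! (j div 2 - 1)))"

definition u_sign :: "nat \<Rightarrow> complex" where
  "u_sign j = (if odd j then 1 else - 1)"

definition u_coord :: "nat \<Rightarrow> 'm::{finite,linorder} cvec \<Rightarrow> complex" where
  "u_coord j v = u_sign j * v $ u_index j"

lemma u_sign_mult [simp]: "u_sign j * u_sign j = 1" "u_sign j \<noteq> 0"
  by (auto simp: u_sign_def)

lemma jmap_axis_Inl: "jmap (axis (Inl i) 1) = - axis (Inr (i :: 'm::finite)) (1::complex)"
proof -
  have "cnj_vec (axis (Inl i) 1) = (axis (Inl i) 1 :: 'm cvec)"
    by (auto simp: cnj_vec_def axis_def vec_eq_iff)
  then have "jmap (axis (Inl i) 1) $ a = J_mat $ a $ Inl i" for a
    by (simp add: jmap_def matrix_vector_mult_def axis_def if_distrib[of "(*) _"] cong: if_cong)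
  then show ?thesis
    by (auto simp: vec_eq_iff J_mat_def axis_def split: sum.split)
qed

lemma u_vec_axis: "u_vec j = u_sign j *s axis (u_index j) 1"
  unfolding u_vec_def u_sign_def u_index_def e_vec_def
  by (auto simp: jmap_axis_Inl vec_eq_iff)

lemma bij_betw_u_index: "bij_betw u_index {1..2 * CARD('m)} (UNIV :: ('m::{finite,linorder} + 'm) set)"
proof -
  let ?s = "sorted_list_of_set (UNIV :: 'm set)"
  have s: "bij_betw ((!) ?s) {..<CARD('m)} UNIV"
    by (rule bij_betw_nth) auto
  have "inj_on (u_index :: nat \<Rightarrow> 'm + 'm) {1..2 * CARD('m)}"
  proof (rule inj_onI)
    fix i j
    assume ij: "i \<in> {1..2 * CARD('m)}" "j \<in> {1..2 * CARD('m)}" "(u_index i :: 'm + 'm) = u_index j"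
    have d: "k div 2 - 1 < CARD('m)" "(k + 1) div 2 - 1 < CARD('m)" if "k \<in> {1..2 * CARD('m)}" for k
      using that by auto
    have *: "a = b" if "?s ! a = ?s ! b" "a < CARD('m)" "b < CARD('m)" for a b
      using bij_betw_imp_inj_on[OF s] that by (auto dest: inj_onD)
    show "i = j"
    proof (cases "odd i")
      case True
      with ij have "odd j" "?s ! ((i + 1) div 2 - 1) = ?s ! ((j + 1) div 2 - 1)"
        by (auto simp: u_index_def split: if_splits)
      with *[OF this(2) d(2) d(2)] ij True show ?thesis
        by (auto elim!: oddE)
    next
      case False
      with ij have "even j" "?s ! (i div 2 - 1) = ?s ! (j div 2 - 1)"
        by (auto simp: u_index_def split: if_splits)
      with *[OF this(2) d(1) d(1)] ij False show ?thesis
        by (auto elim!: evenE)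
    qed
  qed
  moreover have "card (u_index ` {1..2 * CARD('m)} :: ('m + 'm) set) = CARD('m + 'm)"
    using card_image[OF calculation] by simp
  then have "(u_index ` {1..2 * CARD('m)} :: ('m + 'm) set) = UNIV"
    by (intro card_subset_eq) auto
  ultimately show ?thesis
    by (simp add: bij_betw_def)
qed

lemma u_index_eq_iff:
  "i \<in> {1..2 * CARD('m)} \<Longrightarrow> j \<in> {1..2 * CARD('m)} \<Longrightarrow>
    (u_index i :: 'm::{finite,linorder} + 'm) = u_index j \<longleftrightarrow> i = j"
  using bij_betw_imp_inj_on[OF bij_betw_u_index] by (auto dest: inj_onD)

lemma u_coord_u_vec:
  assumes "i \<in> {1..2 * CARD('m)}" "j \<in> {1..2 * CARD('m)}"
  shows "u_coord i (u_vec j :: 'm::{finite,linorder} cvec) = (if i = j then 1 else 0)"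
  unfolding u_coord_def u_vec_axis using u_index_eq_iff[OF assms] by (simp add: axis_def)

lemma u_coord_add [simp]: "u_coord j (v + w) = u_coord j v + u_coord j w"
  and u_coord_diff [simp]: "u_coord j (v - w) = u_coord j v - u_coord j w"
  and u_coord_scale [simp]: "u_coord j (c *s v) = c * u_coord j v"
  and u_coord_0 [simp]: "u_coord j 0 = 0"
  by (simp_all add: u_coord_def algebra_simps)

lemma u_coord_sum: "u_coord j (sum f A) = (\<Sum>a\<in>A. u_coord j (f a))"
  by (induction A rule: infinite_finite_induct) auto

lemma u_coord_expand: "v = (\<Sum>j = 1..2 * CARD('m). u_coord j v *s u_vec j)"
  for v :: "'m::{finite,linorder} cvec"
proof -
  have "(\<Sum>j = 1..2 * CARD('m). u_coord j v *s u_vec j) $ a = v $ a" for a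
  proof -
    have "(\<Sum>j = 1..2 * CARD('m). u_coord j v *s u_vec j) $ a =
        (\<Sum>j = 1..2 * CARD('m). v $ u_index j * (if u_index j = a then 1 else 0))"
      unfolding sum_component
    proof (rule sum.cong[OF refl])
      fix j
      have "u_sign j * (v $ u_index j) * u_sign j = v $ u_index j"
        using u_sign_mult(1)[of j] by (simp add: mult.commute mult.left_commute)
      then show "(u_coord j v *s u_vec j) $ a = v $ u_index j * (if u_index j = a then 1 else 0)"
        by (simp add: u_coord_def u_vec_axis axis_def mult.assoc[symmetric])
    qed
    also have "\<dots> = (\<Sum>b\<in>UNIV. v $ b * (if b = a then 1 else 0))"
      by (rule sum.reindex_bij_betw[OF bij_betw_u_index])
    also have "\<dots> = v $ a"
      by (simp add: if_distrib[of "(*) _"] cong: if_cong)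
    finally show ?thesis .
  qed
  then have "(\<Sum>j = 1..2 * CARD('m). u_coord j v *s u_vec j) = v"
    by (intro vec_eq_iff[THEN iffD2] allI)
  then show ?thesis
    by (rule sym)
qed

lemma u_coord_eqI:
  "(\<And>j. j \<in> {1..2 * CARD('m)} \<Longrightarrow> u_coord j v = u_coord j w) \<Longrightarrow> v = (w :: 'm::{finite,linorder} cvec)"
  by (subst u_coord_expand, subst (2) u_coord_expand) (auto intro: sum.cong)

section \<open>Frames as matrices: the endomorphism that takes each u_j to b_j\<close>

definition frame_matrix :: "(nat \<Rightarrow> 'm::{finite,linorder} cvec) \<Rightarrow> 'm cmat" where
  "frame_matrix b = (\<chi> r c. \<Sum>j = 1..2 * CARD('m). b j $ r * u_coord j (axis c 1))"

lemma frame_matrix_mult: "frame_matrix b *v v = (\<Sum>j = 1..2 * CARD('m). u_coord j v *s b j)"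
  for v :: "'m::{finite,linorder} cvec"
proof -
  have v: "(\<Sum>c\<in>UNIV. u_coord j (axis c 1) * v $ c) = u_coord j v" for j
  proof -
    have "(\<Sum>c\<in>UNIV. u_coord j (axis c 1) * v $ c) = (\<Sum>c\<in>UNIV. if c = u_index j then u_sign j * v $ c else 0)"
      by (rule sum.cong) (auto simp: u_coord_def axis_def)
    then show ?thesis
      by (simp add: u_coord_def)
  qed
  have "(frame_matrix b *v v) $ r = (\<Sum>j = 1..2 * CARD('m). b j $ r * u_coord j v)" for r
    unfolding frame_matrix_def matrix_vector_mult_def v[symmetric] sum_distrib_left
    by (simp add: sum_distrib_right mult.assoc) (rule sum.swap)
  then show ?thesis
    by (simp add: vec_eq_iff mult.commute)
qed

lemma frame_matrix_u_vec [simp]: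
  assumes "j \<in> {1..2 * CARD('m)}"
  shows "frame_matrix b *v u_vec j = (b j :: 'm::{finite,linorder} cvec)"
proof -
  have "(\<Sum>i = 1..2 * CARD('m). u_coord i (u_vec j :: 'm cvec) *s b i) =
      (\<Sum>i = 1..2 * CARD('m). if i = j then b i else 0)"
    by (rule sum.cong) (use assms in \<open>auto simp: u_coord_u_vec\<close>)
  then show ?thesis
    using assms by (simp add: frame_matrix_mult)
qed

lemma matrix_vector_mult_sum: "A *v sum f S = (\<Sum>x\<in>S. A *v f x)" for A :: "complex^'n^'k"
  by (induction S rule: infinite_finite_induct) (auto simp: matrix_vector_right_distrib)

lemma matrix_eq_on_u_vec:
  assumes "\<And>j. j \<in> {1..2 * CARD('m)} \<Longrightarrow> A *v u_vec j = B *v u_vec j"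
  shows "A = (B :: 'm::{finite,linorder} cmat)"
proof -
  have "A *v v = B *v v" for v
  proof -
    have "A *v v = (\<Sum>j = 1..2 * CARD('m). u_coord j v *s (A *v u_vec j))"
      by (subst u_coord_expand) (simp only: matrix_vector_mult_sum vector_scalar_commute)
    also have "\<dots> = (\<Sum>j = 1..2 * CARD('m). u_coord j v *s (B *v u_vec j))"
      using assms by simp
    also have "\<dots> = B *v v"
      by (subst (4) u_coord_expand) (simp only: matrix_vector_mult_sum vector_scalar_commute)
    finally show ?thesis .
  qed
  then show ?thesis
    by (simp add: matrix_eq)
qed

lemma frame_matrix_of_matrix [simp]: "frame_matrix (\<lambda>j. X *v u_vec j) = X"
  by (rule matrix_eq_on_u_vec) simp

lemma matrix_mult_frame_matrix: "X ** frame_matrix b = frame_matrix (\<lambda>j. X *v b j)"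
  by (rule matrix_eq_on_u_vec) (simp flip: matrix_vector_mul_assoc)

lemma det_nz_iff_ker: "det X \<noteq> 0 \<longleftrightarrow> (\<forall>v. X *v v = 0 \<longrightarrow> v = 0)"
  for X :: "'m::finite cmat"
  by (simp flip: invertible_det_nz add: invertible_left_inverse matrix_left_invertible_ker)

lemma matrix_inverse_exists:
  fixes X :: "complex^'n^'n"
  assumes "det X \<noteq> 0"
  obtains Y where "X ** Y = mat 1" "Y ** X = mat 1" "det Y \<noteq> 0"
proof -
  obtain Y where Y: "X ** Y = mat 1" "Y ** X = mat 1"
    using assms invertible_det_nz[of X] unfolding invertible_def by blast
  have "det X * det Y = 1"
    using Y(1) det_mul[of X Y] by simp
  then have "det Y \<noteq> 0"
    by auto
  with Y show ?thesis
    by (rule that)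
qed

subsection \<open>Complete flags and bases\<close>

lemma act_mult: "act (A ** B) F = act A (act B F)"
  by (auto simp: act_def fun_eq_iff image_image matrix_vector_mul_assoc)

lemma act_mat_1 [simp]: "act (mat 1) F = F"
  by (auto simp: act_def fun_eq_iff)

lemma act_flag_of_basis: "act X (flag_of_basis b) = flag_of_basis (\<lambda>j. X *v b j)"
  by (auto simp: act_def fun_eq_iff flag_of_basis_def vec.span_image[symmetric] image_image)

lemma flag_of_basis_cong:
  assumes "\<And>j. j \<in> {1..2 * CARD('m)} \<Longrightarrow> b j = c j"
  shows "flag_of_basis b = (flag_of_basis c :: 'm::finite flag)"
proof -
  have "b ` {1..min k (2 * CARD('m))} = c ` {1..min k (2 * CARD('m))}" for k
    by (rule image_cong) (use assms in auto)
  then show ?thesis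
    by (simp add: flag_of_basis_def fun_eq_iff)
qed

lemma flag_of_basis_eq_act: "flag_of_basis b = act (frame_matrix b) iwasawa_flag"
  unfolding iwasawa_flag_def act_flag_of_basis by (rule flag_of_basis_cong) simp

lemma act_iwasawa: "act X iwasawa_flag = flag_of_basis (\<lambda>j. X *v u_vec j)"
  by (simp add: iwasawa_flag_def act_flag_of_basis)

lemma iwasawa_flag_iff:
  fixes v :: "'m::{finite,linorder} cvec"
  shows "v \<in> iwasawa_flag k \<longleftrightarrow> (\<forall>j\<in>{1..2 * CARD('m)}. k < j \<longrightarrow> u_coord j v = 0)"
proof
  assume v: "v \<in> iwasawa_flag k"
  let ?S = "{v :: 'm cvec. \<forall>j\<in>{1..2 * CARD('m)}. k < j \<longrightarrow> u_coord j v = 0}"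
  have "vec.subspace ?S"
    by (auto simp: vec.subspace_def)
  moreover have "u_vec ` {1..min k (2 * CARD('m))} \<subseteq> ?S"
    by (auto simp: u_coord_u_vec)
  ultimately have "iwasawa_flag k \<subseteq> ?S"
    unfolding iwasawa_flag_def flag_of_basis_def by (intro vec.span_minimal)
  with v show "\<forall>j\<in>{1..2 * CARD('m)}. k < j \<longrightarrow> u_coord j v = 0"
    by blast
next
  assume *: "\<forall>j\<in>{1..2 * CARD('m)}. k < j \<longrightarrow> u_coord j v = 0"
  have "(\<Sum>j = 1..2 * CARD('m). u_coord j v *s u_vec j) \<in> (iwasawa_flag k :: 'm cvec set)"
    unfolding iwasawa_flag_def flag_of_basis_def
  proof (rule vec.span_sum)
    fix j
    assume j: "j \<in> {1..2 * CARD('m)}"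
    show "u_coord j v *s u_vec j \<in> vec.span (u_vec ` {1..min k (2 * CARD('m))} :: 'm cvec set)"
    proof (cases "j \<le> k")
      case True
      then show ?thesis
        using j by (intro vec.span_scale vec.span_base) auto
    next
      case False
      then have "u_coord j v = 0"
        using * j by auto
      then show ?thesis
        by (simp add: vec.span_zero)
    qed
  qed
  then show "v \<in> iwasawa_flag k"
    using u_coord_expand[of v] by simp
qed

lemma complete_flagsD:
  fixes F :: "'m::finite flag"
  assumes "F \<in> complete_flags"
  shows "mono F" "vec.subspace (F k)" "vec.dim (F k) = min k (2 * CARD('m))"
  using assms by (auto simp: complete_flags_def)

lemma complete_flag_memI: "F \<in> complete_flags \<Longrightarrow> i \<le> j \<Longrightarrow> v \<in> F i \<Longrightarrow> v \<in> F j"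
  using complete_flagsD(1) monoD by blast

lemma flag_of_basis_mono: "mono (flag_of_basis b)"
  unfolding flag_of_basis_def by (intro monoI vec.span_mono image_mono) auto

lemma matrix_vector_inj:
  fixes X :: "'m::finite cmat"
  assumes "det X \<noteq> 0" "X *v v = X *v w"
  shows "v = w"
  using assms det_nz_iff_ker[of X] by (metis matrix_vector_mult_diff_distrib right_minus_eq)

lemma dim_act:
  fixes X :: "'m::finite cmat"
  assumes "det X \<noteq> 0"
  shows "vec.dim ((*v) X ` S) = vec.dim S"
  by (rule vec.dim_image_eq) (use assms matrix_vector_inj in \<open>auto intro: inj_onI\<close>)

lemma act_complete:
  assumes "det X \<noteq> 0" "F \<in> complete_flags"
  shows "act X F \<in> complete_flags"
  unfolding complete_flags_def
proof (intro CollectI conjI allI)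
  show "mono (act X F)"
    unfolding act_def using complete_flagsD(1)[OF assms(2)] by (auto simp: mono_def)
  show "vec.subspace (act X F k)" for k
    unfolding act_def by (intro vec.subspace_image complete_flagsD assms)
  show "vec.dim (act X F k) = min k (2 * CARD('a))" for k
    unfolding act_def dim_act[OF assms(1)] using complete_flagsD(3)[OF assms(2)] .
qed

lemma iwasawa_complete: "iwasawa_flag \<in> (complete_flags :: 'm::{finite,linorder} flag set)"
  unfolding complete_flags_def
proof (intro CollectI conjI allI)
  let ?E = "iwasawa_flag :: 'm flag"
  show "mono ?E"
    unfolding iwasawa_flag_def by (rule flag_of_basis_mono)
  show "vec.subspace (?E k)" for k
    unfolding iwasawa_flag_def flag_of_basis_def by (rule vec.subspace_span)
  show "vec.dim (?E k) = min k (2 * CARD('m))" for k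
  proof -
    let ?d = "(u_index :: nat \<Rightarrow> 'm + 'm) ` {1..min k (2 * CARD('m))}"
    have "?E k = {x. \<forall>i. i \<notin> ?d \<longrightarrow> x $ i = 0}"
    proof (intro Set.set_eqI iffI CollectI allI impI)
      fix v :: "'m cvec" and i
      assume v: "v \<in> ?E k" and i: "i \<notin> ?d"
      obtain j where j: "j \<in> {1..2 * CARD('m)}" "i = u_index j"
        using bij_betw_imp_surj_on[OF bij_betw_u_index] by (metis UNIV_I image_iff)
      have "k < j"
      proof (rule ccontr)
        assume "\<not> k < j"
        with j i show False
          by auto
      qed
      with v j show "v $ i = 0"
        by (auto simp: iwasawa_flag_iff u_coord_def)
    next
      fix v :: "'m cvec"
      assume "v \<in> {x. \<forall>i. i \<notin> ?d \<longrightarrow> x $ i = 0}"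
      moreover have "(u_index j :: 'm + 'm) \<notin> ?d" if "j \<in> {1..2 * CARD('m)}" "k < j" for j
        using that u_index_eq_iff[where 'm = 'm, of _ j] by fastforce
      ultimately show "v \<in> ?E k"
        by (auto simp: iwasawa_flag_iff u_coord_def)
    qed
    then have "vec.dim (?E k) = card ?d"
      by (simp add: dim_substandard_cart)
    also have "\<dots> = min k (2 * CARD('m))"
      by (subst card_image) (auto intro!: inj_onI simp: u_index_eq_iff)
    finally show ?thesis .
  qed
qed

lemma flag_of_basis_complete:
  "det (frame_matrix b) \<noteq> 0 \<Longrightarrow> flag_of_basis b \<in> complete_flags"
  unfolding flag_of_basis_eq_act by (intro act_complete iwasawa_complete)

definition adapted :: "'m::finite flag \<Rightarrow> (nat \<Rightarrow> 'm cvec) \<Rightarrow> bool" where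
  "adapted F b \<longleftrightarrow> (\<forall>p\<in>{1..2 * CARD('m)}. b p \<in> F p \<and> b p \<notin> F (p - 1))"

lemma adapted_exists:
  fixes F :: "'m::finite flag"
  assumes "F \<in> complete_flags"
  obtains b where "adapted F b"
proof -
  have "\<exists>v. v \<in> F p \<and> v \<notin> F (p - 1)" if p: "p \<in> {1..2 * CARD('m)}" for p
  proof (rule ccontr)
    assume "\<not> ?thesis"
    then have "vec.dim (F p) \<le> vec.dim (F (p - 1))"
      by (intro vec.dim_subset) auto
    then show False
      using p complete_flagsD(3)[OF assms] by auto
  qed
  then obtain b where "\<forall>p\<in>{1..2 * CARD('m)}. b p \<in> F p \<and> b p \<notin> F (p - 1)"
    by metis
  then show ?thesis
    by (intro that[of b]) (simp add: adapted_def)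
qed

text \<open>In a nontrivial linear relation the term of highest index \<open>p\<close> would put
  \<open>b p\<close> into \<open>F (p - 1)\<close>. Once the family is a basis, the spans agree with
  the steps of \<open>F\<close> by dimension.\<close>

lemma adapted_frame:
  fixes F :: "'m::{finite,linorder} flag"
  assumes F: "F \<in> complete_flags" and b: "adapted F b"
  shows "det (frame_matrix b) \<noteq> 0" "flag_of_basis b = F"
proof -
  note sub = complete_flagsD(2)[OF F]
  have mem: "b j \<in> F p" if "j \<in> {1..2 * CARD('m)}" "j \<le> p" for j p
    using complete_flag_memI[OF F that(2)] b that(1) by (auto simp: adapted_def)
  show det: "det (frame_matrix b) \<noteq> 0"
    unfolding det_nz_iff_ker
  proof (intro allI impI)
    fix v
    assume v: "frame_matrix b *v v = 0"
    have "u_coord j v = 0" if "j \<in> {1..2 * CARD('m)}" for j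
    proof (rule ccontr)
      assume "u_coord j v \<noteq> 0"
      define P where "P = {j \<in> {1..2 * CARD('m)}. u_coord j v \<noteq> 0}"
      define p where "p = Max P"
      have P: "finite P" "P \<noteq> {}"
        using that \<open>u_coord j v \<noteq> 0\<close> by (auto simp: P_def)
      have p: "p \<in> {1..2 * CARD('m)}" "u_coord p v \<noteq> 0"
        using Max_in[OF P] by (auto simp: p_def P_def)
      have above: "u_coord i v = 0" if "i \<in> {1..2 * CARD('m)}" "p < i" for i
      proof (rule ccontr)
        assume "u_coord i v \<noteq> 0"
        then have "i \<le> p"
          unfolding p_def using that(1) by (intro Max_ge[OF P(1)]) (auto simp: P_def)
        with that(2) show False
          by simp
      qed
      have "0 = (\<Sum>i = 1..2 * CARD('m). u_coord i v *s b i)"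
        using v by (simp add: frame_matrix_mult)
      also have "\<dots> = u_coord p v *s b p + (\<Sum>i\<in>{1..2 * CARD('m)} - {p}. u_coord i v *s b i)"
        using p by (intro sum.remove) auto
      finally have "u_coord p v *s b p = - (\<Sum>i\<in>{1..2 * CARD('m)} - {p}. u_coord i v *s b i)"
        by (simp add: eq_neg_iff_add_eq_0)
      also have "\<dots> \<in> F (p - 1)"
      proof (intro vec.subspace_neg vec.subspace_sum sub)
        fix i
        assume i: "i \<in> {1..2 * CARD('m)} - {p}"
        show "u_coord i v *s b i \<in> F (p - 1)"
        proof (cases "i < p")
          case True
          then show ?thesis
            using i by (intro vec.subspace_scale[OF sub] mem) auto
        next
          case False
          then show ?thesis
            using above[of i] i vec.subspace_0[OF sub] by simp
        qed
      qed
      finally have "inverse (u_coord p v) *s (u_coord p v *s b p) \<in> F (p - 1)"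
        by (rule vec.subspace_scale[OF sub])
      then show False
        using p b by (auto simp: adapted_def)
    qed
    then show "v = 0"
      by (intro u_coord_eqI) simp
  qed
  show "flag_of_basis b = F"
  proof
    fix k
    have "flag_of_basis b k \<subseteq> F k"
      unfolding flag_of_basis_def by (intro vec.span_minimal sub) (use mem in auto)
    moreover have "vec.dim (F k) \<le> vec.dim (flag_of_basis b k)"
      using complete_flagsD(3)[OF F] complete_flagsD(3)[OF flag_of_basis_complete[OF det]] by simp
    ultimately have "vec.span (flag_of_basis b k) = vec.span (F k)"
      by (rule vec.dim_eq_span)
    then show "flag_of_basis b k = F k"
      using vec.span_eq_iff sub[of k] complete_flagsD(2)[OF flag_of_basis_complete[OF det]] by metis
  qed
qed

lemma complete_flag_act_iwasawa:
  fixes F :: "'m::{finite,linorder} flag"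
  assumes "F \<in> complete_flags"
  obtains X where "det X \<noteq> 0" "F = act X iwasawa_flag"
proof -
  obtain b where "adapted F b"
    using adapted_exists[OF assms] .
  then show ?thesis
    using that[of "frame_matrix b"] adapted_frame[OF assms] by (simp add: flag_of_basis_eq_act)
qed

lemma subspace_eq_of_dim:
  assumes "vec.subspace S" "vec.subspace T" "S \<subseteq> T" "vec.dim T \<le> vec.dim S"
  shows "S = T"
  using vec.dim_eq_span[OF assms(3,4)] assms(1,2) vec.span_eq_iff by metis

subsection \<open>The topology of the flag manifold\<close>

lemma continuous_on_det:
  fixes f :: "'a::topological_space \<Rightarrow> complex^'n^'n"
  assumes "continuous_on S f"
  shows "continuous_on S (\<lambda>x. det (f x))"
  unfolding det_def
  by (intro continuous_on_sum continuous_on_mult continuous_on_const continuous_on_prod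
      continuous_on_component assms)

lemma continuous_on_matrix_mult:
  fixes f :: "'a::topological_space \<Rightarrow> complex^'n^'k" and g :: "'a \<Rightarrow> complex^'l^'n"
  assumes "continuous_on S f" "continuous_on S g"
  shows "continuous_on S (\<lambda>x. f x ** g x)"
  unfolding matrix_matrix_mult_def
  by (intro continuous_on_vec_lambda continuous_on_sum continuous_on_mult continuous_on_component assms)

lemma continuous_on_matrix_vector_mult:
  fixes f :: "'a::topological_space \<Rightarrow> complex^'n^'k" and g :: "'a \<Rightarrow> complex^'n"
  assumes "continuous_on S f" "continuous_on S g"
  shows "continuous_on S (\<lambda>x. f x *v g x)"
  unfolding matrix_vector_mult_def
  by (intro continuous_on_vec_lambda continuous_on_sum continuous_on_mult continuous_on_component assms)

lemma continuous_on_vector_scale: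
  fixes f :: "'a::topological_space \<Rightarrow> complex" and g :: "'a \<Rightarrow> complex^'n"
  assumes "continuous_on S f" "continuous_on S g"
  shows "continuous_on S (\<lambda>x. f x *s g x)"
  unfolding vector_scalar_mult_def
  by (intro continuous_on_vec_lambda continuous_on_mult continuous_on_component assms)

lemma continuous_on_u_coord:
  "continuous_on S f \<Longrightarrow> continuous_on S (\<lambda>x. u_coord j (f x))"
  unfolding u_coord_def by (intro continuous_on_mult continuous_on_const continuous_on_component)

lemma continuous_on_frame_matrix:
  fixes b :: "'a::topological_space \<Rightarrow> nat \<Rightarrow> 'm::{finite,linorder} cvec"
  assumes "\<And>j. j \<in> {1..2 * CARD('m)} \<Longrightarrow> continuous_on S (\<lambda>x. b x j)"
  shows "continuous_on S (\<lambda>x. frame_matrix (b x))"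
  unfolding frame_matrix_def
  by (intro continuous_on_vec_lambda continuous_on_sum continuous_on_mult continuous_on_component
      continuous_on_const assms)

text \<open>Unlike \<open>SL\<close> this set is open among all matrices, so elimination and
  segments of matrices can be used without leaving the domain of the orbit map.\<close>

definition GL :: "'m::finite cmat set" where
  "GL = {X. det X \<noteq> 0}"

lemma SL_subset_GL: "SL \<subseteq> GL"
  by (auto simp: SL_def GL_def)

lemma open_GL: "open (GL :: 'm::finite cmat set)"
proof -
  have "GL = {X :: 'm cmat. det X \<in> - {0}}"
    by (auto simp: GL_def)
  moreover have "open ((\<lambda>X :: 'm cmat. det X) -` (- {0}))"
    using continuous_on_det[OF continuous_on_id] by (intro open_vimage) auto
  ultimately show ?thesis
    by (simp only: vimage_def)
qed

text \<open>Turns an invertible matrix into one of determinant 1 without moving the flags of the Iwasawa basis.\<close>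

definition scale_first :: "complex \<Rightarrow> 'm::{finite,linorder} cmat" where
  "scale_first c = frame_matrix (\<lambda>j. (if j = 1 then c else 1) *s u_vec j)"

lemma scale_first_u_vec:
  assumes "j \<in> {1..2 * CARD('m)}"
  shows "scale_first c *v u_vec j = (if j = 1 then c else 1) *s (u_vec j :: 'm::{finite,linorder} cvec)"
  using assms by (simp add: scale_first_def)

lemma det_scale_first: "det (scale_first c :: 'm::{finite,linorder} cmat) = c"
proof -
  let ?i = "u_index 1 :: 'm + 'm"
  let ?T = "(\<chi> r k. if r = k then (if r = ?i then c else 1) else 0) :: 'm cmat"
  have 1: "1 \<in> {1..2 * CARD('m)}"
    by (simp add: Suc_le_eq)
  have T: "(?T *v v) $ r = (if r = ?i then c else 1) * v $ r" for v r
  proof -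
    have "(?T *v v) $ r = (\<Sum>k\<in>UNIV. if k = r then (if r = ?i then c else 1) * v $ k else 0)"
      unfolding matrix_vector_mult_def vec_lambda_beta by (rule sum.cong) auto
    then show ?thesis
      by simp
  qed
  have "?T *v u_vec j = (if j = 1 then c else 1) *s u_vec j" if j: "j \<in> {1..2 * CARD('m)}" for j
  proof (rule vec_eq_iff[THEN iffD2], rule allI)
    fix r
    show "(?T *v u_vec j) $ r = ((if j = 1 then c else 1) *s u_vec j) $ r"
      unfolding T u_vec_axis vector_smult_component using u_index_eq_iff[OF j 1]
      by (cases "r = u_index j") (simp_all add: axis_def)
  qed
  then have "scale_first c = ?T"
    by (intro matrix_eq_on_u_vec) (simp only: scale_first_u_vec)
  moreover have "det ?T = (\<Prod>r\<in>UNIV. if r = ?i then c else 1)"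
    by (subst det_diagonal) auto
  ultimately show ?thesis
    by simp
qed

lemma span_scaled_image:
  assumes "\<And>j. j \<in> A \<Longrightarrow> d j \<noteq> (0::complex)" "finite A"
  shows "vec.span ((\<lambda>j. d j *s b j) ` A) = vec.span (b ` A)"
proof (rule vec.span_eq[THEN iffD2], intro conjI subsetI)
  fix x
  assume "x \<in> (\<lambda>j. d j *s b j) ` A"
  then show "x \<in> vec.span (b ` A)"
    by (auto intro: vec.span_scale vec.span_base)
next
  fix x
  assume "x \<in> b ` A"
  then obtain j where j: "j \<in> A" "x = b j"
    by auto
  then have "x = inverse (d j) *s (d j *s b j)"
    using assms by (simp add: vector_smult_assoc)
  then show "x \<in> vec.span ((\<lambda>j. d j *s b j) ` A)"
    using j by (metis (no_types, lifting) image_eqI vec.span_base vec.span_scale)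
qed

lemma flag_of_basis_scale:
  assumes "\<And>j. j \<in> {1..2 * CARD('m)} \<Longrightarrow> d j \<noteq> 0"
  shows "flag_of_basis (\<lambda>j. d j *s b j) = (flag_of_basis b :: 'm::finite flag)"
  unfolding flag_of_basis_def fun_eq_iff using assms by (auto intro!: span_scaled_image)

lemma act_scale_first:
  fixes w :: "nat \<Rightarrow> nat"
  assumes "c \<noteq> 0" "w permutes {1..2 * CARD('m)}"
  shows "act (scale_first c) (flag_of_basis (u_vec \<circ> w)) =
    (flag_of_basis (u_vec \<circ> w) :: 'm::{finite,linorder} flag)"
proof -
  have "act (scale_first c) (flag_of_basis (u_vec \<circ> w)) =
      (flag_of_basis (\<lambda>j. (if w j = 1 then c else 1) *s (u_vec \<circ> w) j) :: 'm flag)"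
    unfolding act_flag_of_basis
  proof (rule flag_of_basis_cong)
    fix j
    assume "j \<in> {1..2 * CARD('m)}"
    then have "w j \<in> {1..2 * CARD('m)}"
      using permutes_in_image[OF assms(2)] by blast
    then show "scale_first c *v (u_vec \<circ> w) j = ((if w j = 1 then c else 1) *s (u_vec \<circ> w) j :: 'm cvec)"
      unfolding o_apply by (rule scale_first_u_vec)
  qed
  also have "\<dots> = flag_of_basis (u_vec \<circ> w)"
    by (rule flag_of_basis_scale[of "\<lambda>j. if w j = 1 then c else 1" "u_vec \<circ> w"]) (simp add: assms(1))
  finally show ?thesis .
qed

lemma act_scale_first_iwasawa:
  "c \<noteq> 0 \<Longrightarrow> act (scale_first c) iwasawa_flag = iwasawa_flag"
  using act_scale_first[OF _ permutes_id] unfolding iwasawa_flag_def by (simp only: comp_id)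

text \<open>Right multiplication by \<open>scale_first (inverse (det X))\<close> moves an invertible
  \<open>X\<close> continuously into \<open>SL\<close> without changing the flag \<open>X\<close>
  defines.\<close>

lemma openin_flag_topology_GL:
  "openin flag_topology U \<longleftrightarrow>
    U \<subseteq> (complete_flags :: 'm::{finite,linorder} flag set) \<and> open {X \<in> GL. act X iwasawa_flag \<in> U}"
proof -
  let ?P = "{X \<in> GL. act X (iwasawa_flag :: 'm flag) \<in> U}"
  let ?Q = "{X \<in> SL. act X (iwasawa_flag :: 'm flag) \<in> U}"
  have "open ?P" if Q: "openin (top_of_set SL) ?Q"
  proof -
    obtain T where T: "open T" "?Q = SL \<inter> T"
      using Q unfolding openin_open by blast
    let ?r = "\<lambda>X :: 'm cmat. X ** scale_first (inverse (det X))"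
    have "continuous_on GL (\<lambda>X. inverse (det X))"
      by (intro continuous_on_inverse continuous_on_det continuous_on_id) (auto simp: GL_def)
    then have "continuous_on GL (\<lambda>X. if j = 1 then inverse (det X) else 1)" for j :: nat
      by (cases "j = 1") (simp_all add: continuous_on_const)
    then have "continuous_on GL ?r"
      unfolding scale_first_def
      by (intro continuous_on_matrix_mult continuous_on_frame_matrix continuous_on_vector_scale
          continuous_on_id continuous_on_const)
    then have "open (?r -` T \<inter> GL)"
      using T(1) by (simp add: continuous_on_open_vimage[OF open_GL])
    moreover have "?r -` T \<inter> GL = ?P"
    proof -
      have "?r X \<in> SL" "act (?r X) iwasawa_flag = act X iwasawa_flag" if "X \<in> GL" for X
        using that by (auto simp: SL_def GL_def det_mul det_scale_first act_mult act_scale_first_iwasawa)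
      moreover have "act Y iwasawa_flag \<in> U \<longleftrightarrow> Y \<in> T" if "Y \<in> SL" for Y
        using T(2) that by blast
      ultimately show ?thesis
        by (intro Set.set_eqI) (metis (mono_tags, lifting) IntD1 IntD2 IntI mem_Collect_eq vimageD vimageI2)
    qed
    ultimately show ?thesis
      by simp
  qed
  moreover have "openin (top_of_set SL) ?Q" if "open ?P"
  proof -
    have "?Q = SL \<inter> ?P"
      using SL_subset_GL by auto
    then show ?thesis
      using that unfolding openin_open by blast
  qed
  ultimately show ?thesis
    unfolding openin_flag_topology by blast
qed

lemma topspace_flag_topology [simp]:
  "topspace flag_topology = (complete_flags :: 'm::{finite,linorder} flag set)"
proof -
  have "{X \<in> GL. act X iwasawa_flag \<in> (complete_flags :: 'm flag set)} = GL"
    by (auto simp: GL_def intro: act_complete iwasawa_complete)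
  then have "openin flag_topology (complete_flags :: 'm flag set)"
    by (simp add: openin_flag_topology_GL open_GL)
  moreover have "topspace flag_topology \<subseteq> (complete_flags :: 'm flag set)"
    using openin_topspace[of flag_topology] openin_flag_topology by blast
  ultimately show ?thesis
    using openin_subset by blast
qed

abbreviation orbit_map :: "'m::{finite,linorder} cmat \<Rightarrow> 'm flag" where
  "orbit_map X \<equiv> act X iwasawa_flag"

lemma continuous_map_orbit_map:
  "continuous_map (top_of_set GL) flag_topology (orbit_map :: 'm::{finite,linorder} cmat \<Rightarrow> _)"
  unfolding continuous_map_def
proof (intro conjI allI impI)
  show "orbit_map \<in> topspace (top_of_set GL) \<rightarrow> topspace (flag_topology :: 'm flag topology)"
    by (auto simp: GL_def intro: act_complete iwasawa_complete)
  fix U :: "'m flag set"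
  assume "openin flag_topology U"
  then have "open {X \<in> GL. orbit_map X \<in> U}"
    by (simp add: openin_flag_topology_GL)
  then show "openin (top_of_set GL) {X \<in> topspace (top_of_set GL). orbit_map X \<in> U}"
    by (auto intro!: open_subset)
qed

lemma open_left_mult_image:
  fixes Y :: "'m::finite cmat"
  assumes "det Y \<noteq> 0" "open V"
  shows "open ((\<lambda>X. X ** Y) ` V)" "open ((\<lambda>X. Y ** X) ` V)"
proof -
  obtain Z where Z: "Y ** Z = mat 1" "Z ** Y = mat 1" "det Z \<noteq> 0"
    using matrix_inverse_exists[OF assms(1)] .
  have "(\<lambda>X. X ** Y) ` V = (\<lambda>X. X ** Z) -` V"
  proof (intro Set.set_eqI iffI)
    fix X
    assume "X \<in> (\<lambda>X. X ** Z) -` V"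
    moreover have "X = (X ** Z) ** Y"
      using Z by (simp flip: matrix_mul_assoc)
    ultimately show "X \<in> (\<lambda>X. X ** Y) ` V"
      by blast
  qed (use Z in \<open>auto simp flip: matrix_mul_assoc\<close>)
  moreover have "(\<lambda>X. Y ** X) ` V = (\<lambda>X. Z ** X) -` V"
  proof (intro Set.set_eqI iffI)
    fix X
    assume "X \<in> (\<lambda>X. Z ** X) -` V"
    moreover have "X = Y ** (Z ** X)"
      using Z by (simp add: matrix_mul_assoc)
    ultimately show "X \<in> (\<lambda>X. Y ** X) ` V"
      by blast
  qed (use Z in \<open>auto simp: matrix_mul_assoc\<close>)
  moreover have "continuous_on UNIV (\<lambda>X. X ** Z)" "continuous_on UNIV (\<lambda>X. Z ** X)"
    by (intro continuous_on_matrix_mult continuous_on_id continuous_on_const)+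
  ultimately show "open ((\<lambda>X. X ** Y) ` V)" "open ((\<lambda>X. Y ** X) ` V)"
    using assms(2) open_vimage by metis+
qed

text \<open>The saturation of an open \<open>V\<close> is the union of its right translates by the
  stabilizer of the Iwasawa flag, each of which is open.\<close>

lemma open_map_orbit_map:
  "open_map (top_of_set GL) flag_topology (orbit_map :: 'm::{finite,linorder} cmat \<Rightarrow> _)"
  unfolding open_map_def
proof (intro allI impI)
  fix V :: "'m cmat set"
  assume "openin (top_of_set GL) V"
  then have V: "open V" "V \<subseteq> GL"
    using open_GL openin_open_eq by blast+
  let ?B = "{Y \<in> GL. orbit_map Y = (iwasawa_flag :: 'm flag)}"
  have "{X \<in> GL. orbit_map X \<in> orbit_map ` V} = (\<Union>Y\<in>?B. (\<lambda>X. X ** Y) ` V)"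
  proof (intro Set.set_eqI iffI)
    fix X
    assume "X \<in> {X \<in> GL. orbit_map X \<in> orbit_map ` V}"
    then obtain A where A: "det X \<noteq> 0" "A \<in> V" "orbit_map X = orbit_map A"
      by (auto simp: GL_def)
    then have "det A \<noteq> 0"
      using V by (auto simp: GL_def)
    then obtain C where C: "A ** C = mat 1" "C ** A = mat 1" "det C \<noteq> 0"
      using matrix_inverse_exists by blast
    have "orbit_map (C ** X) = act (C ** A) iwasawa_flag"
      unfolding act_mult A(3) ..
    then have "C ** X \<in> ?B"
      using C A(1) by (simp add: GL_def det_mul)
    moreover have "X = A ** (C ** X)"
      using C by (simp add: matrix_mul_assoc)
    ultimately show "X \<in> (\<Union>Y\<in>?B. (\<lambda>X. X ** Y) ` V)"
      using A(2) by blast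
  next
    fix X
    assume "X \<in> (\<Union>Y\<in>?B. (\<lambda>X. X ** Y) ` V)"
    then show "X \<in> {X \<in> GL. orbit_map X \<in> orbit_map ` V}"
      using V(2) by (auto simp: GL_def det_mul act_mult)
  qed
  moreover have "open (\<Union>Y\<in>?B. (\<lambda>X. X ** Y) ` V)"
    using V(1) by (intro open_UN ballI open_left_mult_image) (auto simp: GL_def)
  moreover have "orbit_map ` V \<subseteq> complete_flags"
    using V(2) by (auto simp: GL_def intro: act_complete iwasawa_complete)
  ultimately show "openin flag_topology (orbit_map ` V)"
    by (simp add: openin_flag_topology_GL)
qed

lemma orbit_map_surj: "orbit_map ` GL = (complete_flags :: 'm::{finite,linorder} flag set)"
  using complete_flag_act_iwasawa by (auto simp: GL_def intro: act_complete iwasawa_complete)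

text \<open>As the orbit map is open, it stays a quotient map over every set of flags.\<close>

lemma continuous_map_from_flags:
  fixes A :: "'m::{finite,linorder} flag set"
  assumes A: "A \<subseteq> complete_flags"
    and f: "continuous_map (top_of_set {X \<in> GL. orbit_map X \<in> A}) T (f \<circ> orbit_map)"
  shows "continuous_map (subtopology flag_topology A) T f"
proof -
  let ?P = "{X \<in> GL. orbit_map X \<in> A}"
  have sub: "subtopology (top_of_set GL) ?P = top_of_set ?P"
    by (simp add: subtopology_subtopology) (metis (no_types, lifting) Collect_mem_eq Int_absorb1 mem_Collect_eq subsetI)
  have "quotient_map (top_of_set ?P) (subtopology flag_topology A) orbit_map"
  proof (rule continuous_open_imp_quotient_map)
    show "continuous_map (top_of_set ?P) (subtopology flag_topology A) orbit_map"
      using continuous_map_from_subtopology[OF continuous_map_orbit_map, of ?P]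
      by (auto simp: sub continuous_map_in_subtopology)
    show "open_map (top_of_set ?P) (subtopology flag_topology A) orbit_map"
      using open_map_restriction[OF open_map_orbit_map, of A ?P] by (simp add: sub)
    show "orbit_map ` topspace (top_of_set ?P) = topspace (subtopology flag_topology A)"
      using orbit_map_surj A by (fastforce simp: image_iff set_eq_iff)
  qed
  then show ?thesis
    using f by (rule continuous_compose_quotient_map)
qed

text \<open>On matrices the action is left multiplication, which commutes with the orbit
  map.\<close>

lemma homeomorphic_maps_act:
  fixes X :: "'m::{finite,linorder} cmat"
  assumes "X ** Y = mat 1" "Y ** X = mat 1"
  shows "homeomorphic_maps flag_topology flag_topology (act X) (act Y)"
proof -
  have cont: "continuous_map flag_topology flag_topology (act X)" if X: "det X \<noteq> 0" for X :: "'m cmat"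
    unfolding continuous_map_def
  proof (intro conjI allI impI)
    show "act X \<in> topspace flag_topology \<rightarrow> topspace flag_topology"
      using act_complete[OF X] by auto
    fix U :: "'m flag set"
    assume "openin flag_topology U"
    then have U: "open {Z \<in> GL. orbit_map Z \<in> U}"
      by (simp add: openin_flag_topology_GL)
    have "{Z \<in> GL. orbit_map Z \<in> {F \<in> complete_flags. act X F \<in> U}} = (\<lambda>Z. X ** Z) -` {Z \<in> GL. orbit_map Z \<in> U}"
      using X by (auto simp: GL_def det_mul act_mult intro: act_complete iwasawa_complete)
    moreover have "open ((\<lambda>Z. X ** Z) -` {Z \<in> GL. orbit_map Z \<in> U})"
      by (intro open_vimage[OF U] continuous_on_matrix_mult continuous_on_id continuous_on_const)
    ultimately have "open {Z \<in> GL. orbit_map Z \<in> {F \<in> complete_flags. act X F \<in> U}}"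
      by (simp only:)
    then show "openin flag_topology {F \<in> topspace flag_topology. act X F \<in> U}"
      unfolding openin_flag_topology_GL topspace_flag_topology by blast
  qed
  have "det X * det Y = 1"
    using assms(1) det_mul[of X Y] by simp
  then have "det X \<noteq> 0" "det Y \<noteq> 0"
    by auto
  then show ?thesis
    unfolding homeomorphic_maps_def using assms by (auto intro: cont simp flip: act_mult)
qed

subsection \<open>Affine charts of the flag manifold\<close>

definition chart_index :: "nat \<Rightarrow> (nat \<times> nat) set" where
  "chart_index n = {(k, j). 1 \<le> j \<and> j < k \<and> k \<le> n}"

text \<open>Frames that are unipotent lower triangular with respect to u_{w(1)}, ..., u_{w(n)}; the
  pair (k, j) stands for row k and column j. Their flags fill the open cell centred at V_w, which is
  the case of zero coordinates.\<close>

definition chart_frame :: "(nat \<Rightarrow> nat) \<Rightarrow> (nat \<times> nat \<Rightarrow> complex) \<Rightarrow> nat \<Rightarrow> 'm::{finite,linorder} cvec" where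
  "chart_frame w L j = u_vec (w j) + (\<Sum>k\<in>{j<..2 * CARD('m)}. L (k, j) *s u_vec (w k))"

definition chart :: "(nat \<Rightarrow> nat) \<Rightarrow> (nat \<times> nat \<Rightarrow> complex) \<Rightarrow> 'm::{finite,linorder} flag" where
  "chart w L = flag_of_basis (chart_frame w L)"

text \<open>The flag determines only the values on \<open>chart_index\<close>; elsewhere the choice
  is arbitrary.\<close>

definition chart_coords :: "(nat \<Rightarrow> nat) \<Rightarrow> 'm::{finite,linorder} flag \<Rightarrow> nat \<times> nat \<Rightarrow> complex" where
  "chart_coords w F = (SOME L. chart w L = F)"

text \<open>Gaussian elimination with the pivot of the \<open>k\<close>-th vector in position \<open>w k\<close>.\<close>

primrec elim :: "(nat \<Rightarrow> nat) \<Rightarrow> (nat \<Rightarrow> 'm::{finite,linorder} cvec) \<Rightarrow> nat \<Rightarrow> nat \<Rightarrow> 'm cvec" where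
  "elim w x 0 = x"
| "elim w x (Suc k) = (\<lambda>p. if p \<le> Suc k then elim w x k p
    else elim w x k p - (u_coord (w (Suc k)) (elim w x k p) /
      u_coord (w (Suc k)) (elim w x k (Suc k))) *s elim w x k (Suc k))"

text \<open>Counted from 0: the divisor used in elimination step \<open>Suc k\<close>.\<close>

definition pivot :: "(nat \<Rightarrow> nat) \<Rightarrow> (nat \<Rightarrow> 'm::{finite,linorder} cvec) \<Rightarrow> nat \<Rightarrow> complex" where
  "pivot w x k = u_coord (w (Suc k)) (elim w x k (Suc k))"

definition regular :: "(nat \<Rightarrow> nat) \<Rightarrow> (nat \<Rightarrow> 'm::{finite,linorder} cvec) \<Rightarrow> nat \<Rightarrow> bool" where
  "regular w x l \<longleftrightarrow> (\<forall>k<l. pivot w x k \<noteq> 0)"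

lemma flag_of_basis_memE:
  fixes b :: "nat \<Rightarrow> 'm::{finite,linorder} cvec"
  assumes "v \<in> flag_of_basis b k"
  obtains c where "\<And>i. k < i \<Longrightarrow> c i = 0" "v = (\<Sum>i = 1..2 * CARD('m). c i *s b i)"
proof -
  obtain z where z: "z \<in> iwasawa_flag k" "v = frame_matrix b *v z"
    using assms by (auto simp: flag_of_basis_eq_act act_def)
  let ?c = "\<lambda>i. if k < i then 0 else u_coord i z"
  have "v = (\<Sum>i = 1..2 * CARD('m). u_coord i z *s b i)"
    using z(2) by (simp add: frame_matrix_mult)
  also have "\<dots> = (\<Sum>i = 1..2 * CARD('m). ?c i *s b i)"
    by (rule sum.cong) (use z(1) in \<open>auto simp: iwasawa_flag_iff\<close>)
  finally show ?thesis
    by (intro that[of ?c]) auto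
qed

lemma span_subset_flag_of_basis:
  "k \<le> 2 * CARD('m) \<Longrightarrow> flag_of_basis b k = vec.span (b ` {1..k})"
  for b :: "nat \<Rightarrow> 'm::finite cvec"
  by (simp add: flag_of_basis_def min_def)

text \<open>Each step subtracts multiples of earlier vectors only, which is why elimination
  preserves the flag.\<close>

lemma elim_diff_mem_span:
  "1 \<le> p \<Longrightarrow> elim w x k p - x p \<in> vec.span (x ` {1..p - 1})"
proof (induction k arbitrary: p)
  case 0
  then show ?case
    by (simp add: vec.span_zero)
next
  case (Suc k)
  show ?case
  proof (cases "p \<le> Suc k")
    case True
    then show ?thesis
      using Suc by simp
  next
    case False
    let ?S = "vec.span (x ` {1..p - 1})"
    have "elim w x k (Suc k) - x (Suc k) \<in> ?S"
      using Suc.IH[of "Suc k"] False vec.span_mono[of "x ` {1..Suc k - 1}" "x ` {1..p - 1}"] by force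
    moreover have "x (Suc k) \<in> ?S"
      using False by (intro vec.span_base) auto
    ultimately have "elim w x k (Suc k) \<in> ?S"
      by (metis diff_add_cancel vec.span_add)
    then have "(elim w x k p - x p) - c *s elim w x k (Suc k) \<in> ?S" for c
      by (intro vec.span_diff vec.span_scale Suc.IH Suc.prems)
    then show ?thesis
      using False by (simp add: algebra_simps)
  qed
qed

text \<open>A step clears its own pivot position, and the vector it subtracts is already zero in the
  previous pivot positions.\<close>

lemma elim_vanish:
  "regular w x l \<Longrightarrow> i \<in> {1..l} \<Longrightarrow> i < p \<Longrightarrow> u_coord (w i) (elim w x l p) = 0"
proof (induction l arbitrary: p)
  case (Suc l)
  have reg: "regular w x l" "pivot w x l \<noteq> 0"
    using Suc.prems(1) by (auto simp: regular_def)
  show ?case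
  proof (cases "i = Suc l")
    case True
    then show ?thesis
      using Suc.prems reg(2) by (auto simp: pivot_def)
  next
    case False
    then have "u_coord (w i) (elim w x l p) = 0" "u_coord (w i) (elim w x l (Suc l)) = 0"
      using Suc.IH reg(1) Suc.prems by auto
    then show ?thesis
      by simp
  qed
qed simp

lemma elim_stable: "p \<le> Suc k \<Longrightarrow> k \<le> l \<Longrightarrow> elim w x l p = elim w x k p"
  by (induction l) (auto simp: le_Suc_eq)

lemma u_coord_elim: "1 \<le> p \<Longrightarrow> p \<le> l \<Longrightarrow> u_coord (w p) (elim w x l p) = pivot w x (p - 1)"
  using elim_stable[of p "p - 1" l w x] by (simp add: pivot_def)

lemma u_vec_notin_iwasawa:
  "p \<in> {1..2 * CARD('m)} \<Longrightarrow> (u_vec p :: 'm::{finite,linorder} cvec) \<notin> iwasawa_flag (p - 1)"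
  by (auto simp: iwasawa_flag_iff u_coord_u_vec intro!: bexI[of _ p])

lemma adapted_flag_of_basis:
  fixes b :: "nat \<Rightarrow> 'm::{finite,linorder} cvec"
  assumes "det (frame_matrix b) \<noteq> 0"
  shows "adapted (flag_of_basis b) b"
  unfolding adapted_def
proof (intro ballI conjI)
  fix p
  assume p: "p \<in> {1..2 * CARD('m)}"
  show "b p \<in> flag_of_basis b p"
    using p by (auto simp: span_subset_flag_of_basis intro: vec.span_base)
  show "b p \<notin> flag_of_basis b (p - 1)"
  proof
    assume "b p \<in> flag_of_basis b (p - 1)"
    then obtain z where "z \<in> iwasawa_flag (p - 1)" "frame_matrix b *v u_vec p = frame_matrix b *v z"
      using p by (auto simp: flag_of_basis_eq_act act_def)
    then have "u_vec p \<in> (iwasawa_flag (p - 1) :: 'm cvec set)"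
      using matrix_vector_inj[OF assms] by metis
    then show False
      using u_vec_notin_iwasawa[OF p] by blast
  qed
qed

section \<open>The affine chart centred at V_w: uniqueness, openness and continuity of its
  coordinates\<close>

context
  fixes w :: "nat \<Rightarrow> nat"
  assumes w: "w permutes {1..2 * CARD('m::{finite,linorder})}"
begin

lemma perm_mem: "w i \<in> {1..2 * CARD('m)} \<longleftrightarrow> i \<in> {1..2 * CARD('m)}"
  by (rule permutes_in_image[OF w])

lemma perm_eq: "w i = w j \<longleftrightarrow> i = j"
  using permutes_inj[OF w] by (auto dest: injD)

lemma u_coord_perm:
  "i \<in> {1..2 * CARD('m)} \<Longrightarrow> j \<in> {1..2 * CARD('m)} \<Longrightarrow>
    u_coord (w i) (u_vec (w j) :: 'm cvec) = (if i = j then 1 else 0)"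
  by (subst u_coord_u_vec) (simp_all only: perm_mem perm_eq)

lemma u_coord_perm_eqI:
  assumes "\<And>i. i \<in> {1..2 * CARD('m)} \<Longrightarrow> u_coord (w i) v = u_coord (w i) v'"
  shows "v = (v' :: 'm cvec)"
proof (rule u_coord_eqI)
  fix j
  assume "j \<in> {1..2 * CARD('m)}"
  then obtain i where "i \<in> {1..2 * CARD('m)}" "j = w i"
    using permutes_image[OF w] by blast
  then show "u_coord j v = u_coord j v'"
    using assms by simp
qed

lemma u_coord_chart_frame:
  assumes "i \<in> {1..2 * CARD('m)}" "j \<in> {1..2 * CARD('m)}"
  shows "u_coord (w i) (chart_frame w L j :: 'm cvec) = (if i = j then 1 else if j < i then L (i, j) else 0)"
proof -
  have "(\<Sum>k\<in>{j<..2 * CARD('m)}. L (k, j) * u_coord (w i) (u_vec (w k) :: 'm cvec)) =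
      (\<Sum>k\<in>{j<..2 * CARD('m)}. if k = i then L (k, j) else 0)"
    by (rule sum.cong) (use assms u_coord_perm[of i] in auto)
  then show ?thesis
    using assms by (simp add: chart_frame_def u_coord_sum u_coord_perm)
qed



text \<open>Forward substitution: once the earlier coefficients vanish, coordinate
  \<open>w i\<close> of \<open>v\<close> equals \<open>c i\<close>. The bound n + 1 on
  \<open>k\<close> admits the case of all coefficients, which yields invertibility of the
  frame.\<close>

lemma chart_leading_zero:
  fixes c :: "nat \<Rightarrow> complex" and L :: "nat \<times> nat \<Rightarrow> complex"
  assumes v: "v = (\<Sum>i = 1..2 * CARD('m). c i *s (chart_frame w L i :: 'm cvec))"
    and zero: "\<And>i. 1 \<le> i \<Longrightarrow> i < k \<Longrightarrow> u_coord (w i) v = 0" and k: "k \<le> 2 * CARD('m) + 1"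
  shows "1 \<le> i \<Longrightarrow> i < k \<Longrightarrow> c i = 0"
proof (induction i rule: less_induct)
  case (less i)
  then have i: "i \<in> {1..2 * CARD('m)}"
    using k by auto
  have "0 = u_coord (w i) v"
    using zero less.prems by simp
  also have "\<dots> = (\<Sum>j = 1..2 * CARD('m). c j * (if i = j then 1 else if j < i then L (i, j) else 0))"
    unfolding v u_coord_sum by (rule sum.cong) (simp_all add: u_coord_chart_frame[OF i])
  also have "\<dots> = (\<Sum>j = 1..2 * CARD('m). if j = i then c i else 0)"
    by (rule sum.cong) (use less in auto)
  finally show ?case
    using i by simp
qed

lemma det_chart_frame: "det (frame_matrix (chart_frame w L :: nat \<Rightarrow> 'm cvec)) \<noteq> 0"
  unfolding det_nz_iff_ker
proof (intro allI impI)
  fix v :: "'m cvec"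
  assume v: "frame_matrix (chart_frame w L) *v v = 0"
  show "v = 0"
  proof (rule u_coord_eqI)
    fix j
    assume "j \<in> {1..2 * CARD('m)}"
    then show "u_coord j v = u_coord j 0"
      using chart_leading_zero[of 0 "\<lambda>i. u_coord i v" L "2 * CARD('m) + 1" j] v
      by (simp add: frame_matrix_mult)
  qed
qed

lemma chart_complete: "(chart w L :: 'm flag) \<in> complete_flags"
  unfolding chart_def by (intro flag_of_basis_complete det_chart_frame)

text \<open>The vectors of step \<open>k\<close> whose first k - 1 coordinates vanish form a line.
  This gives both the injectivity of the chart and the nonvanishing of pivots on it.\<close>

lemma chart_unique_vector:
  assumes v: "v \<in> (chart w L :: 'm flag) k" and k: "k \<in> {1..2 * CARD('m)}"
    and zero: "\<And>i. 1 \<le> i \<Longrightarrow> i < k \<Longrightarrow> u_coord (w i) v = 0"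
  shows "v = u_coord (w k) v *s chart_frame w L k"
proof -
  obtain c where c: "\<And>i. k < i \<Longrightarrow> c i = 0"
    and vc: "v = (\<Sum>i = 1..2 * CARD('m). c i *s chart_frame w L i)"
    using v unfolding chart_def by (elim flag_of_basis_memE) blast
  have below: "c i = 0" if "1 \<le> i" "i < k" for i
    using chart_leading_zero[OF vc zero, of k i] that k by auto
  have "v = (\<Sum>i = 1..2 * CARD('m). if i = k then c k *s chart_frame w L k else 0)"
    unfolding vc
  proof (rule sum.cong[OF refl])
    fix i
    assume "i \<in> {1..2 * CARD('m)}"
    then show "c i *s (chart_frame w L i :: 'm cvec) = (if i = k then c k *s chart_frame w L k else 0)"
      using c[of i] below[of i] by (cases i k rule: linorder_cases) auto
  qed
  then have v: "v = c k *s chart_frame w L k"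
    using k by simp
  then have "u_coord (w k) v = c k"
    using u_coord_chart_frame[OF k k] by simp
  with v show ?thesis
    by simp
qed

lemma chart_frame_mem: "k \<in> {1..2 * CARD('m)} \<Longrightarrow> chart_frame w L k \<in> (chart w L :: 'm flag) k"
  unfolding chart_def by (auto simp: span_subset_flag_of_basis intro: vec.span_base)

lemma chart_inj:
  assumes eq: "chart w L = (chart w L' :: 'm flag)" and s: "s \<in> chart_index (2 * CARD('m))"
  shows "L s = L' s"
proof -
  obtain k j where kj: "s = (k, j)" "j \<in> {1..2 * CARD('m)}" "k \<in> {1..2 * CARD('m)}" "j < k"
    using s by (auto simp: chart_index_def)
  have "chart_frame w L j = u_coord (w j) (chart_frame w L j :: 'm cvec) *s (chart_frame w L' j :: 'm cvec)"
  proof (rule chart_unique_vector[of "chart_frame w L j" L' j])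
    show "(chart_frame w L j :: 'm cvec) \<in> chart w L' j"
      using chart_frame_mem[OF kj(2), of L] eq by simp
  qed (use kj in \<open>auto simp: u_coord_chart_frame\<close>)
  then have "chart_frame w L j = (chart_frame w L' j :: 'm cvec)"
    using kj by (simp add: u_coord_chart_frame)
  then show ?thesis
    using u_coord_chart_frame[of k j L] u_coord_chart_frame[of k j L'] kj by simp
qed

lemma chart_cong:
  assumes "\<And>s. s \<in> chart_index (2 * CARD('m)) \<Longrightarrow> L s = L' s"
  shows "chart w L = (chart w L' :: 'm flag)"
  unfolding chart_def
proof (rule flag_of_basis_cong)
  fix j
  assume "j \<in> {1..2 * CARD('m)}"
  then show "chart_frame w L j = (chart_frame w L' j :: 'm cvec)"
    unfolding chart_frame_def
    by (intro arg_cong2[where f = "(+)"] sum.cong refl) (use assms in \<open>auto simp: chart_index_def\<close>)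
qed

lemma chart_coords_chart:
  "s \<in> chart_index (2 * CARD('m)) \<Longrightarrow> chart_coords w (chart w L :: 'm flag) s = L s"
  unfolding chart_coords_def by (rule chart_inj) (rule someI[of _ L], rule refl)

text \<open>Dividing the eliminated vectors by their pivots does not move the flag and produces the
  normal form of the chart. The resulting formula for the coordinates is what makes them
  continuous.\<close>

lemma regular_chart:
  fixes x :: "nat \<Rightarrow> 'm cvec"
  assumes det: "det (frame_matrix x) \<noteq> 0" and reg: "regular w x (2 * CARD('m))"
  shows "flag_of_basis x = chart w (\<lambda>(k, p). u_coord (w k) (elim w x (2 * CARD('m)) p) / pivot w x (p - 1))"
    (is "_ = chart w ?L")
proof -
  let ?N = "2 * CARD('m)" and ?F = "flag_of_basis x"
  let ?f = "\<lambda>p. inverse (pivot w x (p - 1)) *s elim w x ?N p"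
  have piv: "pivot w x (p - 1) \<noteq> 0" if "p \<in> {1..?N}" for p
    using reg that by (auto simp: regular_def)
  have F: "?F \<in> complete_flags"
    by (rule flag_of_basis_complete[OF det])
  have "adapted ?F (elim w x ?N)"
    unfolding adapted_def
  proof (intro ballI conjI)
    fix p
    assume p: "p \<in> {1..?N}"
    note sub = complete_flagsD(2)[OF F]
    have d: "elim w x ?N p - x p \<in> ?F (p - 1)"
      using elim_diff_mem_span[of p w x ?N] p by (subst span_subset_flag_of_basis) auto
    have x: "x p \<in> ?F p" "x p \<notin> ?F (p - 1)"
      using adapted_flag_of_basis[OF det] p by (auto simp: adapted_def)
    have "elim w x ?N p - x p \<in> ?F p"
      using d complete_flag_memI[OF F _ d, of p] by simp
    from vec.subspace_add[OF sub this x(1)] show "elim w x ?N p \<in> ?F p"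
      by simp
    show "elim w x ?N p \<notin> ?F (p - 1)"
      using vec.subspace_diff[OF sub _ d] x(2) by fastforce
  qed
  then have "?F = flag_of_basis (elim w x ?N)"
    using adapted_frame(2)[OF F] by simp
  also have "\<dots> = flag_of_basis ?f"
    by (rule flag_of_basis_scale[symmetric, of "\<lambda>p. inverse (pivot w x (p - 1))"]) (use piv in auto)
  also have "\<dots> = chart w ?L"
    unfolding chart_def
  proof (rule flag_of_basis_cong)
    fix j
    assume j: "j \<in> {1..?N}"
    show "?f j = chart_frame w ?L j"
    proof (rule u_coord_perm_eqI)
      fix i
      assume i: "i \<in> {1..?N}"
      show "u_coord (w i) (?f j) = u_coord (w i) (chart_frame w ?L j :: 'm cvec)"
        unfolding u_coord_chart_frame[OF i j]
        using piv[OF j] u_coord_elim[of j ?N w x] elim_vanish[OF reg i, of j] i j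
        by (auto simp: divide_simps)
    qed
  qed
  finally show ?thesis .
qed

text \<open>After \<open>l\<close> steps the next vector is nonzero, lies in step l + 1 and has
  vanishing leading coordinates, so it is a multiple of the chart vector and the factor, its pivot,
  is nonzero.\<close>

lemma chart_regular:
  fixes x :: "nat \<Rightarrow> 'm cvec"
  assumes det: "det (frame_matrix x) \<noteq> 0" and eq: "flag_of_basis x = chart w L"
  shows "l \<le> 2 * CARD('m) \<Longrightarrow> regular w x l"
proof (induction l)
  case 0
  then show ?case
    by (simp add: regular_def)
next
  case (Suc l)
  then have reg: "regular w x l"
    by simp
  let ?v = "elim w x l (Suc l)" and ?F = "flag_of_basis x"
  have F: "?F \<in> complete_flags"
    by (rule flag_of_basis_complete[OF det])
  note sub = complete_flagsD(2)[OF F]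
  have x: "x (Suc l) \<in> ?F (Suc l)" "x (Suc l) \<notin> ?F l"
    using adapted_flag_of_basis[OF det, unfolded adapted_def, rule_format, of "Suc l"] Suc.prems by auto
  have d: "?v - x (Suc l) \<in> ?F l"
    using elim_diff_mem_span[of "Suc l" w x l] Suc.prems by (simp add: span_subset_flag_of_basis)
  have d': "?v - x (Suc l) \<in> ?F (Suc l)"
    using d complete_flag_memI[OF F _ d, of "Suc l"] by simp
  have "?v \<in> chart w L (Suc l)"
    using vec.subspace_add[OF sub d' x(1)] by (simp flip: eq)
  then have "?v = pivot w x l *s chart_frame w L (Suc l)"
    unfolding pivot_def
    by (rule chart_unique_vector) (use Suc.prems elim_vanish[OF reg] in auto)
  moreover have "?v \<noteq> 0"
  proof
    assume "?v = 0"
    then have "- x (Suc l) \<in> ?F l"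
      using d by simp
    then show False
      using vec.subspace_neg[OF sub[of l], of "- x (Suc l)"] x(2) by simp
  qed
  ultimately have "pivot w x l \<noteq> 0"
    by auto
  then show ?case
    using reg by (auto simp: regular_def less_Suc_eq)
qed

lemma orbit_map_in_chart_iff:
  fixes X :: "'m cmat"
  assumes "X \<in> GL"
  shows "orbit_map X \<in> range (chart w) \<longleftrightarrow> regular w (\<lambda>p. X *v u_vec p) (2 * CARD('m))"
proof -
  have det: "det (frame_matrix (\<lambda>p. X *v u_vec p)) \<noteq> 0"
    using assms by (simp add: GL_def)
  show ?thesis
    unfolding act_iwasawa using chart_regular[OF det _ order.refl] regular_chart[OF det] by fast
qed

text \<open>Openness and continuity need one another: a step is continuous where its pivot is
  nonzero, and this is an open condition because the preceding steps are continuous.\<close>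

lemma regular_open_continuous:
  "open {X :: 'm cmat. X \<in> GL \<and> regular w (\<lambda>p. X *v u_vec p) l} \<and>
    (\<forall>p. continuous_on {X \<in> GL. regular w (\<lambda>p. X *v u_vec p) l} (\<lambda>X :: 'm cmat. elim w (\<lambda>p. X *v u_vec p) l p))"
proof (induction l)
  case 0
  have "{X :: 'm cmat. X \<in> GL} = GL"
    by auto
  then show ?case
    by (auto simp: regular_def open_GL intro!: continuous_on_matrix_vector_mult continuous_on_id continuous_on_const)
next
  case (Suc l)
  let ?x = "\<lambda>(X :: 'm cmat) p. X *v u_vec p"
  let ?R = "\<lambda>l. {X \<in> GL. regular w (?x X) l}"
  have cont: "continuous_on (?R l) (\<lambda>X. u_coord (w i) (elim w (?x X) l p))" for i p
    using Suc.IH by (intro continuous_on_u_coord) blast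
  have piv: "continuous_on (?R l) (\<lambda>X. pivot w (?x X) l)"
    unfolding pivot_def by (rule cont)
  have R: "?R (Suc l) = (\<lambda>X. pivot w (?x X) l) -` (- {0}) \<inter> ?R l"
    by (auto simp: regular_def less_Suc_eq)
  have op: "open (?R (Suc l))"
    unfolding R using Suc.IH piv continuous_on_open_vimage[of "?R l"] by blast
  have sub: "?R (Suc l) \<subseteq> ?R l"
    unfolding R by blast
  have "continuous_on (?R (Suc l)) (\<lambda>X. elim w (?x X) (Suc l) p)" for p
  proof -
    have e: "continuous_on (?R (Suc l)) (\<lambda>X. elim w (?x X) l q)" for q
      using Suc.IH continuous_on_subset sub by blast
    have "continuous_on (?R (Suc l)) (\<lambda>X. u_coord (w (Suc l)) (elim w (?x X) l p) / pivot w (?x X) l)"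
      using R by (intro continuous_on_divide continuous_on_subset[OF cont sub] continuous_on_subset[OF piv sub]) auto
    then show ?thesis
      using e by (cases "p \<le> Suc l")
        (auto simp: pivot_def intro!: continuous_on_diff continuous_on_vector_scale)
  qed
  with op show ?case
    by blast
qed

lemma preimage_chart:
  "{X \<in> GL. orbit_map X \<in> range (chart w)} =
    {X :: 'm cmat. X \<in> GL \<and> regular w (\<lambda>p. X *v u_vec p) (2 * CARD('m))}"
  using orbit_map_in_chart_iff by blast

lemma openin_chart: "openin flag_topology (range (chart w) :: 'm flag set)"
  unfolding openin_flag_topology_GL preimage_chart
  using regular_open_continuous chart_complete by blast

lemma continuous_chart_coords:
  assumes s: "s \<in> chart_index (2 * CARD('m))"
  shows "continuous_map (subtopology flag_topology (range (chart w) :: 'm flag set)) euclidean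
    (\<lambda>F. chart_coords w F s)"
proof (rule continuous_map_from_flags)
  let ?N = "2 * CARD('m)" and ?x = "\<lambda>(X :: 'm cmat) p. X *v u_vec p"
  let ?R = "{X \<in> GL. regular w (?x X) ?N}"
  show "range (chart w) \<subseteq> (complete_flags :: 'm flag set)"
    using chart_complete by blast
  obtain k j where kj: "s = (k, j)" "j \<in> {1..?N}"
    using s by (auto simp: chart_index_def)
  have "continuous_on ?R (\<lambda>X. u_coord (w i) (elim w (?x X) ?N j))" for i
    using regular_open_continuous by (intro continuous_on_u_coord) blast
  moreover have "pivot w (?x X) (j - 1) = u_coord (w j) (elim w (?x X) ?N j)" for X
    using kj(2) by (intro u_coord_elim[symmetric]) auto
  moreover have "pivot w (?x X) (j - 1) \<noteq> 0" if "X \<in> ?R" for X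
    using that kj(2) by (auto simp: regular_def)
  ultimately have c1: "continuous_on ?R (\<lambda>X. u_coord (w k) (elim w (?x X) ?N j) / pivot w (?x X) (j - 1))"
    by (intro continuous_on_divide) auto
  have c2: "chart_coords w (orbit_map X) s = u_coord (w k) (elim w (?x X) ?N j) / pivot w (?x X) (j - 1)"
    if X: "X \<in> ?R" for X
  proof -
    have "det (frame_matrix (?x X)) \<noteq> 0" "regular w (?x X) ?N"
      using X by (simp_all add: GL_def)
    from regular_chart[OF this] show ?thesis
      unfolding act_iwasawa using chart_coords_chart[OF s] kj(1) by simp
  qed
  have "continuous_on ?R (\<lambda>X. chart_coords w (orbit_map X) s)"
    by (rule continuous_on_eq[OF c1 c2[symmetric]])
  then show "continuous_map (top_of_set {X :: 'm cmat. X \<in> GL \<and> orbit_map X \<in> range (chart w)}) euclidean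
      ((\<lambda>F. chart_coords w F s) \<circ> orbit_map)"
    unfolding preimage_chart by (simp add: o_def)
qed

lemma continuous_map_chart:
  assumes "\<And>s. s \<in> chart_index (2 * CARD('m)) \<Longrightarrow> continuous_map T euclidean (\<lambda>y. L y s)"
  shows "continuous_map T flag_topology (\<lambda>y. chart w (L y) :: 'm flag)"
proof -
  \<comment> \<open>Continuity is assumed on \<open>chart_index\<close> only, whereas the product
    topology tests every coordinate; the cut-off is invisible to \<open>chart\<close>.\<close>
  let ?L = "\<lambda>y s. if s \<in> chart_index (2 * CARD('m)) then L y s else 0"
  let ?M = "\<lambda>L. frame_matrix (chart_frame w L :: nat \<Rightarrow> 'm cvec)"
  have "continuous_on UNIV (\<lambda>L. chart_frame w L j :: 'm cvec)" for j
    unfolding chart_frame_def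
    by (intro continuous_on_add continuous_on_const continuous_on_sum continuous_on_vector_scale
        continuous_on_product_coordinates)
  then have "continuous_on UNIV ?M"
    by (intro continuous_on_frame_matrix)
  then have "continuous_map euclidean (top_of_set GL) ?M"
    using det_chart_frame by (auto simp: continuous_map_in_subtopology GL_def)
  from continuous_map_compose[OF this continuous_map_orbit_map]
  have c: "continuous_map euclidean flag_topology (\<lambda>L. chart w L :: 'm flag)"
    by (simp add: o_def chart_def flip: flag_of_basis_eq_act)
  have "continuous_map T (product_topology (\<lambda>_. euclidean) UNIV) ?L"
    using assms by (auto simp: continuous_map_componentwise_UNIV)
  then have "continuous_map T euclidean ?L"
    by (simp only: euclidean_product_topology)
  from continuous_map_compose[OF this c]
  have "continuous_map T flag_topology (\<lambda>y. chart w (?L y) :: 'm flag)"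
    by (simp add: o_def)
  moreover have "chart w (?L y) = (chart w (L y) :: 'm flag)" for y
    by (rule chart_cong) simp
  ultimately show ?thesis
    by simp
qed

text \<open>Since \<open>g\<close> reproduces the free coordinates \<open>S\<close>, projecting the
  chart coordinates to \<open>S\<close> inverts the parametrization. With \<open>g = id\<close> it
  serves the whole chart and the Schubert cells, with dependent coordinates the isotropic
  flags.\<close>

lemma homeomorphic_chart_graph:
  assumes S: "S \<subseteq> chart_index (2 * CARD('m))" "finite S"
    and g: "\<And>s. s \<in> chart_index (2 * CARD('m)) \<Longrightarrow> continuous_on UNIV (\<lambda>a. g a s)"
    and gS: "\<And>a s. s \<in> S \<Longrightarrow> g a s = a s"
  shows "subtopology flag_topology ((\<lambda>a. chart w (g a) :: 'm flag) ` {a. \<forall>s. s \<notin> S \<longrightarrow> a s = 0})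
    homeomorphic_space complex_space (card S)"
    (is "subtopology _ ?C homeomorphic_space _")
proof -
  obtain e where e: "bij_betw e S {..<card S}"
    using finite_same_card_bij[OF S(2), of "{..<card S}"] by auto
  define h where "h = the_inv_into S e"
  have h: "h i \<in> S" "e (h i) = i" if "i < card S" for i
    using e that unfolding h_def bij_betw_def
    by (auto intro: the_inv_into_into f_the_inv_into_f)
  have eS: "e s < card S" "h (e s) = s" if "s \<in> S" for s
    using e that unfolding h_def bij_betw_def by (auto simp: the_inv_into_f_f)
  let ?ext = "\<lambda>(y :: nat \<Rightarrow> complex) s. if s \<in> S then y (e s) else 0"
  let ?f = "\<lambda>y. chart w (g (?ext y)) :: 'm flag"
  let ?k = "\<lambda>F :: 'm flag. \<lambda>i\<in>{..<card S}. chart_coords w F (h i)"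
  have "continuous_map (complex_space (card S)) (product_topology (\<lambda>_. euclidean) UNIV) ?ext"
    unfolding continuous_map_componentwise_UNIV complex_space_def
  proof
    fix s
    show "continuous_map (product_topology (\<lambda>_. euclidean) {..<card S}) euclidean (\<lambda>y. ?ext y s)"
      using eS(1)[of s] by (cases "s \<in> S") (auto intro: continuous_map_product_projection)
  qed
  then have cont_ext: "continuous_map (complex_space (card S)) euclidean ?ext"
    by (simp only: euclidean_product_topology)
  have f: "continuous_map (complex_space (card S)) flag_topology ?f"
  proof (rule continuous_map_chart)
    fix s
    assume "s \<in> chart_index (2 * CARD('m))"
    then have "continuous_map euclidean euclidean (\<lambda>a. g a s)"
      using g by simp
    from continuous_map_compose[OF cont_ext this]
    show "continuous_map (complex_space (card S)) euclidean (\<lambda>y. g (?ext y) s)"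
      by (simp add: o_def)
  qed
  have C: "?C \<subseteq> range (chart w)"
    by auto
  have coords: "chart_coords w (chart w (g a) :: 'm flag) s = a s" if "s \<in> S" for a s
    using chart_coords_chart[of s "g a"] S(1) gS[OF that] that by auto
  have "homeomorphic_maps (complex_space (card S)) (subtopology flag_topology ?C) ?f ?k"
    unfolding homeomorphic_maps_def
  proof (intro conjI ballI)
    show "continuous_map (complex_space (card S)) (subtopology flag_topology ?C) ?f"
      using f by (force simp: continuous_map_in_subtopology)
    show "continuous_map (subtopology flag_topology ?C) (complex_space (card S)) ?k"
      unfolding complex_space_def continuous_map_componentwise
    proof (intro conjI ballI)
      fix i
      assume i: "i \<in> {..<card S}"
      then have "h i \<in> chart_index (2 * CARD('m))"
        using h(1) S(1) by auto
      from continuous_map_from_subtopology_mono[OF continuous_chart_coords[OF this] C]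
      show "continuous_map (subtopology flag_topology ?C) euclidean (\<lambda>F. ?k F i)"
        using i by simp
    qed auto
    show "?k (?f y) = y" if "y \<in> topspace (complex_space (card S))" for y
    proof
      fix i
      show "?k (?f y) i = y i"
        using that h[of i] coords[of "h i" "?ext y"]
        by (auto simp: complex_space_def PiE_def extensional_def)
    qed
    show "?f (?k F) = F" if F: "F \<in> topspace (subtopology flag_topology ?C)" for F
    proof -
      obtain a where a: "F = chart w (g a)" "\<forall>s. s \<notin> S \<longrightarrow> a s = 0"
        using F unfolding topspace_subtopology by blast
      have "?ext (?k F) s = a s" for s
      proof (cases "s \<in> S")
        case True
        then show ?thesis
          using a(1) coords[of s a] eS[of s] by simp
      next
        case False
        then have "a s = 0"
          using a(2) by blast
        with False show ?thesis
          by simp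
      qed
      then have "?ext (?k F) = a"
        by (rule ext)
      then show ?thesis
        using a(1) by simp
    qed
  qed
  then show ?thesis
    using homeomorphic_maps_imp_homeomorphic_space homeomorphic_space_sym by blast
qed

end

subsection \<open>The quaternionic structure in the Iwasawa basis\<close>

lemma sum_UNIV_Plus:
  "(\<Sum>a\<in>UNIV. f a) = (\<Sum>i\<in>UNIV. f (Inl i)) + (\<Sum>i\<in>UNIV. f (Inr i))"
  for f :: "'a::finite + 'b::finite \<Rightarrow> 'c::comm_monoid_add"
proof -
  have "(\<Sum>a\<in>UNIV. f a) = sum f (Inl ` UNIV \<union> Inr ` UNIV)"
    by (simp add: UNIV_sum)
  also have "\<dots> = sum f (range Inl) + sum f (range Inr)"
    by (rule sum.union_disjoint) auto
  finally show ?thesis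
    by (simp add: sum.reindex)
qed

lemma J_mat_mult [simp]:
  "(J_mat *v w) $ Inl i = w $ Inr i" "(J_mat *v w) $ Inr i = - w $ Inl i"
  by (simp_all add: matrix_vector_mult_def sum_UNIV_Plus J_mat_def if_distribR
      if_distrib[of "\<lambda>x. x * _"] cong: if_cong)

lemma jmap_component [simp]:
  "jmap v $ Inl i = cnj (v $ Inr i)" "jmap v $ Inr i = - cnj (v $ Inl i)"
  by (simp_all add: jmap_def cnj_vec_def)

lemma cvec_eqI: "(\<And>i. v $ Inl i = w $ Inl i) \<Longrightarrow> (\<And>i. v $ Inr i = w $ Inr i) \<Longrightarrow> v = w"
  by (metis sum.exhaust vec_eq_iff)

lemma jmap_add: "jmap (v + w) = jmap v + jmap w"
  and jmap_scale: "jmap (c *s v) = cnj c *s jmap v"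
  and jmap_jmap [simp]: "jmap (jmap v) = - v"
  and jmap_0 [simp]: "jmap 0 = 0"
  by (rule cvec_eqI; simp)+

lemma jmap_minus: "jmap (- v) = - jmap v"
  by (rule cvec_eqI) simp_all

lemma jmap_sum: "jmap (sum f A) = (\<Sum>a\<in>A. jmap (f a))"
  by (induction A rule: infinite_finite_induct) (auto simp: jmap_add)

lemma omega_eq: "omega v w = (\<Sum>i\<in>UNIV. v $ Inl i * w $ Inr i) - (\<Sum>i\<in>UNIV. v $ Inr i * w $ Inl i)"
  by (simp add: omega_def sum_UNIV_Plus sum_negf)

lemma omega_swap: "omega w v = - omega v w"
  by (simp add: omega_eq mult.commute)

lemma omega_add_left: "omega (v + v') w = omega v w + omega v' w"
  and omega_scale_left: "omega (c *s v) w = c * omega v w"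
  by (simp_all add: omega_eq sum.distrib sum_distrib_left algebra_simps)

lemma omega_add_right: "omega w (v + v') = omega w v + omega w v'"
  and omega_scale_right: "omega w (c *s v) = c * omega w v"
  by (simp_all add: omega_eq sum.distrib sum_distrib_left algebra_simps)

lemma omega_minus_right [simp]: "omega w (- v) = - omega w v"
  by (simp add: omega_eq sum_negf)

lemma omega_0 [simp]: "omega 0 w = 0" "omega w 0 = 0"
  by (simp_all add: omega_eq)

lemma omega_sum_left: "omega (sum f A) w = (\<Sum>a\<in>A. omega (f a) w)"
  by (induction A rule: infinite_finite_induct) (auto simp: omega_add_left)

lemma omega_sum_right: "omega w (sum f A) = (\<Sum>a\<in>A. omega w (f a))"
  by (induction A rule: infinite_finite_induct) (auto simp: omega_add_right)

text \<open>J squares to -1, so pairing with j(w) under omega is minus the standard Hermitian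
  product with w.\<close>

lemma omega_jmap_right: "omega v (jmap w) = - (\<Sum>a\<in>UNIV. v $ a * cnj (w $ a))"
  by (simp add: omega_eq sum_UNIV_Plus sum_negf)

lemma omega_jmap_jmap: "omega (jmap v) (jmap w) = cnj (omega v w)"
  by (simp add: omega_eq sum_negf mult.commute)

lemma omega_self_jmap: "omega v (jmap v) = - of_real (\<Sum>a\<in>UNIV. (cmod (v $ a))\<^sup>2)"
  unfolding omega_jmap_right by (simp flip: complex_norm_square)

lemma omega_self_jmap_eq_0: "omega v (jmap v) = 0 \<longleftrightarrow> v = 0"
proof -
  have "(\<Sum>a\<in>UNIV. (cmod (v $ a))\<^sup>2) = 0 \<longleftrightarrow> (\<forall>a. v $ a = 0)"
    by (subst sum_nonneg_eq_0_iff) auto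
  then show ?thesis
    unfolding omega_self_jmap by (simp only: neg_equal_0_iff_equal of_real_eq_0_iff vec_eq_iff zero_index)
qed

text \<open>Up to sign, j exchanges u_{2k-1} and u_{2k}.\<close>

definition partner :: "nat \<Rightarrow> nat" where
  "partner j = (if odd j then j + 1 else j - 1)"

lemma partner_partner [simp]: "1 \<le> j \<Longrightarrow> partner (partner j) = j"
  by (auto simp: partner_def)

lemma partner_mem: "j \<in> {1..2 * m} \<Longrightarrow> partner j \<in> {1..2 * m}"
  unfolding partner_def atLeastAtMost_iff by presburger

lemma bij_betw_partner: "bij_betw partner {1..2 * m} {1..2 * m}"
  by (rule bij_betw_byWitness[where f' = partner]) (use partner_mem in auto)

lemma u_coord_jmap:
  assumes "1 \<le> j"
  shows "u_coord j (jmap v) = (if odd j then - 1 else 1) * cnj (u_coord (partner j) v)"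
proof (cases "odd j")
  case True
  then show ?thesis
    by (simp add: u_coord_def u_sign_def partner_def u_index_def)
next
  case False
  then have "even j"
    by simp
  then obtain k where "j = 2 * Suc k"
    using assms by (metis Suc_pred' even_two_times_div_two div_greater_zero_iff evenE gr0I mult_0_right not_one_le_zero)
  then show ?thesis
    by (simp add: u_coord_def u_sign_def partner_def u_index_def)
qed

lemma jmap_u_vec:
  assumes "j \<in> {1..2 * CARD('m)}"
  shows "jmap (u_vec j :: 'm::{finite,linorder} cvec) = (if odd j then 1 else - 1) *s u_vec (partner j)"
proof (rule u_coord_eqI)
  fix i
  assume i: "i \<in> {1..2 * CARD('m)}"
  have "partner i = j \<longleftrightarrow> i = partner j"
    using partner_partner[of i] partner_partner[of j] i assms by auto
  moreover have "odd i \<longleftrightarrow> even (partner i)"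
    using i by (auto simp: partner_def)
  ultimately show "u_coord i (jmap (u_vec j :: 'm cvec)) =
      u_coord i ((if odd j then 1 else - 1) *s (u_vec (partner j) :: 'm cvec))"
    using i assms partner_mem[OF i] partner_mem[OF assms] by (auto simp: u_coord_jmap u_coord_u_vec)
qed

lemma jmap_u_vec_odd:
  assumes "i \<in> {1..CARD('m)}"
  shows "jmap (u_vec (2 * i - 1)) = (u_vec (2 * i) :: 'm::{finite,linorder} cvec)"
proof -
  have "2 * i - 1 \<in> {1..2 * CARD('m)}" "odd (2 * i - 1)" "partner (2 * i - 1) = 2 * i"
    using assms by (auto simp: partner_def)
  then show ?thesis
    using jmap_u_vec[where 'm = 'm, of "2 * i - 1"] by simp
qed

text \<open>As u_j is plus or minus j of its partner, this is the Hermitian orthonormality of the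
  Iwasawa basis.\<close>

lemma omega_u_vec:
  assumes i: "i \<in> {1..2 * CARD('m)}" and j: "j \<in> {1..2 * CARD('m)}"
  shows "omega (u_vec i :: 'm::{finite,linorder} cvec) (u_vec j) =
    (if j = partner i then (if odd i then - 1 else 1) else 0)"
proof -
  let ?s = "\<lambda>j::nat. if odd j then 1 else - 1 :: complex"
  have herm: "(\<Sum>a\<in>UNIV. (u_vec i :: 'm cvec) $ a * cnj (u_vec k $ a)) = (if i = k then 1 else 0)"
    if k: "k \<in> {1..2 * CARD('m)}" for k
  proof -
    have "(\<Sum>a\<in>UNIV. (u_vec i :: 'm cvec) $ a * cnj (u_vec k $ a)) =
        (\<Sum>a\<in>UNIV. if a = (u_index i :: 'm + 'm) then u_sign i * cnj (u_vec k $ a) else 0)"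
      by (rule sum.cong) (auto simp: u_vec_axis axis_def)
    also have "\<dots> = u_sign i * cnj (u_vec k $ (u_index i :: 'm + 'm))"
      by simp
    also have "\<dots> = (if i = k then 1 else 0)"
      using u_index_eq_iff[where 'm = 'm, OF i k] by (auto simp: u_vec_axis axis_def u_sign_def)
    finally show ?thesis .
  qed
  have "(u_vec j :: 'm cvec) = ?s j *s (?s j *s u_vec j)"
    by (simp add: vector_smult_assoc)
  also have "\<dots> = - ?s j *s jmap (u_vec (partner j))"
    using j jmap_u_vec[OF partner_mem[OF j]] by (auto simp: partner_def vec_eq_iff)
  finally have "omega (u_vec i :: 'm cvec) (u_vec j) = ?s j * (if i = partner j then 1 else 0)"
    using herm[OF partner_mem[OF j]] by (simp add: omega_scale_right omega_jmap_right)
  moreover have "partner i = j \<longleftrightarrow> i = partner j"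
    using partner_partner[of i] partner_partner[of j] i j by auto
  moreover have "odd i \<longleftrightarrow> even (partner i)"
    using i by (auto simp: partner_def)
  ultimately show ?thesis
    by auto
qed

lemma jmap_span_subset: "jmap ` vec.span B \<subseteq> vec.span (jmap ` B)"
proof -
  have "vec.subspace {v. jmap v \<in> vec.span (jmap ` B)}"
    by (auto simp: vec.subspace_def jmap_add jmap_scale
        intro: vec.span_zero vec.span_add vec.span_scale)
  then have "vec.span B \<subseteq> {v. jmap v \<in> vec.span (jmap ` B)}"
    by (intro vec.span_minimal) (auto intro: vec.span_base)
  then show ?thesis
    by blast
qed

text \<open>\<open>jmap\<close> is conjugate linear and maps spanning sets to spanning sets, so it
  does not raise dimensions; applying it twice returns to \<open>S\<close>, because j squares to
  -1.\<close>

lemma dim_jmap_image: 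
  assumes "vec.subspace S"
  shows "vec.dim (jmap ` S) = vec.dim S"
proof -
  have le: "vec.dim (jmap ` S) \<le> vec.dim S" for S :: "'a cvec set"
  proof -
    obtain B where B: "B \<subseteq> S" "vec.independent B" "S \<subseteq> vec.span B" "card B = vec.dim S"
      using vec.basis_exists by blast
    then have "finite B"
      using vec.independent_bound_general by blast
    have "vec.dim (jmap ` S) \<le> card (jmap ` B)"
      using jmap_span_subset B(3) \<open>finite B\<close> by (intro vec.dim_le_card) blast+
    also have "\<dots> \<le> vec.dim S"
      using card_image_le[OF \<open>finite B\<close>, of jmap] B(4) by simp
    finally show ?thesis .
  qed
  have "S \<subseteq> jmap ` jmap ` S"
  proof
    fix v
    assume "v \<in> S"
    then have "- v \<in> S"
      by (rule vec.subspace_neg[OF assms])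
    moreover have "v = jmap (jmap (- v))"
      by simp
    ultimately show "v \<in> jmap ` jmap ` S"
      by blast
  qed
  then have "vec.dim S \<le> vec.dim (jmap ` jmap ` S)"
    by (rule vec.dim_subset)
  with le[of S] le[of "jmap ` S"] show ?thesis
    by simp
qed

lemma subspace_jmap_image:
  assumes "vec.subspace S"
  shows "vec.subspace (jmap ` S)"
  unfolding vec.subspace_def
proof (intro conjI ballI allI)
  show "0 \<in> jmap ` S"
    using vec.subspace_0[OF assms] by (metis image_eqI jmap_0)
next
  fix x y
  assume "x \<in> jmap ` S" "y \<in> jmap ` S"
  then show "x + y \<in> jmap ` S"
    using vec.subspace_add[OF assms] by (auto simp flip: jmap_add)
next
  fix c x
  assume "x \<in> jmap ` S"
  then obtain y where y: "y \<in> S" "x = jmap y"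
    by blast
  then have "c *s x = jmap (cnj c *s y)"
    by (simp add: jmap_scale)
  then show "c *s x \<in> jmap ` S"
    using vec.subspace_scale[OF assms y(1)] by blast
qed

lemma jmap_iwasawa_even: "jmap ` iwasawa_flag (2 * k) \<subseteq> (iwasawa_flag (2 * k) :: 'm::{finite,linorder} cvec set)"
proof
  fix v :: "'m cvec"
  assume "v \<in> jmap ` iwasawa_flag (2 * k)"
  then obtain w where w: "w \<in> iwasawa_flag (2 * k)" "v = jmap w"
    by blast
  have "u_coord j v = 0" if "j \<in> {1..2 * CARD('m)}" "2 * k < j" for j
  proof -
    have "2 * k < partner j"
      using that(2) by (auto simp: partner_def elim!: oddE evenE)
    then have "u_coord (partner j) w = 0"
      using w(1) partner_mem[OF that(1)] by (auto simp: iwasawa_flag_iff)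
    then show ?thesis
      using that(1) w(2) by (simp add: u_coord_jmap)
  qed
  then show "v \<in> iwasawa_flag (2 * k)"
    by (simp add: iwasawa_flag_iff)
qed

subsection \<open>Quaternionic matrices have positive determinant\<close>

definition quaternionic :: "'m::finite cmat \<Rightarrow> bool" where
  "quaternionic X \<longleftrightarrow> (\<forall>v. jmap (X *v v) = X *v jmap v)"

lemma quaternionic_mult: "quaternionic X \<Longrightarrow> quaternionic Y \<Longrightarrow> quaternionic (X ** Y)"
  by (simp add: quaternionic_def flip: matrix_vector_mul_assoc)

lemma quaternionic_inverse:
  assumes "quaternionic X" "X ** Y = mat 1" "Y ** X = mat 1"
  shows "quaternionic Y"
  unfolding quaternionic_def
proof
  fix v
  have "jmap (Y *v v) = (Y ** X) *v jmap (Y *v v)"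
    using assms by simp
  also have "\<dots> = Y *v jmap ((X ** Y) *v v)"
    using assms(1) by (simp add: quaternionic_def flip: matrix_vector_mul_assoc)
  finally show "jmap (Y *v v) = Y *v jmap v"
    using assms by simp
qed

text \<open>For v_i = e_i this is the Iwasawa basis itself.\<close>

definition quat_frame :: "(nat \<Rightarrow> 'm::finite cvec) \<Rightarrow> nat \<Rightarrow> 'm cvec" where
  "quat_frame v j = (if odd j then v ((j + 1) div 2) else jmap (v (j div 2)))"

lemma jmap_quat_frame:
  assumes "1 \<le> j"
  shows "jmap (quat_frame v j) = (if odd j then 1 else - 1) *s quat_frame v (partner j)"
proof (cases "odd j")
  case True
  then show ?thesis
    by (auto simp: quat_frame_def partner_def elim!: oddE)
next
  case False
  then have "even j" "j \<noteq> 0"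
    using assms by auto
  then obtain k where "j = 2 * Suc k"
    by (metis evenE mult_0_right not0_implies_Suc)
  then show ?thesis
    by (simp add: quat_frame_def partner_def)
qed

text \<open>j acts on this family and on the Iwasawa basis by the same permutation
  \<open>partner\<close> with the same signs.\<close>

lemma quaternionic_quat_frame: "quaternionic (frame_matrix (quat_frame v) :: 'm::{finite,linorder} cmat)"
  unfolding quaternionic_def
proof
  fix z :: "'m cvec"
  let ?q = "quat_frame v :: nat \<Rightarrow> 'm cvec" and ?s = "\<lambda>j::nat. if odd j then 1 else - 1 :: complex"
  have "frame_matrix ?q *v jmap z = (\<Sum>j = 1..2 * CARD('m). (- ?s j * cnj (u_coord (partner j) z)) *s ?q j)"
    unfolding frame_matrix_mult by (rule sum.cong) (auto simp: u_coord_jmap)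
  also have "\<dots> = (\<Sum>j = 1..2 * CARD('m). (- ?s (partner j) * cnj (u_coord (partner (partner j)) z)) *s ?q (partner j))"
    by (rule sum.reindex_bij_betw[OF bij_betw_partner, symmetric])
  also have "\<dots> = (\<Sum>j = 1..2 * CARD('m). jmap (u_coord j z *s ?q j))"
  proof (rule sum.cong[OF refl])
    fix j
    assume j: "j \<in> {1..2 * CARD('m)}"
    have "odd j \<longleftrightarrow> even (partner j)"
      using j by (auto simp: partner_def)
    then have "- ?s (partner j) = ?s j"
      by auto
    then show "(- ?s (partner j) * cnj (u_coord (partner (partner j)) z)) *s ?q (partner j) = jmap (u_coord j z *s ?q j)"
      using j jmap_quat_frame[of j v] by (simp add: jmap_scale vector_smult_assoc mult.commute)
  qed
  finally show "jmap (frame_matrix ?q *v z) = frame_matrix ?q *v jmap z"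
    by (simp add: frame_matrix_mult jmap_sum)
qed

section \<open>The determinant as a multilinear function of the vectors of a frame\<close>

lemma transpose_frame_matrix_upd:
  assumes "j \<in> {1..2 * CARD('m)}"
  shows "transpose (frame_matrix (b(j := x)) :: 'm::{finite,linorder} cmat) =
    (\<chi> c. if c = u_index j then u_sign j *s x else transpose (frame_matrix b) $ c)"
proof -
  have "frame_matrix (b(j := x)) $ r $ c =
      (if c = u_index j then u_sign j * x $ r else frame_matrix b $ r $ c)" for r c :: "'m + 'm"
  proof (cases "c = u_index j")
    case True
    have "(\<Sum>i = 1..2 * CARD('m). (b(j := x)) i $ r * u_coord i (axis c 1)) =
        (\<Sum>i = 1..2 * CARD('m). if i = j then u_sign j * x $ r else 0)"
      by (rule sum.cong) (use True assms in \<open>auto simp: u_coord_def axis_def u_index_eq_iff\<close>)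
    then show ?thesis
      using True assms by (simp add: frame_matrix_def)
  next
    case False
    have "(\<Sum>i = 1..2 * CARD('m). (b(j := x)) i $ r * u_coord i (axis c 1)) =
        (\<Sum>i = 1..2 * CARD('m). b i $ r * u_coord i (axis c 1))"
      by (rule sum.cong) (use False in \<open>auto simp: u_coord_def axis_def\<close>)
    then show ?thesis
      using False by (simp add: frame_matrix_def)
  qed
  then show ?thesis
    by (simp add: vec_eq_iff transpose_def)
qed

text \<open>Transposition turns the replacement of a frame vector into the replacement of a row, the
  form in which \<open>det_row_add\<close> and \<open>det_row_mul\<close> apply.\<close>

lemma det_frame_upd:
  assumes "j \<in> {1..2 * CARD('m)}"
  shows "det (frame_matrix (b(j := x)) :: 'm::{finite,linorder} cmat) =
    det (\<chi> c. if c = u_index j then u_sign j *s x else transpose (frame_matrix b) $ c)"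
  using transpose_frame_matrix_upd[OF assms, of b x] det_transpose[of "frame_matrix (b(j := x))"]
  by (simp only:)

lemma det_frame_upd_add:
  assumes "j \<in> {1..2 * CARD('m)}"
  shows "det (frame_matrix (b(j := x + y)) :: 'm::{finite,linorder} cmat) =
    det (frame_matrix (b(j := x)) :: 'm cmat) + det (frame_matrix (b(j := y)) :: 'm cmat)"
  unfolding det_frame_upd[OF assms] vector_add_ldistrib by (rule det_row_add)

lemma det_frame_upd_scale:
  assumes "j \<in> {1..2 * CARD('m)}"
  shows "det (frame_matrix (b(j := c *s x)) :: 'm::{finite,linorder} cmat) =
    c * det (frame_matrix (b(j := x)) :: 'm cmat)"
proof -
  have "u_sign j *s (c *s x) = c *s (u_sign j *s x)"
    by (simp add: vector_smult_assoc mult.commute)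
  then show ?thesis
    unfolding det_frame_upd[OF assms] by (simp only: det_row_mul)
qed

lemma det_frame_eq_0:
  fixes b :: "nat \<Rightarrow> 'm::{finite,linorder} cvec"
  assumes "i \<in> {1..2 * CARD('m)}" "j \<in> {1..2 * CARD('m)}" "i \<noteq> j" "b i = b j"
  shows "det (frame_matrix b) = 0"
proof -
  have "frame_matrix b *v (u_vec i - u_vec j) = 0"
    using assms by (simp add: matrix_vector_mult_diff_distrib)
  moreover have "u_vec i - u_vec j \<noteq> (0 :: 'm cvec)"
    using u_coord_u_vec[where 'm = 'm, of i i] u_coord_u_vec[where 'm = 'm, of i j] assms
    by (metis diff_eq_diff_eq diff_self right_minus_eq zero_neq_one)
  ultimately show ?thesis
    using det_nz_iff_ker by blast
qed

lemma det_frame_upd_sum: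
  assumes "j \<in> {1..2 * CARD('m)}"
  shows "det (frame_matrix (b(j := \<Sum>i\<in>A. c i *s x i)) :: 'm::{finite,linorder} cmat) =
    (\<Sum>i\<in>A. c i * det (frame_matrix (b(j := x i)) :: 'm cmat))"
proof (induction A rule: infinite_finite_induct)
  case (insert a A)
  then show ?case
    by (simp only: sum.insert[OF insert(1,2)] det_frame_upd_add[OF assms] det_frame_upd_scale[OF assms])
qed (use det_frame_upd_scale[OF assms, of b 0 0] in
    \<open>simp_all only: sum.infinite sum.empty not_False_eq_True vector_smult_lzero mult_zero_left\<close>)



text \<open>Expanding \<open>x\<close> and \<open>y\<close> in the basis, only the terms with
  indices \<open>p\<close> and \<open>q\<close> survive, the others repeating a vector.\<close>

lemma det_frame_two:
  assumes p: "p \<in> {1..2 * CARD('m)}" and q: "q \<in> {1..2 * CARD('m)}" and "p \<noteq> q"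
  shows "det (frame_matrix (u_vec(p := x, q := y)) :: 'm::{finite,linorder} cmat) =
    u_coord p x * u_coord q y - u_coord q x * u_coord p y"
proof -
  let ?N = "2 * CARD('m)"
  let ?d = "\<lambda>x y. det (frame_matrix (u_vec(p := x, q := y)) :: 'm cmat)"
  have swap: "u_vec(p := x, q := y) = u_vec(q := y, p := x)" for x y :: "'m cvec"
    using \<open>p \<noteq> q\<close> by (simp add: fun_upd_twist)
  have two: "sum f {1..?N} = f p + f q" if "\<And>i. i \<in> {1..?N} \<Longrightarrow> i \<noteq> p \<Longrightarrow> i \<noteq> q \<Longrightarrow> f i = 0"
    for f :: "nat \<Rightarrow> complex"
  proof -
    have "sum f {1..?N} = sum f {p, q}"
      by (rule sum.mono_neutral_right) (use that p q in auto)
    then show ?thesis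
      using \<open>p \<noteq> q\<close> by simp
  qed
  have y: "?d x y = u_coord p y * ?d x (u_vec p) + u_coord q y * ?d x (u_vec q)" for x y
  proof -
    have "?d x y = ?d x (\<Sum>i = 1..?N. u_coord i y *s u_vec i)"
      using u_coord_expand[of y] by simp
    also have "\<dots> = (\<Sum>i = 1..?N. u_coord i y * ?d x (u_vec i))"
      by (rule det_frame_upd_sum[OF q])
    also have "\<dots> = u_coord p y * ?d x (u_vec p) + u_coord q y * ?d x (u_vec q)"
    proof (rule two)
      fix i
      assume "i \<in> {1..?N}" "i \<noteq> p" "i \<noteq> q"
      then have "?d x (u_vec i) = 0"
        using q by (intro det_frame_eq_0[of i q]) auto
      then show "u_coord i y * ?d x (u_vec i) = 0"
        by simp
    qed
    finally show ?thesis .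
  qed
  have x: "?d x y = u_coord p x * ?d (u_vec p) y + u_coord q x * ?d (u_vec q) y" for x y
  proof -
    have "?d x y = ?d (\<Sum>i = 1..?N. u_coord i x *s u_vec i) y"
      using u_coord_expand[of x] by simp
    also have "\<dots> = (\<Sum>i = 1..?N. u_coord i x * ?d (u_vec i) y)"
      unfolding swap by (rule det_frame_upd_sum[OF p])
    also have "\<dots> = u_coord p x * ?d (u_vec p) y + u_coord q x * ?d (u_vec q) y"
    proof (rule two)
      fix i
      assume "i \<in> {1..?N}" "i \<noteq> p" "i \<noteq> q"
      then have "?d (u_vec i) y = 0"
        using p \<open>p \<noteq> q\<close> by (intro det_frame_eq_0[of i p]) auto
      then show "u_coord i x * ?d (u_vec i) y = 0"
        by simp
    qed
    finally show ?thesis .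
  qed
  have same: "?d z z = 0" for z
    using p q \<open>p \<noteq> q\<close> by (intro det_frame_eq_0[of p q]) auto
  have "frame_matrix u_vec = (mat 1 :: 'm cmat)"
    by (rule matrix_eq_on_u_vec) simp
  then have one: "?d (u_vec p) (u_vec q) = 1"
    by simp
  \<comment> \<open>The left side is 0, a repeated vector; this yields the sign of the exchanged
    pair.\<close>
  have "?d (u_vec p + u_vec q) (u_vec p + u_vec q) = ?d (u_vec p) (u_vec q) + ?d (u_vec q) (u_vec p)"
    unfolding x[of "u_vec p + u_vec q"] y[of _ "u_vec p + u_vec q"]
    using p q \<open>p \<noteq> q\<close> same[of "u_vec p"] same[of "u_vec q"] by (simp add: u_coord_u_vec)
  then have "?d (u_vec q) (u_vec p) = - 1"
    using same one by (simp add: eq_neg_iff_add_eq_0 add.commute)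
  then show ?thesis
    unfolding x[of x] y[of _ y] using same[of "u_vec p"] same[of "u_vec q"] one by (simp add: algebra_simps)
qed

text \<open>Here \<open>u_vec (2 * i - 1)\<close> is the basis vector \<open>e\<^sub>i\<close>.\<close>

definition quat_upd :: "nat \<Rightarrow> 'm::{finite,linorder} cvec \<Rightarrow> 'm cmat" where
  "quat_upd l x = frame_matrix (quat_frame ((\<lambda>i. u_vec (2 * i - 1))(l := x)))"

lemma quat_frame_upd:
  fixes x :: "'m::{finite,linorder} cvec"
  assumes "l \<in> {1..CARD('m)}" "j \<in> {1..2 * CARD('m)}"
  shows "quat_frame ((\<lambda>i. u_vec (2 * i - 1))(l := x)) j =
    (u_vec(2 * l - 1 := x, 2 * l := jmap x)) j"
proof (cases "odd j")
  case True
  then obtain k where "j = 2 * k + 1"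
    by (rule oddE)
  then show ?thesis
    using assms by (auto simp: quat_frame_def)
next
  case False
  then have "even j"
    by simp
  then obtain k where k: "j = 2 * k"
    by (rule evenE)
  then have "jmap (u_vec (2 * k - 1) :: 'm cvec) = u_vec (2 * k)"
    using assms by (intro jmap_u_vec_odd) auto
  then show ?thesis
    using assms k by (auto simp: quat_frame_def)
qed

lemma quat_upd_u_vec:
  fixes x :: "'m::{finite,linorder} cvec"
  assumes l: "l \<in> {1..CARD('m)}" and i: "i \<in> {1..CARD('m)}"
  shows "quat_upd l x *v u_vec (2 * i - 1) = (if i = l then x else u_vec (2 * i - 1))"
proof -
  have j: "2 * i - 1 \<in> {1..2 * CARD('m)}"
    using i by auto
  have "2 * i - 1 \<noteq> 2 * l" "2 * i - 1 = 2 * l - 1 \<longleftrightarrow> i = l"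
    using l i by (auto; presburger)+
  then show ?thesis
    unfolding quat_upd_def using quat_frame_upd[OF l j, of x] j by auto
qed

text \<open>The determinant is that of the 2 by 2 block with columns from x and j(x), the norm of a
  quaternion.\<close>

lemma det_quat_upd:
  fixes x :: "'m::{finite,linorder} cvec"
  assumes l: "l \<in> {1..CARD('m)}"
  shows "det (quat_upd l x) = of_real ((cmod (u_coord (2 * l - 1) x))\<^sup>2 + (cmod (u_coord (2 * l) x))\<^sup>2)"
proof -
  have pq: "2 * l - 1 \<in> {1..2 * CARD('m)}" "2 * l \<in> {1..2 * CARD('m)}" "2 * l - 1 \<noteq> 2 * l"
    using l by auto
  have "quat_upd l x = frame_matrix (u_vec(2 * l - 1 := x, 2 * l := jmap x))"
    unfolding quat_upd_def by (rule matrix_eq_on_u_vec) (simp only: frame_matrix_u_vec quat_frame_upd[OF l])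
  moreover have "u_coord (2 * l) (jmap x) = cnj (u_coord (2 * l - 1) x)"
    "u_coord (2 * l - 1) (jmap x) = - cnj (u_coord (2 * l) x)"
    using l u_coord_jmap[of "2 * l" x] u_coord_jmap[of "2 * l - 1" x] by (auto simp: partner_def)
  ultimately show ?thesis
    unfolding of_real_add complex_norm_square using det_frame_two[OF pq, of x "jmap x"] by simp
qed

lemma quaternionic_quat_upd: "quaternionic (quat_upd l x)"
  unfolding quat_upd_def by (rule quaternionic_quat_frame)

definition pos_det :: "'m::finite cmat \<Rightarrow> bool" where
  "pos_det X \<longleftrightarrow> (\<exists>r>0. det X = of_real r)"

lemma pos_det_factor:
  assumes "pos_det X" "pos_det (X ** Y)"
  shows "pos_det Y"
proof -
  obtain r s where rs: "r > 0" "det X = of_real r" "s > 0" "det X * det Y = of_real s"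
    using assms by (auto simp: pos_det_def det_mul)
  then have "det Y = of_real (s / r)"
    by (simp add: field_simps)
  then show ?thesis
    unfolding pos_det_def using rs by (intro exI[of _ "s / r"]) auto
qed

lemma pos_det_mult: "pos_det X \<Longrightarrow> pos_det Y \<Longrightarrow> pos_det (X ** Y)"
  unfolding pos_det_def by (metis det_mul mult_pos_pos of_real_mult)

lemma pos_det_quat_upd:
  fixes x :: "'m::{finite,linorder} cvec"
  assumes "l \<in> {1..CARD('m)}" "u_coord (2 * l - 1) x \<noteq> 0 \<or> u_coord (2 * l) x \<noteq> 0"
  shows "pos_det (quat_upd l x)"
proof -
  have "(cmod (u_coord (2 * l - 1) x))\<^sup>2 + (cmod (u_coord (2 * l) x))\<^sup>2 > 0"
    using assms(2) by (auto simp: add_pos_nonneg add_nonneg_pos)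
  then show ?thesis
    unfolding pos_det_def det_quat_upd[OF assms(1)] by blast
qed

text \<open>
  Proved by Gaussian elimination over the quaternions. If the diagonal entry to be cleared vanishes, a shear
  of determinant 1 makes it nonzero first.
\<close>

lemma quaternionic_pos_det:
  fixes X :: "'m::{finite,linorder} cmat"
  assumes "quaternionic X" "det X \<noteq> 0"
  shows "pos_det X"
proof -
  let ?e = "\<lambda>i. u_vec (2 * i - 1) :: 'm cvec"
  have "pos_det X" if "k \<le> CARD('m)" "quaternionic X" "det X \<noteq> 0"
    "\<And>i. k < i \<Longrightarrow> i \<le> CARD('m) \<Longrightarrow> X *v ?e i = ?e i" for k and X :: "'m cmat"
    using that
  proof (induction k arbitrary: X)
    case 0
    have "X = mat 1"
    proof (rule matrix_eq_on_u_vec)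
      fix j
      assume j: "j \<in> {1..2 * CARD('m)}"
      show "X *v u_vec j = mat 1 *v (u_vec j :: 'm cvec)"
      proof (cases "odd j")
        case True
        then obtain i where "j = 2 * i + 1"
          by (rule oddE)
        then show ?thesis
          using 0(4)[of "i + 1"] j by simp
      next
        case False
        then have "even j"
          by simp
        then obtain i where i: "j = 2 * i"
          by (rule evenE)
        then have "u_vec j = jmap (?e i)"
          using j jmap_u_vec_odd[where 'm = 'm, of i] by simp
        moreover have "X *v ?e i = ?e i"
          using 0(4)[of i] i j by simp
        ultimately have "X *v u_vec j = (u_vec j :: 'm cvec)"
          using 0(2) unfolding quaternionic_def by metis
        then show ?thesis
          by simp
      qed
    qed
    then show ?case
      unfolding pos_det_def by (intro exI[of _ 1]) simp
  next
    case (Suc k)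
    let ?l = "Suc k"
    have l: "?l \<in> {1..CARD('m)}"
      using Suc.prems(1) by simp
    \<comment> \<open>With a nonzero diagonal entry: \<open>?T\<close> agrees with \<open>X\<close>
      on the \<open>l\<close>-th and all later e_i, so multiplying by its inverse gives a
      quaternionic matrix that fixes one more basis vector.\<close>
    have main: "pos_det X"
      if X: "quaternionic X" "det X \<noteq> 0" "\<And>i. ?l < i \<Longrightarrow> i \<le> CARD('m) \<Longrightarrow> X *v ?e i = ?e i"
        and nz: "u_coord (2 * ?l - 1) (X *v ?e ?l) \<noteq> 0 \<or> u_coord (2 * ?l) (X *v ?e ?l) \<noteq> 0" for X :: "'m cmat"
    proof -
      let ?T = "quat_upd ?l (X *v ?e ?l)"
      have T: "pos_det ?T"
        by (rule pos_det_quat_upd[OF l nz])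
      then have "det ?T \<noteq> 0"
        by (auto simp: pos_det_def)
      then obtain Y where Y: "?T ** Y = mat 1" "Y ** ?T = mat 1" "det Y \<noteq> 0"
        using matrix_inverse_exists by blast
      have "pos_det (Y ** X)"
      proof (rule Suc.IH)
        show "quaternionic (Y ** X)"
          using quaternionic_inverse[OF quaternionic_quat_upd Y(1,2)] X(1) by (rule quaternionic_mult)
        show "det (Y ** X) \<noteq> 0"
          using Y(3) X(2) by (simp add: det_mul)
        show "(Y ** X) *v ?e i = ?e i" if "k < i" "i \<le> CARD('m)" for i
        proof -
          have "X *v ?e i = ?T *v ?e i"
            using that X(3)[of i] quat_upd_u_vec[OF l, of i "X *v ?e ?l"] by (cases "i = ?l") auto
          then have "(Y ** X) *v ?e i = (Y ** ?T) *v ?e i"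
            by (simp flip: matrix_vector_mul_assoc)
          then show ?thesis
            using Y(2) by simp
        qed
      qed (use Suc.prems(1) in simp)
      moreover have "?T ** (Y ** X) = X"
        using Y(1) by (simp add: matrix_mul_assoc)
      ultimately show ?thesis
        using pos_det_mult[OF T] by metis
    qed
    let ?x = "X *v ?e ?l"
    show ?case
    proof (cases "u_coord (2 * ?l - 1) ?x \<noteq> 0 \<or> u_coord (2 * ?l) ?x \<noteq> 0")
      case True
      then show ?thesis
        using main Suc.prems by blast
    next
      case False
      \<comment> \<open>Otherwise X e_l would be a combination of vectors that \<open>X\<close>
        fixes, so by injectivity it would equal e_l, whose \<open>l\<close>-th entry is not
        zero.\<close>
      have "\<exists>i\<in>{1..k}. u_coord (2 * i - 1) ?x \<noteq> 0 \<or> u_coord (2 * i) ?x \<noteq> 0"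
      proof (rule ccontr)
        assume no: "\<not> ?thesis"
        have "X *v ?x = ?x"
        proof -
          have "X *v (u_coord j ?x *s u_vec j) = u_coord j ?x *s u_vec j" if j: "j \<in> {1..2 * CARD('m)}" for j
          proof -
            define i where "i = (j + 1) div 2"
            have ji: "j = 2 * i - 1 \<or> j = 2 * i" and i: "1 \<le> i" "i \<le> CARD('m)"
              using j unfolding i_def by auto
            show ?thesis
            proof (cases "i \<le> ?l")
              case True
              then have "u_coord (2 * i - 1) ?x = 0 \<and> u_coord (2 * i) ?x = 0"
                using no False i by (cases "i = ?l") auto
              then show ?thesis
                using ji by auto
            next
              case gt: False
              then have e: "X *v ?e i = ?e i"
                using Suc.prems(4) i by auto
              moreover have "u_vec (2 * i) = jmap (?e i)"
                using i jmap_u_vec_odd[where 'm = 'm, of i] by simp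
              ultimately have "X *v u_vec (2 * i) = (u_vec (2 * i) :: 'm cvec)"
                using Suc.prems(2) unfolding quaternionic_def by metis
              with e ji show ?thesis
                by (auto simp: vector_scalar_commute)
            qed
          qed
          then have "X *v (\<Sum>j = 1..2 * CARD('m). u_coord j ?x *s u_vec j) =
              (\<Sum>j = 1..2 * CARD('m). u_coord j ?x *s u_vec j)"
            unfolding matrix_vector_mult_sum by (rule sum.cong[OF refl])
          then show ?thesis
            using u_coord_expand[of ?x] by simp
        qed
        then have "?x = ?e ?l"
          using matrix_vector_inj[OF Suc.prems(3), of ?x "?e ?l"] by simp
        then show False
          using False u_coord_u_vec[where 'm = 'm, of "2 * ?l - 1" "2 * ?l - 1"] l by auto
      qed
      then obtain i where i: "i \<in> {1..k}" "u_coord (2 * i - 1) ?x \<noteq> 0 \<or> u_coord (2 * i) ?x \<noteq> 0"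
        by blast
      \<comment> \<open>The shear e_i to e_i + e_l adds the \<open>i\<close>-th quaternionic entry
        of \<open>?x\<close> to its vanishing \<open>l\<close>-th one.\<close>
      let ?S = "quat_upd i (?e i + ?e ?l)"
      have im: "i \<in> {1..CARD('m)}"
        using i Suc.prems(1) by auto
      have mem: "2 * i - 1 \<in> {1..2 * CARD('m)}" "2 * ?l - 1 \<in> {1..2 * CARD('m)}" "2 * i - 1 \<noteq> 2 * ?l - 1"
        using im l i(1) by auto
      have "u_coord (2 * i - 1) (?e i + ?e ?l) = 1"
        using u_coord_u_vec[where 'm = 'm, OF mem(1,1)] u_coord_u_vec[where 'm = 'm, OF mem(1,2)] mem(3) by simp
      then have S: "pos_det ?S"
        by (intro pos_det_quat_upd im) simp
      have "?S *v ?x = ?x + (u_coord (2 * i - 1) ?x *s ?e ?l + u_coord (2 * i) ?x *s u_vec (2 * ?l))"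
      proof -
        have upd: "?S *v u_vec j = (u_vec j :: 'm cvec) + (if j = 2 * i - 1 then ?e ?l else if j = 2 * i then u_vec (2 * ?l) else 0)"
          if j: "j \<in> {1..2 * CARD('m)}" for j
        proof -
          have J: "jmap (?e r) = u_vec (2 * r)" if "r \<in> {1..CARD('m)}" for r
            using that by (rule jmap_u_vec_odd)
          show ?thesis
            unfolding quat_upd_def frame_matrix_u_vec[OF j] quat_frame_upd[OF im j]
            using J[OF im] J[OF l] im by (auto simp: jmap_add)
        qed
        have "?S *v ?x = (\<Sum>j = 1..2 * CARD('m). u_coord j ?x *s (?S *v u_vec j))"
          by (subst u_coord_expand) (simp only: matrix_vector_mult_sum vector_scalar_commute)
        also have "\<dots> = (\<Sum>j = 1..2 * CARD('m). u_coord j ?x *s u_vec j +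
            ((if j = 2 * i - 1 then u_coord j ?x *s ?e ?l else 0) +
             (if j = 2 * i then u_coord j ?x *s u_vec (2 * ?l) else 0)))"
          proof (rule sum.cong[OF refl])
          fix j
          assume j: "j \<in> {1..2 * CARD('m)}"
          have "2 * i - 1 \<noteq> 2 * i"
            using im by auto
          then show "u_coord j ?x *s (?S *v u_vec j) = u_coord j ?x *s u_vec j +
            ((if j = 2 * i - 1 then u_coord j ?x *s ?e ?l else 0) +
             (if j = 2 * i then u_coord j ?x *s u_vec (2 * ?l) else 0))"
            unfolding upd[OF j] by (simp add: vector_add_ldistrib)
        qed
        also have "\<dots> = ?x + (u_coord (2 * i - 1) ?x *s ?e ?l + u_coord (2 * i) ?x *s u_vec (2 * ?l))"
          using im u_coord_expand[of ?x] by (simp add: sum.distrib) auto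
        finally show ?thesis .
      qed
      then have "u_coord (2 * ?l - 1) ((?S ** X) *v ?e ?l) = u_coord (2 * i - 1) ?x"
        "u_coord (2 * ?l) ((?S ** X) *v ?e ?l) = u_coord (2 * i) ?x"
        using False l u_coord_u_vec[where 'm = 'm, of "2 * ?l - 1"] u_coord_u_vec[where 'm = 'm, of "2 * ?l"]
        by (auto simp flip: matrix_vector_mul_assoc)
      then have "pos_det (?S ** X)"
      proof (intro main)
        show "quaternionic (?S ** X)"
          using quaternionic_quat_upd Suc.prems(2) by (rule quaternionic_mult)
        show "det (?S ** X) \<noteq> 0"
          using S Suc.prems(3) by (auto simp: pos_det_def det_mul)
        show "(?S ** X) *v ?e r = ?e r" if "?l < r" "r \<le> CARD('m)" for r
          using that Suc.prems(4) quat_upd_u_vec[OF im, of r] i(1) by (simp flip: matrix_vector_mul_assoc)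
      qed (use i(2) in simp)
      then show ?thesis
        by (rule pos_det_factor[OF S])
    qed
  qed
  from this[of "CARD('m)" X] show ?thesis
    using assms by simp
qed

subsection \<open>The open orbit\<close>

definition transversal_flags :: "'m::finite flag set" where
  "transversal_flags = {F \<in> complete_flags. \<forall>p\<le>2 * CARD('m). F p \<inter> jmap ` F (2 * CARD('m) - p) \<subseteq> {0}}"

definition isotropic_flags :: "'m::finite flag set" where
  "isotropic_flags = {F \<in> complete_flags. \<forall>p\<le>2 * CARD('m). F p \<subseteq> perp (F (2 * CARD('m) - p))}"

lemma dim_add_le_of_Int:
  fixes A B S :: "'m::finite cvec set"
  assumes "vec.subspace A" "vec.subspace B" "vec.subspace S" "A \<subseteq> S" "B \<subseteq> S" "A \<inter> B \<subseteq> {0}"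
  shows "vec.dim A + vec.dim B \<le> vec.dim S"
proof -
  have "{x + y |x y. x \<in> A \<and> y \<in> B} \<subseteq> S"
    using assms(3,4,5) by (auto intro: vec.subspace_add)
  then have "vec.dim {x + y |x y. x \<in> A \<and> y \<in> B} \<le> vec.dim S"
    by (rule vec.dim_subset)
  moreover have "vec.dim (A \<inter> B) = 0"
    using assms(6) vec.dim_eq_0 by blast
  ultimately show ?thesis
    using vec.dim_sums_Int[OF assms(1,2)] by linarith
qed

lemma dim_UNIV_cvec: "vec.dim (UNIV :: 'm::finite cvec set) = 2 * CARD('m)"
  unfolding vec_dim_card by simp

text \<open>A common vector j(w) satisfies omega(w, j(w)) = 0, and this value is minus the squared
  norm of w. Hence isotropic flags are transversal, and perp spaces have at most the complementary
  dimension.\<close>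

lemma perp_Int_jmap: "perp W \<inter> jmap ` W \<subseteq> {0}"
proof
  fix v
  assume "v \<in> perp W \<inter> jmap ` W"
  then obtain w where w: "w \<in> W" "v = jmap w" "omega (jmap w) w = 0"
    by (auto simp: perp_def)
  then have "omega w (jmap w) = 0"
    using omega_swap[of "jmap w" w] by simp
  then show "v \<in> {0}"
    using w(2) by (simp add: omega_self_jmap_eq_0)
qed

lemma subspace_perp: "vec.subspace (perp W)"
  by (auto simp: vec.subspace_def perp_def omega_add_left omega_scale_left)

lemma dim_perp_le:
  fixes W :: "'m::finite cvec set"
  assumes "vec.subspace W"
  shows "vec.dim (perp W) + vec.dim W \<le> 2 * CARD('m)"
proof -
  have "vec.dim (perp W) + vec.dim (jmap ` W) \<le> vec.dim (UNIV :: 'm cvec set)"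
    by (rule dim_add_le_of_Int)
      (use subspace_perp subspace_jmap_image[OF assms] perp_Int_jmap in \<open>auto simp: vec.subspace_UNIV\<close>)
  then show ?thesis
    by (simp only: dim_jmap_image[OF assms] dim_UNIV_cvec)
qed

lemma isotropic_subset_transversal: "isotropic_flags \<subseteq> (transversal_flags :: 'm::finite flag set)"
proof
  fix F :: "'m flag"
  assume F: "F \<in> isotropic_flags"
  have "F p \<inter> jmap ` F (2 * CARD('m) - p) \<subseteq> {0}" if "p \<le> 2 * CARD('m)" for p
    using F that perp_Int_jmap[of "F (2 * CARD('m) - p)"] unfolding isotropic_flags_def by blast
  with F show "F \<in> transversal_flags"
    by (simp add: isotropic_flags_def transversal_flags_def)
qed

text \<open>One-line notation 1 3 ... 2m-1 2m ... 4 2, the strictly pairing permutation with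
  increasing left half. Its flag serves as base point of both the open orbit and the cycle.\<close>

definition base_perm :: "nat \<Rightarrow> nat \<Rightarrow> nat" where
  "base_perm m i = (if i \<in> {1..m} then 2 * i - 1 else if i \<in> {m + 1..2 * m} then 2 * (2 * m + 1 - i) else i)"

lemma base_perm_permutes: "base_perm m permutes {1..2 * m}"
proof (rule bij_imp_permutes)
  show "bij_betw (base_perm m) {1..2 * m} {1..2 * m}"
  proof (rule bij_betw_byWitness[where f' = "\<lambda>j. if odd j then (j + 1) div 2 else 2 * m + 1 - j div 2"])
    show "\<forall>i\<in>{1..2 * m}. (if odd (base_perm m i) then (base_perm m i + 1) div 2
        else 2 * m + 1 - base_perm m i div 2) = i"
    proof
      fix i
      assume i: "i \<in> {1..2 * m}"
      show "(if odd (base_perm m i) then (base_perm m i + 1) div 2 else 2 * m + 1 - base_perm m i div 2) = i"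
      proof (cases "i \<le> m")
        case True
        then have "base_perm m i = 2 * i - 1" "odd (2 * i - 1)" "(2 * i - 1 + 1) div 2 = i"
          using i by (auto simp: base_perm_def)
        then show ?thesis
          by simp
      next
        case False
        then show ?thesis
          using i by (auto simp: base_perm_def)
      qed
    qed
    show "\<forall>j\<in>{1..2 * m}. base_perm m (if odd j then (j + 1) div 2 else 2 * m + 1 - j div 2) = j"
    proof
      fix j
      assume j: "j \<in> {1..2 * m}"
      show "base_perm m (if odd j then (j + 1) div 2 else 2 * m + 1 - j div 2) = j"
      proof (cases "odd j")
        case True
        then obtain k where "j = 2 * k + 1"
          by (rule oddE)
        then show ?thesis
          using j by (auto simp: base_perm_def)
      next
        case False
        then have "even j"
          by simp
        then obtain k where "j = 2 * k"
          by (rule evenE)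
        then show ?thesis
          using j by (auto simp: base_perm_def)
      qed
    qed
  show "(\<lambda>j. if odd j then (j + 1) div 2 else 2 * m + 1 - j div 2) ` {1..2 * m} \<subseteq> {1..2 * m}"
    proof (rule image_subsetI)
      fix j
      assume "j \<in> {1..2 * m}"
      then show "(if odd j then (j + 1) div 2 else 2 * m + 1 - j div 2) \<in> {1..2 * m}"
        unfolding atLeastAtMost_iff by presburger
    qed
  qed (auto simp: base_perm_def)
qed (auto simp: base_perm_def)

lemma strictly_pairing_base_perm: "strictly_pairing m (base_perm m)"
  by (auto simp: strictly_pairing_def base_perm_def)

definition base_flag :: "'m::{finite,linorder} flag" where
  "base_flag = flag_of_basis (u_vec \<circ> base_perm CARD('m))"

lemma quat_frame_base_perm:
  assumes "p \<in> {1..2 * CARD('m)}"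
  shows "quat_frame v (base_perm CARD('m) p) =
    (if p \<le> CARD('m) then v p else jmap (v (2 * CARD('m) + 1 - p)) :: 'm::finite cvec)"
proof (cases "p \<le> CARD('m)")
  case True
  then have "base_perm CARD('m) p = 2 * p - 1" "odd (2 * p - 1)" "(2 * p - 1 + 1) div 2 = p"
    using assms by (auto simp: base_perm_def)
  with True show ?thesis
    by (simp add: quat_frame_def)
next
  case False
  then have "base_perm CARD('m) p = 2 * (2 * CARD('m) + 1 - p)"
    using assms by (auto simp: base_perm_def)
  with False show ?thesis
    by (simp add: quat_frame_def)
qed

lemma flag_of_basis_perm:
  fixes b :: "nat \<Rightarrow> 'm::{finite,linorder} cvec"
  assumes "w permutes {1..2 * CARD('m)}"
  shows "act (frame_matrix b) (flag_of_basis (u_vec \<circ> w)) = flag_of_basis (b \<circ> w)"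
    "frame_matrix b ** frame_matrix (u_vec \<circ> w) = frame_matrix (b \<circ> w)"
proof -
  have "frame_matrix b *v (u_vec \<circ> w) j = (b \<circ> w) j" if "j \<in> {1..2 * CARD('m)}" for j
    using that permutes_in_image[OF assms, of j] by (simp only: o_apply frame_matrix_u_vec)
  then show "act (frame_matrix b) (flag_of_basis (u_vec \<circ> w)) = flag_of_basis (b \<circ> w)"
    "frame_matrix b ** frame_matrix (u_vec \<circ> w) = frame_matrix (b \<circ> w)"
    unfolding act_flag_of_basis
    by (auto intro!: flag_of_basis_cong matrix_eq_on_u_vec simp flip: matrix_vector_mul_assoc)
qed

text \<open>
  In a transversal flag the lines \<open>F i \<inter> j (F (n + 1 - i))\<close>, \<open>i \<le> m\<close>, form a quaternionic basis
  adapted to the flag.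
\<close>

definition quat_adapted :: "'m::finite flag \<Rightarrow> (nat \<Rightarrow> 'm cvec) \<Rightarrow> bool" where
  "quat_adapted F v \<longleftrightarrow> (\<forall>i\<in>{1..CARD('m)}. v i \<noteq> 0 \<and> v i \<in> F i \<and> jmap (v i) \<in> F (2 * CARD('m) + 1 - i))"

text \<open>The dimensions i and n + 1 - i exceed n together, so F_i and j(F_{n+1-i}) share a
  nonzero vector.\<close>

lemma quat_adapted_exists:
  fixes F :: "'m::finite flag"
  assumes "F \<in> complete_flags"
  obtains v where "quat_adapted F v"
proof -
  note sub = complete_flagsD(2)[OF assms] and dim = complete_flagsD(3)[OF assms]
  have "\<exists>x. x \<noteq> 0 \<and> x \<in> F i \<and> jmap x \<in> F (2 * CARD('m) + 1 - i)" if i: "i \<in> {1..CARD('m)}" for i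
  proof (rule ccontr)
    assume no: "\<not> ?thesis"
    let ?G = "F (2 * CARD('m) + 1 - i)"
    have "F i \<inter> jmap ` ?G \<subseteq> {0}"
    proof
      fix x
      assume x: "x \<in> F i \<inter> jmap ` ?G"
      then obtain y where "y \<in> ?G" "x = jmap y"
        by blast
      then have "jmap x \<in> ?G"
        using vec.subspace_neg[OF sub] by simp
      with no x show "x \<in> {0}"
        by blast
    qed
    then have "vec.dim (F i) + vec.dim (jmap ` ?G) \<le> vec.dim (UNIV :: 'm cvec set)"
      by (intro dim_add_le_of_Int sub subspace_jmap_image) (auto simp: vec.subspace_UNIV)
    moreover have "min i (2 * CARD('m)) = i"
      "min (2 * CARD('m) + 1 - i) (2 * CARD('m)) = 2 * CARD('m) + 1 - i"
      using i by auto
    ultimately have "i + (2 * CARD('m) + 1 - i) \<le> 2 * CARD('m)"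
      by (simp only: dim_jmap_image[OF sub] dim dim_UNIV_cvec)
    then show False
      by arith
  qed
  then obtain v where "\<forall>i\<in>{1..CARD('m)}. v i \<noteq> 0 \<and> v i \<in> F i \<and> jmap (v i) \<in> F (2 * CARD('m) + 1 - i)"
    by metis
  then show ?thesis
    using that by (simp add: quat_adapted_def)
qed

text \<open>Transversality at position i - 1 keeps v_i out of F_{i-1}, and at position i it keeps
  j(v_i) out of F_{n-i}. So v_1, ..., v_m, j(v_m), ..., j(v_1) is adapted to
  \<open>F\<close>.\<close>

lemma quat_adapted_frame:
  fixes F :: "'m::{finite,linorder} flag"
  assumes F: "F \<in> transversal_flags" and v: "quat_adapted F v"
  shows "det (frame_matrix (quat_frame v)) \<noteq> 0" "F = act (frame_matrix (quat_frame v)) base_flag"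
proof -
  let ?N = "2 * CARD('m)" and ?w = "base_perm CARD('m)"
  have Fc: "F \<in> complete_flags" and tr: "\<And>p x. p \<le> ?N \<Longrightarrow> x \<in> F p \<Longrightarrow> x \<in> jmap ` F (?N - p) \<Longrightarrow> x = 0"
    using F by (auto simp: transversal_flags_def)
  note sub = complete_flagsD(2)[OF Fc]
  have vD: "v i \<noteq> 0" "v i \<in> F i" "jmap (v i) \<in> F (?N + 1 - i)" "v i \<in> jmap ` F (?N + 1 - i)"
    if "i \<in> {1..CARD('m)}" for i
  proof -
    show *: "v i \<noteq> 0" "v i \<in> F i" "jmap (v i) \<in> F (?N + 1 - i)"
      using v that by (auto simp: quat_adapted_def)
    have "v i = jmap (- jmap (v i))"
      by (simp add: jmap_minus)
    then show "v i \<in> jmap ` F (?N + 1 - i)"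
      using vec.subspace_neg[OF sub *(3)] by blast
  qed
  have "adapted F (quat_frame v \<circ> ?w)"
    unfolding adapted_def
  proof
    fix p
    assume p: "p \<in> {1..?N}"
    show "(quat_frame v \<circ> ?w) p \<in> F p \<and> (quat_frame v \<circ> ?w) p \<notin> F (p - 1)"
    proof (cases "p \<le> CARD('m)")
      case True
      then have i: "p \<in> {1..CARD('m)}"
        using p by auto
      have p1: "p - 1 \<le> ?N" "?N - (p - 1) = ?N + 1 - p"
        using p by auto
      have "v p \<notin> F (p - 1)"
        using tr[OF p1(1)] vD(1,4)[OF i] unfolding p1(2) by blast
      then show ?thesis
        using True quat_frame_base_perm[OF p, of v] vD(2)[OF i] by simp
    next
      case False
      define i where "i = ?N + 1 - p"
      have i: "i \<in> {1..CARD('m)}" "?N + 1 - i = p" "?N - i = p - 1" "i \<le> ?N"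
        using False p by (auto simp: i_def)
      have "jmap (v i) \<notin> F (p - 1)"
      proof
        assume "jmap (v i) \<in> F (p - 1)"
        then have "- jmap (v i) \<in> F (?N - i)"
          using vec.subspace_neg[OF sub] i(3) by simp
        moreover have "v i = jmap (- jmap (v i))"
          by (simp add: jmap_minus)
        ultimately have "v i = 0"
          using tr[OF i(4) vD(2)[OF i(1)]] by blast
        then show False
          using vD(1)[OF i(1)] by simp
      qed
      then show ?thesis
        using False quat_frame_base_perm[OF p, of v] vD(3)[OF i(1)] i(2) by (simp add: i_def)
    qed
  qed
  note ad = adapted_frame[OF Fc this]
  have "det (frame_matrix (quat_frame v) ** frame_matrix (u_vec \<circ> ?w) :: 'm cmat) \<noteq> 0"
    using ad(1) flag_of_basis_perm(2)[OF base_perm_permutes, of "quat_frame v"] by simp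
  then show "det (frame_matrix (quat_frame v)) \<noteq> 0"
    by (auto simp: det_mul)
  show "F = act (frame_matrix (quat_frame v)) base_flag"
    unfolding base_flag_def flag_of_basis_perm(1)[OF base_perm_permutes] using ad(2) by simp
qed

lemma quaternionic_act_transversal:
  fixes F :: "'m::finite flag"
  assumes X: "quaternionic X" "det X \<noteq> 0" and F: "F \<in> transversal_flags"
  shows "act X F \<in> transversal_flags"
proof -
  have Fc: "F \<in> complete_flags"
    using F by (simp add: transversal_flags_def)
  have "x = 0" if p: "p \<le> 2 * CARD('m)" and x: "x \<in> act X F p" "x \<in> jmap ` act X F (2 * CARD('m) - p)" for p x
  proof -
    obtain y z where y: "y \<in> F p" "x = X *v y" and z: "z \<in> F (2 * CARD('m) - p)" "x = jmap (X *v z)"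
      using x by (auto simp: act_def)
    have "X *v y = X *v jmap z"
      using y(2) z(2) X(1) by (simp add: quaternionic_def)
    then have "y = jmap z"
      by (rule matrix_vector_inj[OF X(2)])
    then have "y = 0"
      using F p y(1) z(1) unfolding transversal_flags_def by blast
    then show ?thesis
      using y(2) by simp
  qed
  then show ?thesis
    using act_complete[OF X(2) Fc] unfolding transversal_flags_def by blast
qed

text \<open>Only real scalars commute with j, so the determinant can be normalized inside the
  quaternionic matrices by a real root; its positivity provides one.\<close>

lemma quaternionic_rescale:
  fixes X :: "'m::{finite,linorder} cmat"
  assumes X: "quaternionic X" "det X \<noteq> 0"
  obtains Y where "Y \<in> SL_quat" "\<And>F. F \<in> complete_flags \<Longrightarrow> act Y F = act X F"
proof -
  obtain r where r: "r > 0" "det X = of_real r"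
    using quaternionic_pos_det[OF X] by (auto simp: pos_det_def)
  define c where "c = root CARD('m + 'm) (1 / r)"
  have c: "c > 0" "c ^ CARD('m + 'm) * r = 1"
    using r(1) by (simp_all add: c_def real_root_gt_zero real_root_pow_pos2 del: card_sum)
  let ?Y = "(\<chi> i. of_real c *s X $ i) :: 'm cmat"
  have Yv: "?Y *v v = of_real c *s (X *v v)" for v
    by (simp add: matrix_vector_mult_def vec_eq_iff sum_distrib_left mult.assoc)
  have "det ?Y = (\<Prod>i\<in>(UNIV :: ('m + 'm) set). of_real c) * det X"
    using det_rows_mul[of "\<lambda>_. of_real c" "\<lambda>i. X $ i"] by simp
  also have "\<dots> = of_real (c ^ CARD('m + 'm) * r)"
    by (simp add: r(2) del: card_sum)
  finally have "det ?Y = 1"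
    unfolding c(2) by simp
  then have "?Y \<in> SL_quat"
    using X(1) by (simp add: SL_quat_def SL_def Yv jmap_scale vector_scalar_commute quaternionic_def)
  moreover have "act ?Y F = act X F" if F: "F \<in> complete_flags" for F
  proof
    fix k
    note sub = complete_flagsD(2)[OF F, of k]
    show "act ?Y F k = act X F k"
    proof (intro Set.set_eqI iffI)
      fix x
      assume "x \<in> act ?Y F k"
      then obtain y where "y \<in> F k" "x = X *v (of_real c *s y)"
        by (auto simp: act_def Yv vector_scalar_commute)
      then show "x \<in> act X F k"
        using vec.subspace_scale[OF sub] by (auto simp: act_def)
    next
      fix x
      assume "x \<in> act X F k"
      then obtain y where y: "y \<in> F k" "x = X *v y"
        by (auto simp: act_def)
      then have "x = ?Y *v (inverse (of_real c) *s y)"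
        using c(1) by (simp add: Yv vector_scalar_commute vector_smult_assoc)
      then show "x \<in> act ?Y F k"
        using vec.subspace_scale[OF sub y(1)] by (auto simp: act_def)
    qed
  qed
  ultimately show ?thesis
    by (rule that)
qed

lemma SL_quat_quaternionic: "X \<in> SL_quat \<Longrightarrow> quaternionic X \<and> det X \<noteq> 0"
  by (simp add: SL_quat_def SL_def quaternionic_def)

text \<open>Both flags are images of the base flag under quaternionic frames, so one frame times the
  inverse of the other carries \<open>F\<close> to \<open>G\<close>.\<close>

lemma transversal_orbit:
  fixes F :: "'m::{finite,linorder} flag"
  assumes F: "F \<in> transversal_flags"
  shows "orbit SL_quat F = transversal_flags"
proof (intro subset_antisym subsetI)
  fix G
  assume "G \<in> orbit SL_quat F"
  then show "G \<in> transversal_flags"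
    using F SL_quat_quaternionic quaternionic_act_transversal unfolding orbit_def by blast
next
  fix G :: "'m flag"
  assume G: "G \<in> transversal_flags"
  have Fc: "F \<in> complete_flags" "G \<in> complete_flags"
    using F G by (simp_all add: transversal_flags_def)
  obtain v where v: "quat_adapted F v"
    using quat_adapted_exists[OF Fc(1)] .
  obtain v' where v': "quat_adapted G v'"
    using quat_adapted_exists[OF Fc(2)] .
  let ?X = "frame_matrix (quat_frame v)" and ?X' = "frame_matrix (quat_frame v')"
  note X = quat_adapted_frame[OF F v] and X' = quat_adapted_frame[OF G v']
  obtain Y where Y: "?X ** Y = mat 1" "Y ** ?X = mat 1" "det Y \<noteq> 0"
    using matrix_inverse_exists[OF X(1)] .
  have "act (?X' ** Y) F = act (?X' ** (Y ** ?X)) base_flag"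
    unfolding X(2) by (simp only: act_mult)
  then have G: "act (?X' ** Y) F = G"
    using Y(2) X'(2) by simp
  have q: "quaternionic (?X' ** Y)" "det (?X' ** Y) \<noteq> 0"
    using quaternionic_mult[OF quaternionic_quat_frame quaternionic_inverse[OF quaternionic_quat_frame Y(1,2)]]
      X'(1) Y(3) by (simp_all add: det_mul)
  obtain Z where Z: "Z \<in> SL_quat" "\<And>F. F \<in> complete_flags \<Longrightarrow> act Z F = act (?X' ** Y) F"
    using quaternionic_rescale[OF q] by blast
  have "G = act Z F"
    using G Z(2)[OF Fc(1)] by simp
  then show "G \<in> orbit SL_quat F"
    unfolding orbit_def using Z(1) by (rule image_eqI)
qed

lemma partner_strictly_pairing:
  assumes sp: "strictly_pairing m w" and a: "a \<in> {1..2 * m}"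
  shows "partner (w a) = w (2 * m + 1 - a)"
proof (cases "a \<le> m")
  case True
  then show ?thesis
    using sp a by (auto simp: strictly_pairing_def partner_def)
next
  case False
  then have "2 * m + 1 - a \<in> {1..m}" "2 * m + 1 - (2 * m + 1 - a) = a"
    using a by auto
  then have "odd (w (2 * m + 1 - a))" "w a = w (2 * m + 1 - a) + 1"
    using sp unfolding strictly_pairing_def by fastforce+
  then show ?thesis
    by (simp add: partner_def)
qed

lemma isotropic_basis_iff:
  fixes b :: "nat \<Rightarrow> 'm::{finite,linorder} cvec"
  assumes det: "det (frame_matrix b) \<noteq> 0"
  shows "flag_of_basis b \<in> isotropic_flags \<longleftrightarrow>
    (\<forall>i\<in>{1..2 * CARD('m)}. \<forall>j\<in>{1..2 * CARD('m)}. i + j \<le> 2 * CARD('m) \<longrightarrow> omega (b i) (b j) = 0)"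
proof
  assume iso: "flag_of_basis b \<in> isotropic_flags"
  show "\<forall>i\<in>{1..2 * CARD('m)}. \<forall>j\<in>{1..2 * CARD('m)}. i + j \<le> 2 * CARD('m) \<longrightarrow> omega (b i) (b j) = 0"
  proof (intro ballI impI)
    fix i j
    assume ij: "i \<in> {1..2 * CARD('m)}" "j \<in> {1..2 * CARD('m)}" "i + j \<le> 2 * CARD('m)"
    then have "b i \<in> flag_of_basis b i" "b j \<in> flag_of_basis b (2 * CARD('m) - i)"
      by (auto simp: flag_of_basis_def intro!: vec.span_base)
    moreover have "flag_of_basis b i \<subseteq> perp (flag_of_basis b (2 * CARD('m) - i))"
      using iso ij by (auto simp: isotropic_flags_def)
    ultimately show "omega (b i) (b j) = 0"
      by (auto simp: perp_def)
  qed
next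
  assume *: "\<forall>i\<in>{1..2 * CARD('m)}. \<forall>j\<in>{1..2 * CARD('m)}. i + j \<le> 2 * CARD('m) \<longrightarrow> omega (b i) (b j) = 0"
  have "omega x y = 0"
    if p: "p \<le> 2 * CARD('m)" and x: "x \<in> flag_of_basis b p" and y: "y \<in> flag_of_basis b (2 * CARD('m) - p)" for p x y
  proof -
    obtain c where c: "\<And>i. p < i \<Longrightarrow> c i = 0" "x = (\<Sum>i = 1..2 * CARD('m). c i *s b i)"
      using x by (elim flag_of_basis_memE) blast
    obtain d where d: "\<And>i. 2 * CARD('m) - p < i \<Longrightarrow> d i = 0" "y = (\<Sum>i = 1..2 * CARD('m). d i *s b i)"
      using y by (elim flag_of_basis_memE) blast
    have "omega x y = (\<Sum>i = 1..2 * CARD('m). c i * omega (b i) y)"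
      unfolding c(2) by (simp add: omega_sum_left omega_scale_left)
    also have "\<dots> = (\<Sum>i = 1..2 * CARD('m). \<Sum>j = 1..2 * CARD('m). c i * (d j * omega (b i) (b j)))"
      unfolding d(2) by (simp add: omega_sum_right omega_scale_right sum_distrib_left)
    also have "\<dots> = 0"
    proof (intro sum.neutral ballI)
      fix i j
      assume ij: "i \<in> {1..2 * CARD('m)}" "j \<in> {1..2 * CARD('m)}"
      show "c i * (d j * omega (b i) (b j)) = 0"
      proof (cases "p < i \<or> 2 * CARD('m) - p < j")
        case True
        then show ?thesis
          using c(1) d(1) by auto
      next
        case False
        then have "i + j \<le> 2 * CARD('m)"
          using p by linarith
        then show ?thesis
          using * ij by simp
      qed
    qed
    finally show ?thesis .
  qed
  then show "flag_of_basis b \<in> isotropic_flags"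
    using flag_of_basis_complete[OF det] unfolding isotropic_flags_def perp_def by blast
qed

lemma det_perm_frame:
  assumes "w permutes {1..2 * CARD('m)}"
  shows "det (frame_matrix (u_vec \<circ> w) :: 'm::{finite,linorder} cmat) \<noteq> 0"
proof -
  have "chart_frame w (\<lambda>_. 0) = (u_vec \<circ> w :: nat \<Rightarrow> 'm cvec)"
    by (simp add: fun_eq_iff chart_frame_def)
  then show ?thesis
    using det_chart_frame[OF assms, of "\<lambda>_. 0"] by simp
qed

text \<open>omega pairs the vector at place i only with the one at place n + 1 - i, which i + j at
  most n excludes.\<close>

lemma strictly_pairing_isotropic:
  assumes "w permutes {1..2 * CARD('m)}" "strictly_pairing CARD('m) w"
  shows "flag_of_basis (u_vec \<circ> w) \<in> (isotropic_flags :: 'm::{finite,linorder} flag set)"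
  unfolding isotropic_basis_iff[OF det_perm_frame[OF assms(1)]]
proof (intro ballI impI)
  fix i j
  assume ij: "i \<in> {1..2 * CARD('m)}" "j \<in> {1..2 * CARD('m)}" "i + j \<le> 2 * CARD('m)"
  have "w j \<noteq> partner (w i)"
  proof
    assume "w j = partner (w i)"
    then have "w j = w (2 * CARD('m) + 1 - i)"
      using partner_strictly_pairing[OF assms(2) ij(1)] by simp
    then have "j = 2 * CARD('m) + 1 - i"
      using permutes_inj[OF assms(1)] by (rule injD[rotated])
    then show False
      using ij by linarith
  qed
  moreover have "w i \<in> {1..2 * CARD('m)}" "w j \<in> {1..2 * CARD('m)}"
    using ij permutes_in_image[OF assms(1)] by blast+
  ultimately show "omega ((u_vec \<circ> w) i :: 'm cvec) ((u_vec \<circ> w) j) = 0"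
    by (simp only: o_apply omega_u_vec if_False)
qed

lemma base_flag_isotropic: "base_flag \<in> (isotropic_flags :: 'm::{finite,linorder} flag set)"
  unfolding base_flag_def
  by (intro strictly_pairing_isotropic base_perm_permutes strictly_pairing_base_perm)

subsection \<open>The base cycle consists of the isotropic flags\<close>

text \<open>Every flag obeys the bound min(i, n - j) on dim(F_i cap perp(F_j)), and isotropic flags
  attain it for all i and j at once. So a flag with all these dimensions maximal must attain it
  too.\<close>

lemma base_cycle_transversal:
  "base_cycle transversal_flags = (isotropic_flags :: 'm::{finite,linorder} flag set)"
proof -
  let ?N = "2 * CARD('m)"
  \<comment> \<open>The inner \<open>min j ?N\<close> accounts for the constant continuation of a
    flag beyond n.\<close>
  have upper: "vec.dim (F i \<inter> perp (F j)) \<le> min i (?N - min j ?N)" if F: "F \<in> complete_flags" for F :: "'m flag" and i j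
  proof -
    have "vec.dim (F i \<inter> perp (F j)) \<le> vec.dim (F i)" "vec.dim (F i \<inter> perp (F j)) \<le> vec.dim (perp (F j))"
      by (auto intro: vec.dim_subset)
    then show ?thesis
      using dim_perp_le[OF complete_flagsD(2)[OF F, of j]] complete_flagsD(3)[OF F] by auto
  qed
  have lower: "min i (?N - min j ?N) \<le> vec.dim (F i \<inter> perp (F j))" if F: "F \<in> isotropic_flags" for F :: "'m flag" and i j
  proof -
    let ?k = "min i (?N - min j ?N)"
    have Fc: "F \<in> complete_flags"
      using F by (simp add: isotropic_flags_def)
    have "F j = F (min j ?N)"
    proof (rule subspace_eq_of_dim[symmetric])
      show "F (min j ?N) \<subseteq> F j"
        using complete_flag_memI[OF Fc] by (meson min.cobounded1 subsetI)
    qed (use complete_flagsD[OF Fc] in auto)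
    moreover have "F (?N - min j ?N) \<subseteq> perp (F (min j ?N))"
    proof -
      have "F p \<subseteq> perp (F (?N - p))" if "p \<le> ?N" for p
        using F that by (auto simp: isotropic_flags_def)
      from this[of "?N - min j ?N"] show ?thesis
        by simp
    qed
    ultimately have "F ?k \<subseteq> F i \<inter> perp (F j)"
      using complete_flag_memI[OF Fc, of ?k i] complete_flag_memI[OF Fc, of ?k "?N - min j ?N"] by auto
    then have "vec.dim (F ?k) \<le> vec.dim (F i \<inter> perp (F j))"
      by (rule vec.dim_subset)
    moreover have "min ?k ?N = ?k"
      by linarith
    ultimately show ?thesis
      by (simp only: complete_flagsD(3)[OF Fc])
  qed
  show ?thesis
  proof (intro subset_antisym subsetI)
    fix F :: "'m flag"
    assume F: "F \<in> base_cycle transversal_flags"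
    then have Fc: "F \<in> complete_flags"
      by (auto simp: base_cycle_def transversal_flags_def)
    note sub = complete_flagsD(2)[OF Fc]
    have "F p \<subseteq> perp (F (?N - p))" if p: "p \<le> ?N" for p
    proof -
      \<comment> \<open>The base flag lies in the orbit and attains the bound, so it can be compared
        with \<open>F\<close>.\<close>
      have "p \<le> vec.dim (base_flag p \<inter> perp (base_flag (?N - p)) :: 'm cvec set)"
        using lower[OF base_flag_isotropic, of p "?N - p"] p by simp
      also have "\<dots> \<le> vec.dim (F p \<inter> perp (F (?N - p)))"
        using F base_flag_isotropic isotropic_subset_transversal unfolding base_cycle_def by blast
      finally have "vec.dim (F p) \<le> vec.dim (F p \<inter> perp (F (?N - p)))"
        using complete_flagsD(3)[OF Fc] p by simp
      then have "F p \<inter> perp (F (?N - p)) = F p"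
        by (intro subspace_eq_of_dim vec.subspace_inter sub subspace_perp) auto
      then show ?thesis
        by blast
    qed
    with Fc show "F \<in> isotropic_flags"
      by (simp add: isotropic_flags_def)
  next
    fix F :: "'m flag"
    assume F: "F \<in> isotropic_flags"
    then have T: "F \<in> transversal_flags"
      using isotropic_subset_transversal by blast
    have "vec.dim (F' i \<inter> perp (F' j)) \<le> vec.dim (F i \<inter> perp (F j))" if "F' \<in> transversal_flags" for F' :: "'m flag" and i j
      using upper[of F' i j] lower[OF F, of i j] that by (auto simp: transversal_flags_def)
    with T show "F \<in> base_cycle transversal_flags"
      by (simp add: base_cycle_def)
  qed
qed

subsection \<open>Transversal flags are dense\<close>

lemma det_affine_poly:
  fixes A B :: "complex^'n^'n"
  obtains P where "\<And>t. poly P t = det (\<chi> i j. A $ i $ j + t * B $ i $ j)"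
proof
  show "poly (\<Sum>p | p permutes UNIV. of_int (sign p) * (\<Prod>i\<in>UNIV. [:A $ i $ p i, B $ i $ p i:])) t =
      det (\<chi> i j. A $ i $ j + t * B $ i $ j)" for t
    by (simp add: det_def poly_sum poly_prod)
qed

lemma scaleR_matrix_mult: "(r *\<^sub>R A) *v x = r *\<^sub>R (A *v x)" for A :: "complex^'n^'k"
  by (simp add: matrix_vector_mult_def vec_eq_iff scaleR_sum_right)

lemma jmap_scaleR: "jmap (r *\<^sub>R v) = r *\<^sub>R jmap v"
  by (rule cvec_eqI) simp_all

text \<open>Transversality in position \<open>p\<close> is the non-vanishing of one determinant.\<close>

definition transversal_matrix :: "nat \<Rightarrow> 'm::{finite,linorder} cmat \<Rightarrow> 'm cmat" where
  "transversal_matrix p X = frame_matrix (\<lambda>j. if j \<le> p then X *v u_vec j else jmap (X *v u_vec (j - p)))"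

text \<open>j commutes with real scalars only, so the dependence on X is real linear and the segment
  needs a real parameter.\<close>

lemma transversal_matrix_affine:
  "transversal_matrix p ((1 - t) *\<^sub>R X + t *\<^sub>R Y) = (1 - t) *\<^sub>R transversal_matrix p X + t *\<^sub>R transversal_matrix p Y"
proof (rule matrix_eq_on_u_vec)
  fix j
  assume j: "j \<in> {1..2 * CARD('a)}"
  show "transversal_matrix p ((1 - t) *\<^sub>R X + t *\<^sub>R Y) *v u_vec j =
      ((1 - t) *\<^sub>R transversal_matrix p X + t *\<^sub>R transversal_matrix p Y) *v (u_vec j :: 'a cvec)"
    unfolding transversal_matrix_def matrix_vector_mult_add_rdistrib scaleR_matrix_mult frame_matrix_u_vec[OF j]
    by (simp add: jmap_add jmap_scaleR)
qed

text \<open>A common vector of F_p and j(F_{n-p}) amounts to a linear relation between the vectors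
  of the frame behind \<open>transversal_matrix p X\<close>.\<close>

lemma transversal_if_det:
  fixes X :: "'m::{finite,linorder} cmat"
  assumes X: "det X \<noteq> 0" and det: "\<And>p. p \<le> 2 * CARD('m) \<Longrightarrow> det (transversal_matrix p X) \<noteq> 0"
  shows "orbit_map X \<in> transversal_flags"
proof -
  let ?N = "2 * CARD('m)"
  have "z = 0" if p: "p \<le> ?N" and z: "z \<in> orbit_map X p" "z \<in> jmap ` orbit_map X (?N - p)" for p z
  proof -
    obtain y where y: "y \<in> orbit_map X (?N - p)" "z = jmap y"
      using z(2) by blast
    obtain c where c: "\<And>i. p < i \<Longrightarrow> c i = 0" "z = (\<Sum>i = 1..?N. c i *s (X *v u_vec i))"
      using z(1) unfolding act_iwasawa by (elim flag_of_basis_memE) blast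
    obtain d where d: "\<And>i. ?N - p < i \<Longrightarrow> d i = 0" "y = (\<Sum>i = 1..?N. d i *s (X *v u_vec i))"
      using y(1) unfolding act_iwasawa by (elim flag_of_basis_memE) blast
    \<comment> \<open>Coefficients of that relation: conjugated because j is conjugate linear, and
      negated because the two expansions of \<open>z\<close> are subtracted.\<close>
    let ?k = "\<lambda>j. if j \<le> p then c j else - cnj (d (j - p))"
    let ?v = "\<Sum>j = 1..?N. ?k j *s (u_vec j :: 'm cvec)"
    have split: "{1..?N} = {1..p} \<union> {p + 1..?N}" "{1..p} \<inter> {p + 1..?N} = {}"
      using p by auto
    have sum_split: "sum f {1..?N} = sum f {1..p} + sum f {p + 1..?N}" for f :: "nat \<Rightarrow> 'm cvec"
      using split by (metis finite_atLeastAtMost sum.union_disjoint)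
    have z1: "z = (\<Sum>j = 1..p. c j *s (X *v u_vec j))"
      unfolding c(2) sum_split using c(1) by simp
    have "y = (\<Sum>j = 1..?N - p. d j *s (X *v u_vec j))"
      unfolding d(2) by (rule sum.mono_neutral_right) (use d(1) in auto)
    then have z2: "z = (\<Sum>j = 1..?N - p. cnj (d j) *s jmap (X *v u_vec j))"
      unfolding y(2) by (simp add: jmap_sum jmap_scale)
    have "(\<Sum>j = p + 1..?N. cnj (d (j - p)) *s jmap (X *v u_vec (j - p))) =
        (\<Sum>j = 1..?N - p. cnj (d j) *s jmap (X *v u_vec j))"
      using p by (intro sum.reindex_bij_witness[of _ "\<lambda>j. j + p" "\<lambda>j. j - p"]) auto
    then have z3: "(\<Sum>j = p + 1..?N. ?k j *s jmap (X *v u_vec (j - p))) = - z"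
      unfolding z2 by (simp add: sum_negf)
    have "transversal_matrix p X *v ?v = (\<Sum>j = 1..?N. ?k j *s (if j \<le> p then X *v u_vec j else jmap (X *v u_vec (j - p))))"
      unfolding matrix_vector_mult_sum transversal_matrix_def by (rule sum.cong) (auto simp: vector_scalar_commute)
    also have "\<dots> = z + - z"
      unfolding sum_split z3[symmetric] by (subst z1) (intro arg_cong2[where f = "(+)"] sum.cong; simp)
    finally have "transversal_matrix p X *v ?v = 0"
      by simp
    then have v0: "?v = 0"
      using det[OF p] det_nz_iff_ker by blast
    have "c j = 0" if j: "j \<in> {1..p}" for j
    proof -
      have jN: "j \<in> {1..?N}"
        using j p by auto
      have "0 = u_coord j ?v"
        unfolding v0 by simp
      also have "\<dots> = (\<Sum>i = 1..?N. if i = j then ?k j else 0)"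
        unfolding u_coord_sum by (rule sum.cong) (use jN in \<open>auto simp: u_coord_u_vec\<close>)
      also have "\<dots> = c j"
        using jN j by simp
      finally show ?thesis
        by simp
    qed
    then show ?thesis
      unfolding z1 by simp
  qed
  moreover have "orbit_map X \<in> complete_flags"
    by (intro act_complete X iwasawa_complete)
  ultimately show ?thesis
    unfolding transversal_flags_def by blast
qed

text \<open>j permutes the vectors of the base frame up to sign, so the combined frame is a signed
  rearrangement of the Iwasawa basis.\<close>

lemma det_transversal_base:
  assumes p: "p \<le> 2 * CARD('m)"
  shows "det (transversal_matrix p (frame_matrix (u_vec \<circ> base_perm CARD('m))) :: 'm::{finite,linorder} cmat) \<noteq> 0"
proof -
  let ?N = "2 * CARD('m)" and ?w = "base_perm CARD('m)"
  \<comment> \<open>The places 1, ..., p followed by n, n - 1, ..., p + 1, since j sends the vector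
    at place i to plus or minus the one at place n + 1 - i.\<close>
  let ?s = "\<lambda>j. if j \<le> p then j else ?N + 1 + p - j"
  let ?d = "\<lambda>j. if j \<le> p then 1 else if odd (?w (j - p)) then 1 else - 1 :: complex"
  note w = base_perm_permutes[of "CARD('m)"]
  have "transversal_matrix p (frame_matrix (u_vec \<circ> ?w)) = (frame_matrix (\<lambda>j. ?d j *s u_vec (?w (?s j))) :: 'm cmat)"
  proof (rule matrix_eq_on_u_vec)
    fix j
    assume j: "j \<in> {1..?N}"
    show "transversal_matrix p (frame_matrix (u_vec \<circ> ?w)) *v u_vec j =
        frame_matrix (\<lambda>j. ?d j *s u_vec (?w (?s j))) *v (u_vec j :: 'm cvec)"
    proof (cases "j \<le> p")
      case True
      then show ?thesis
        using j by (simp add: transversal_matrix_def)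
    next
      case False
      then have jp: "j - p \<in> {1..?N}" "?N + 1 - (j - p) = ?N + 1 + p - j"
        using j by auto
      then have "?w (j - p) \<in> {1..?N}"
        using permutes_in_image[OF w] by blast
      from jmap_u_vec[where 'm = 'm, OF this] show ?thesis
        using False j jp partner_strictly_pairing[OF strictly_pairing_base_perm jp(1)]
        by (simp add: transversal_matrix_def)
    qed
  qed
  moreover have "v = 0" if v: "frame_matrix (\<lambda>j. ?d j *s u_vec (?w (?s j))) *v v = 0" for v :: "'m cvec"
  proof (rule u_coord_eqI)
    fix i
    assume i: "i \<in> {1..?N}"
    have s: "?s j \<in> {1..?N}" if "j \<in> {1..?N}" for j
      using that p by auto
    have "0 = u_coord (?w (?s i)) (\<Sum>j = 1..?N. u_coord j v *s (?d j *s u_vec (?w (?s j)) :: 'm cvec))"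
      using v by (simp add: frame_matrix_mult)
    also have "\<dots> = (\<Sum>j = 1..?N. if j = i then u_coord i v * ?d i else 0)"
      unfolding u_coord_sum
    proof (rule sum.cong[OF refl])
      fix j
      assume j: "j \<in> {1..?N}"
      have "?s i = ?s j \<longleftrightarrow> j = i"
        using i j by auto
      then show "u_coord (?w (?s i)) (u_coord j v *s (?d j *s u_vec (?w (?s j)) :: 'm cvec)) =
          (if j = i then u_coord i v * ?d i else 0)"
        unfolding u_coord_scale u_coord_perm[OF w s[OF i] s[OF j]] by (cases "j = i") simp_all
    qed
    also have "\<dots> = u_coord i v * ?d i"
      using i by simp
    finally show "u_coord i v = u_coord i 0"
      by (auto split: if_splits)
  qed
  ultimately show ?thesis
    using det_nz_iff_ker by metis
qed

text \<open>Along the segment from a matrix \<open>A\<close> of a flag in \<open>U\<close> to the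
  base matrix \<open>B\<close>, each relevant determinant is a polynomial in t that is nonzero at t
  = 1. Only finitely many t are bad, while all small t > 0 stay in \<open>U\<close>.\<close>

lemma open_meets_transversal:
  fixes U :: "'m::{finite,linorder} flag set"
  assumes U: "openin flag_topology U" "U \<noteq> {}"
  shows "U \<inter> transversal_flags \<noteq> {}"
proof -
  let ?N = "2 * CARD('m)"
  let ?P = "{X \<in> GL. orbit_map X \<in> U}"
  have P: "open ?P" and Uc: "U \<subseteq> complete_flags"
    using U(1) by (auto simp: openin_flag_topology_GL)
  obtain F where F: "F \<in> U"
    using U(2) by blast
  then have "F \<in> orbit_map ` GL"
    using Uc unfolding orbit_map_surj by blast
  then obtain A where A: "A \<in> ?P"
    using F by auto
  define B where "B = (frame_matrix (u_vec \<circ> base_perm CARD('m)) :: 'm cmat)"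
  have B: "det B \<noteq> 0" "\<And>p. p \<le> ?N \<Longrightarrow> det (transversal_matrix p B) \<noteq> 0"
    unfolding B_def by (rule det_perm_frame[OF base_perm_permutes], rule det_transversal_base)
  let ?X = "\<lambda>t. (1 - t) *\<^sub>R A + t *\<^sub>R B"
  have fin: "finite {t :: real. det ((1 - t) *\<^sub>R C + t *\<^sub>R D) = 0}" if D: "det D \<noteq> 0" for C D :: "'m cmat"
  proof -
    obtain Q where Q: "\<And>t. poly Q t = det (\<chi> i j. C $ i $ j + t * (D - C) $ i $ j)"
      using det_affine_poly[of C "D - C"] by blast
    have QX: "poly Q (of_real t) = det ((1 - t) *\<^sub>R C + t *\<^sub>R D)" for t
      unfolding Q by (rule arg_cong[where f = det]) (simp add: vec_eq_iff scaleR_conv_of_real[where 'a = complex] algebra_simps)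
    have "poly Q (of_real 1) \<noteq> 0"
      unfolding QX using D by simp
    then have "Q \<noteq> 0"
      by auto
    then have "finite {z. poly Q z = 0}"
      by (rule poly_roots_finite)
    then have "finite (of_real -` {z. poly Q z = 0} :: real set)"
      by (rule finite_vimageI) (simp add: inj_of_real)
    then show ?thesis
      by (simp add: QX vimage_def)
  qed
  let ?bad = "{t. det (?X t) = 0} \<union> (\<Union>p\<le>?N. {t. det (transversal_matrix p (?X t)) = 0})"
  have "finite ?bad"
    using fin[OF B(1)] fin[OF B(2)] by (simp add: transversal_matrix_affine)
  moreover have "open (?X -` ?P)"
    by (intro open_vimage P continuous_intros)
  then obtain e where e: "e > 0" "ball 0 e \<subseteq> ?X -` ?P"
    using A open_contains_ball_eq[of "?X -` ?P" 0] by auto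
  have "infinite ({0<..<e} :: real set)"
    using e(1) by (rule infinite_Ioo)
  ultimately obtain t where t: "t \<in> {0<..<e}" "t \<notin> ?bad"
    by (meson finite_subset subsetI)
  then have "?X t \<in> ?P"
    using e(2) by (auto simp: subset_iff)
  moreover have "orbit_map (?X t) \<in> transversal_flags"
    using t(2) by (intro transversal_if_det) auto
  ultimately show ?thesis
    by blast
qed

text \<open>By density \<open>D\<close> contains a transversal flag, and the transversal flags form
  one orbit.\<close>

lemma open_quat_orbit_eq:
  fixes D :: "'m::{finite,linorder} flag set"
  assumes "open_quat_orbit D"
  shows "D = transversal_flags"
proof -
  obtain F where F: "F \<in> complete_flags" "D = orbit SL_quat F" and op: "openin flag_topology D"
    using assms by (auto simp: open_quat_orbit_def)
  have "mat 1 \<in> (SL_quat :: 'm cmat set)"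
    by (simp add: SL_quat_def SL_def)
  then have "F \<in> D"
    unfolding F(2) orbit_def by (metis act_mat_1 image_eqI)
  then obtain G where G: "G \<in> D" "G \<in> transversal_flags"
    using open_meets_transversal[OF op] by blast
  then obtain X where X: "X \<in> SL_quat" "G = act X F"
    unfolding F(2) orbit_def by blast
  then have q: "quaternionic X" "det X \<noteq> 0"
    using SL_quat_quaternionic by auto
  obtain Y where Y: "X ** Y = mat 1" "Y ** X = mat 1" "det Y \<noteq> 0"
    using matrix_inverse_exists[OF q(2)] .
  have "F = act Y G"
    unfolding X(2) act_mult[symmetric] Y(2) by simp
  then have "F \<in> transversal_flags"
    using quaternionic_act_transversal[OF quaternionic_inverse[OF q(1) Y(1,2)] Y(3) G(2)] by simp
  then show ?thesis
    unfolding F(2) by (rule transversal_orbit)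
qed

subsection \<open>Dimension of the flag manifold\<close>

lemma locally_complex_if_homeomorphic:
  assumes "X homeomorphic_space complex_space d"
  shows "locally_complex d X"
  unfolding locally_complex_def
proof
  fix x
  assume "x \<in> topspace X"
  then show "\<exists>U V. openin X U \<and> x \<in> U \<and> openin (complex_space d) V \<and>
      subtopology X U homeomorphic_space subtopology (complex_space d) V"
    using assms by (intro exI[of _ "topspace X"] exI[of _ "topspace (complex_space d)"]) auto
qed

text \<open>Homeomorphisms that preserve \<open>A\<close> carry the chart at \<open>F0\<close> to
  every point, so \<open>A\<close> itself serves as the dense open piece.\<close>

lemma has_complex_dim_homogeneous:
  fixes A C :: "'m::{finite,linorder} flag set"
  assumes A: "A \<subseteq> complete_flags"
    and C: "openin (subtopology flag_topology A) C" "F0 \<in> C"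
    and hom: "subtopology flag_topology C homeomorphic_space complex_space d"
    and trans: "\<And>F. F \<in> A \<Longrightarrow> \<exists>X Y. X ** Y = mat 1 \<and> Y ** X = mat 1 \<and>
      act X ` A \<subseteq> A \<and> act Y ` A \<subseteq> A \<and> F = act X F0"
  shows "has_complex_dim flag_topology A d"
  unfolding has_complex_dim_def
proof (intro exI[of _ A] conjI)
  show "openin (subtopology flag_topology A) A"
    using openin_topspace[of "subtopology flag_topology A"] A by (simp add: Int_absorb1)
  show "A \<subseteq> flag_topology closure_of A"
    using A by (simp add: closure_of_subset)
  show "locally_complex d (subtopology flag_topology A)"
    unfolding locally_complex_def
  proof
    fix F
    assume "F \<in> topspace (subtopology flag_topology A)"
    then have "F \<in> A"
      by simp
    then obtain X Y where XY: "X ** Y = mat 1" "Y ** X = mat 1"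
      and inv: "act X ` A \<subseteq> A" "act Y ` A \<subseteq> A" and F: "F = act X F0"
      using trans by blast
    have CA: "C \<subseteq> A"
      using C(1) openin_imp_subset by blast
    have hom_X: "homeomorphic_map flag_topology flag_topology (act X)"
      using homeomorphic_maps_act[OF XY] homeomorphic_maps_map by blast
    have "act X ` A = A"
    proof
      show "A \<subseteq> act X ` A"
      proof
        fix G
        assume "G \<in> A"
        then have "act Y G \<in> A" "G = act X (act Y G)"
          using inv XY(1) by (auto simp flip: act_mult)
        then show "G \<in> act X ` A"
          by blast
      qed
    qed (rule inv)
    then have "homeomorphic_map (subtopology flag_topology A) (subtopology flag_topology A) (act X)"
      using A by (intro homeomorphic_map_subtopologies[OF hom_X]) (simp add: Int_absorb1)
    then have op: "openin (subtopology flag_topology A) (act X ` C)"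
      using C(1) homeomorphic_map_openness_eq by blast
    have "act X ` C \<subseteq> complete_flags"
      using CA inv(1) A by blast
    then have "homeomorphic_map (subtopology flag_topology C) (subtopology flag_topology (act X ` C)) (act X)"
      using CA A by (intro homeomorphic_map_subtopologies[OF hom_X]) (simp add: Int_absorb1)
    then have "subtopology flag_topology (act X ` C) homeomorphic_space complex_space d"
      using hom homeomorphic_map_imp_homeomorphic_space homeomorphic_space_sym homeomorphic_space_trans by blast
    moreover have "A \<inter> act X ` C = act X ` C"
      using openin_imp_subset[OF op] by blast
    ultimately have "subtopology (subtopology flag_topology A) (act X ` C) homeomorphic_space
        subtopology (complex_space d) (topspace (complex_space d))"
      by (simp add: subtopology_subtopology)
    then show "\<exists>U V. openin (subtopology flag_topology A) U \<and> F \<in> U \<and> openin (complex_space d) V \<and>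
        subtopology (subtopology flag_topology A) U homeomorphic_space subtopology (complex_space d) V"
      using op C(2) F by (intro exI[of _ "act X ` C"] exI[of _ "topspace (complex_space d)"]) auto
  qed
qed

lemma finite_chart_index [simp]: "finite (chart_index n)"
  by (rule finite_subset[of _ "{1..n} \<times> {1..n}"]) (auto simp: chart_index_def)

lemma card_chart_index: "card (chart_index n) = n * (n - 1) div 2"
proof -
  have "bij_betw prod.swap {(p, q). 1 \<le> p \<and> p < q \<and> q \<le> n} (chart_index n)"
    by (rule bij_betw_byWitness[where f' = prod.swap]) (auto simp: chart_index_def)
  then show ?thesis
    using bij_betw_same_card card_increasing_pairs[of n] by fastforce
qed

lemma chart_zero: "chart w (\<lambda>_. 0) = (flag_of_basis (u_vec \<circ> w) :: 'm::{finite,linorder} flag)"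
proof -
  have "chart_frame w (\<lambda>_. 0) = (u_vec \<circ> w :: nat \<Rightarrow> 'm cvec)"
    by (simp add: fun_eq_iff chart_frame_def)
  then show ?thesis
    by (simp add: chart_def)
qed

lemma complex_dim_flags:
  "complex_dim flag_topology (complete_flags :: 'm::{finite,linorder} flag set) = CARD('m) * (2 * CARD('m) - 1)"
proof (rule complex_dim_eqI)
  let ?I = "chart_index (2 * CARD('m))"
  have id: "id permutes {1..2 * CARD('m)}"
    by (rule permutes_id)
  \<comment> \<open>The inner \<open>id\<close> presents the chart as a graph in which every
    coordinate is free.\<close>
  let ?C = "(\<lambda>a. chart id (id a) :: 'm flag) ` {a. \<forall>s. s \<notin> ?I \<longrightarrow> a s = 0}"
  have C: "?C = range (chart id)"
  proof (intro subset_antisym subsetI)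
    fix F :: "'m flag"
    assume "F \<in> range (chart id)"
    then obtain L where "F = chart id L"
      by blast
    also have "\<dots> = chart id (id (\<lambda>s. if s \<in> ?I then L s else 0))"
      by (rule chart_cong[OF id]) simp
    finally show "F \<in> ?C"
      by (intro image_eqI[of _ _ "\<lambda>s. if s \<in> ?I then L s else 0"]) simp_all
  qed auto
  have "subtopology flag_topology ?C homeomorphic_space complex_space (card ?I)"
    by (rule homeomorphic_chart_graph[OF id]) (auto intro: continuous_on_product_coordinates)
  then have hom: "subtopology flag_topology (range (chart id) :: 'm flag set) homeomorphic_space
      complex_space (CARD('m) * (2 * CARD('m) - 1))"
    unfolding C card_chart_index by simp
  show "has_complex_dim flag_topology (complete_flags :: 'm flag set) (CARD('m) * (2 * CARD('m) - 1))"
  proof (rule has_complex_dim_homogeneous[OF order.refl _ _ hom])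
    show "openin (subtopology flag_topology complete_flags) (range (chart id) :: 'm flag set)"
      using openin_chart[OF id] by (metis subtopology_topspace topspace_flag_topology)
    show "iwasawa_flag \<in> (range (chart id) :: 'm flag set)"
      using chart_zero[of id] by (metis comp_id iwasawa_flag_def rangeI)
    fix F :: "'m flag"
    assume "F \<in> complete_flags"
    then obtain X where X: "det X \<noteq> 0" "F = act X iwasawa_flag"
      by (rule complete_flag_act_iwasawa)
    obtain Y where Y: "X ** Y = mat 1" "Y ** X = mat 1" "det Y \<noteq> 0"
      using matrix_inverse_exists[OF X(1)] .
    show "\<exists>X Y. X ** Y = mat 1 \<and> Y ** X = mat 1 \<and> act X ` complete_flags \<subseteq> complete_flags \<and>
        act Y ` complete_flags \<subseteq> complete_flags \<and> F = act X iwasawa_flag"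
      using X Y act_complete by blast
  qed
qed (use iwasawa_complete in auto)

subsection \<open>Schubert cells\<close>

definition schubert_cell :: "(nat \<Rightarrow> nat) \<Rightarrow> 'm::{finite,linorder} flag set" where
  "schubert_cell w = orbit iwasawa_borel (flag_of_basis (u_vec \<circ> w))"

text \<open>Places where the Borel group can put an entry: it adds to u_{w(j)} only vectors of
  smaller index. These are the inversions of w with the two places exchanged.\<close>

definition cell_index :: "nat \<Rightarrow> (nat \<Rightarrow> nat) \<Rightarrow> (nat \<times> nat) set" where
  "cell_index n w = {(k, j) \<in> chart_index n. w k < w j}"

lemma card_cell_index: "card (cell_index n w) = inversions n w"
proof -
  have "bij_betw prod.swap (inversion_set n w) (cell_index n w)"
    by (rule bij_betw_byWitness[where f' = prod.swap])
      (auto simp: cell_index_def chart_index_def inversion_set_def)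
  then show ?thesis
    unfolding inversions_eq_card using bij_betw_same_card by metis
qed

lemma borel_column:
  fixes X :: "'m::{finite,linorder} cmat"
  assumes X: "X \<in> iwasawa_borel" and i: "i \<in> {1..2 * CARD('m)}"
  shows "X *v u_vec i \<in> iwasawa_flag i" "u_coord i (X *v u_vec i) \<noteq> 0"
proof -
  have det: "det X \<noteq> 0" and stab: "act X iwasawa_flag = (iwasawa_flag :: 'm flag)"
    using X by (auto simp: iwasawa_borel_def SL_def)
  have "u_vec i \<in> (iwasawa_flag i :: 'm cvec set)"
    using i by (auto simp: iwasawa_flag_iff u_coord_u_vec)
  then show mem: "X *v u_vec i \<in> iwasawa_flag i"
    using stab by (metis act_def image_eqI)
  show "u_coord i (X *v u_vec i) \<noteq> 0"
  proof
    assume "u_coord i (X *v u_vec i) = 0"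
    then have "u_coord j (X *v u_vec i) = 0" if "j \<in> {1..2 * CARD('m)}" "i - 1 < j" for j
      using mem that by (cases "j = i") (auto simp: iwasawa_flag_iff)
    then have "X *v u_vec i \<in> act X iwasawa_flag (i - 1)"
      unfolding stab iwasawa_flag_iff by blast
    then obtain y where "y \<in> iwasawa_flag (i - 1)" "X *v u_vec i = X *v y"
      by (auto simp: act_def)
    then show False
      using matrix_vector_inj[OF det] u_vec_notin_iwasawa[OF i] by metis
  qed
qed

lemma iwasawa_flag_coord: "v \<in> iwasawa_flag k \<Longrightarrow> k < j \<Longrightarrow> j \<in> {1..2 * CARD('m)} \<Longrightarrow> u_coord j v = 0"
  for v :: "'m::{finite,linorder} cvec"
  by (auto simp: iwasawa_flag_iff)

context
  fixes w :: "nat \<Rightarrow> nat"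
  assumes w: "w permutes {1..2 * CARD('m::{finite,linorder})}"
begin

private lemma mem: "w i \<in> {1..2 * CARD('m)} \<longleftrightarrow> i \<in> {1..2 * CARD('m)}"
  by (rule perm_mem[OF w])

text \<open>A step using pivot index w(k) changes vector p only if w(k) < w(p), as otherwise its
  coefficient is zero. It then subtracts a vector from a smaller step of the Iwasawa flag, which
  leaves the leading coordinate alone.\<close>

lemma elim_triangular:
  fixes b :: "nat \<Rightarrow> 'm cvec"
  assumes b: "\<And>p. p \<in> {1..2 * CARD('m)} \<Longrightarrow> b p \<in> iwasawa_flag (w p)"
  shows "k \<le> 2 * CARD('m) \<Longrightarrow> p \<in> {1..2 * CARD('m)} \<Longrightarrow>
    elim w b k p \<in> iwasawa_flag (w p) \<and> u_coord (w p) (elim w b k p) = u_coord (w p) (b p)"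
proof (induction k arbitrary: p)
  case 0
  then show ?case
    using b by simp
next
  case (Suc k)
  note sub = complete_flagsD(2)[OF iwasawa_complete]
  have k: "Suc k \<in> {1..2 * CARD('m)}"
    using Suc.prems by auto
  note p = Suc.IH[OF _ Suc.prems(2)] and q = Suc.IH[OF _ k]
  have p': "elim w b k p \<in> iwasawa_flag (w p)" "u_coord (w p) (elim w b k p) = u_coord (w p) (b p)"
    and q': "elim w b k (Suc k) \<in> iwasawa_flag (w (Suc k))"
    using p q Suc.prems by auto
  show ?case
  proof (cases "p \<le> Suc k")
    case True
    then show ?thesis
      using p' by simp
  next
    case False
    then have "w (Suc k) \<noteq> w p"
      by (simp add: perm_eq[OF w])
    then consider "w p < w (Suc k)" | "w (Suc k) < w p"
      by linarith
    then show ?thesis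
    proof cases
      case 1
      then have "u_coord (w (Suc k)) (elim w b k p) = 0"
        using iwasawa_flag_coord[OF p'(1)] mem[of "Suc k"] k by blast
      then show ?thesis
        using p' by simp
    next
      case 2
      then have "elim w b k (Suc k) \<in> iwasawa_flag (w p)"
        using complete_flag_memI[OF iwasawa_complete _ q', of "w p"] by simp
      moreover have "u_coord (w p) (elim w b k (Suc k)) = 0"
        using iwasawa_flag_coord[OF q' 2] mem[of p] Suc.prems(2) by blast
      ultimately show ?thesis
        using p' False by (auto intro: vec.subspace_diff[OF sub] vec.subspace_scale[OF sub])
    qed
  qed
qed

text \<open>Elimination of a Borel translate keeps the triangular shape, so the coordinates off
  \<open>cell_index\<close> vanish. Conversely a frame of this shape, reordered by the inverse of w,
  is the image of the Iwasawa basis under a Borel element.\<close>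

lemma schubert_cell_eq:
  "schubert_cell w = (\<lambda>a. chart w (id a) :: 'm flag) ` {a. \<forall>s. s \<notin> cell_index (2 * CARD('m)) w \<longrightarrow> a s = 0}"
proof (intro subset_antisym subsetI)
  let ?N = "2 * CARD('m)"
  fix F :: "'m flag"
  assume "F \<in> schubert_cell w"
  then obtain X where X: "X \<in> iwasawa_borel" "F = flag_of_basis (\<lambda>p. X *v (u_vec \<circ> w) p)"
    by (auto simp: schubert_cell_def orbit_def act_flag_of_basis)
  let ?b = "\<lambda>p. X *v (u_vec \<circ> w) p"
  have "det X \<noteq> 0"
    using X(1) by (auto simp: iwasawa_borel_def SL_def)
  moreover have "frame_matrix ?b = X ** frame_matrix (u_vec \<circ> w)"
    by (rule matrix_mult_frame_matrix[symmetric])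
  ultimately have det: "det (frame_matrix ?b) \<noteq> 0"
    using det_perm_frame[OF w] by (simp add: det_mul)
  have b: "?b p \<in> iwasawa_flag (w p)" "u_coord (w p) (?b p) \<noteq> 0" if "p \<in> {1..?N}" for p
    using borel_column[OF X(1), of "w p"] that mem[of p] by auto
  have reg: "regular w ?b ?N"
    unfolding regular_def pivot_def
  proof (intro allI impI)
    fix k
    assume "k < ?N"
    then show "u_coord (w (Suc k)) (elim w ?b k (Suc k)) \<noteq> 0"
      using elim_triangular[of ?b k "Suc k"] b by simp
  qed
  define L where "L = (\<lambda>(k, p). u_coord (w k) (elim w ?b ?N p) / pivot w ?b (p - 1))"
  let ?a = "\<lambda>s. if s \<in> cell_index ?N w then L s else 0"
  have "F = chart w L"
    unfolding X(2) L_def by (rule regular_chart[OF w det reg])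
  also have "\<dots> = chart w ?a"
  proof (rule chart_cong[OF w])
    fix s
    assume s: "s \<in> chart_index ?N"
    then obtain k p where kp: "s = (k, p)" "p \<in> {1..?N}" "k \<in> {1..?N}" "p < k"
      by (auto simp: chart_index_def)
    have "L s = 0" if "s \<notin> cell_index ?N w"
    proof -
      have "w p < w k"
        using that s kp perm_eq[OF w, of p k] by (auto simp: cell_index_def)
      then have "u_coord (w k) (elim w ?b ?N p) = 0"
        using iwasawa_flag_coord[of "elim w ?b ?N p" "w p" "w k"] elim_triangular[of ?b ?N p] b kp mem[of k] by simp
      then show ?thesis
        by (simp add: L_def kp)
    qed
    then show "L s = ?a s"
      by simp
  qed
  finally show "F \<in> (\<lambda>a. chart w (id a)) ` {a. \<forall>s. s \<notin> cell_index ?N w \<longrightarrow> a s = 0}"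
    by (intro image_eqI[of _ _ ?a]) simp_all
next
  let ?N = "2 * CARD('m)"
  fix F :: "'m flag"
  assume "F \<in> (\<lambda>a. chart w (id a)) ` {a. \<forall>s. s \<notin> cell_index ?N w \<longrightarrow> a s = 0}"
  then obtain a where a: "\<And>s. s \<notin> cell_index ?N w \<Longrightarrow> a s = 0" "F = chart w a"
    by auto
  let ?f = "chart_frame w a :: nat \<Rightarrow> 'm cvec" and ?v = "inv_into UNIV w"
  have v: "?v i \<in> {1..?N} \<longleftrightarrow> i \<in> {1..?N}" "w (?v i) = i" "?v (w i) = i" for i
    using permutes_in_image[OF permutes_inv[OF w]] permutes_inverses[OF w] by auto
  have coord: "u_coord j (?f (?v i)) = (if j = i then 1 else 0)"
    if i: "i \<in> {1..?N}" and j: "j \<in> {1..?N}" and ij: "i \<le> j" for i j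
  proof -
    have "u_coord (w (?v j)) (?f (?v i)) =
        (if ?v j = ?v i then 1 else if ?v i < ?v j then a (?v j, ?v i) else 0)"
      using i j by (intro u_coord_chart_frame[OF w]) (simp_all only: v)
    moreover have "?v j = ?v i \<longleftrightarrow> j = i"
      using v(2) by metis
    moreover have "a (?v j, ?v i) = 0"
      using ij by (intro a(1)) (simp add: cell_index_def v)
    ultimately show ?thesis
      by (simp add: v)
  qed
  \<comment> \<open>After reordering, the frame is upper unipotent in the Iwasawa basis, because its
    nonzero entries (k, j) off the diagonal satisfy w(k) < w(j).\<close>
  have "adapted iwasawa_flag (?f \<circ> ?v)"
    unfolding adapted_def iwasawa_flag_iff by (auto simp: coord)
  note ad = adapted_frame[OF iwasawa_complete this]
  \<comment> \<open>\<open>?Y\<close> has determinant 1; the rescaling moves neither V_w nor the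
    Iwasawa flag.\<close>
  let ?X = "frame_matrix (?f \<circ> ?v)" and ?Y = "frame_matrix (?f \<circ> ?v) ** scale_first (inverse (det (frame_matrix (?f \<circ> ?v))))"
  have "act ?X iwasawa_flag = iwasawa_flag"
    using ad(2) by (simp add: flag_of_basis_eq_act)
  then have "?Y \<in> iwasawa_borel"
    using ad(1) by (simp add: iwasawa_borel_def SL_def det_mul det_scale_first act_mult act_scale_first_iwasawa)
  moreover have "F = act ?Y (flag_of_basis (u_vec \<circ> w))"
  proof -
    have "act ?Y (flag_of_basis (u_vec \<circ> w)) = act ?X (flag_of_basis (u_vec \<circ> w))"
      using ad(1) by (simp add: act_mult act_scale_first[OF _ w])
    also have "\<dots> = flag_of_basis ((?f \<circ> ?v) \<circ> w)"
      by (rule flag_of_basis_perm(1)[OF w])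
    also have "(?f \<circ> ?v) \<circ> w = ?f"
      by (simp add: fun_eq_iff v)
    finally have "act ?Y (flag_of_basis (u_vec \<circ> w)) = flag_of_basis ?f" .
    then show ?thesis
      unfolding a(2) chart_def by (rule sym)
  qed
  ultimately show "F \<in> schubert_cell w"
    unfolding schubert_cell_def orbit_def by blast
qed

lemma schubert_cell_base: "flag_of_basis (u_vec \<circ> w) \<in> (schubert_cell w :: 'm flag set)"
  unfolding schubert_cell_eq
  by (rule image_eqI[of _ _ "\<lambda>_. 0"]) (simp_all add: chart_zero)

lemma schubert_cell_subset: "schubert_cell w \<subseteq> (complete_flags :: 'm flag set)"
  unfolding schubert_cell_eq using chart_complete[OF w] by auto

lemma schubert_cell_subset_schubert: "schubert_cell w \<subseteq> (schubert w :: 'm flag set)"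
  unfolding schubert_def schubert_cell_def[symmetric]
  using schubert_cell_subset by (intro closure_of_subset) simp

text \<open>The cell is closed in the open chart around \<open>V\<^sub>w\<close>, hence open in its closure.\<close>

lemma schubert_Int_chart: "schubert w \<inter> range (chart w) = (schubert_cell w :: 'm flag set)"
proof (intro subset_antisym subsetI)
  fix F :: "'m flag"
  assume F: "F \<in> schubert w \<inter> range (chart w)"
  let ?I = "cell_index (2 * CARD('m)) w"
  obtain L where L: "F = chart w L"
    using F by blast
  have "L s = 0" if s: "s \<in> chart_index (2 * CARD('m))" "s \<notin> ?I" for s
  proof (rule ccontr)
    assume nz: "L s \<noteq> 0"
    \<comment> \<open>A nonzero coordinate off \<open>cell_index\<close> is an open condition that
      fails on the whole cell.\<close>
    let ?U = "{G \<in> topspace (subtopology flag_topology (range (chart w) :: 'm flag set)). chart_coords w G s \<in> - {0}}"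
    have "openin (subtopology flag_topology (range (chart w))) ?U"
      by (rule openin_continuous_map_preimage[OF continuous_chart_coords[OF w s(1)]]) auto
    then have "openin flag_topology ?U"
      using openin_chart[OF w] openin_trans_full by blast
    moreover have "F \<in> ?U"
      using F L nz chart_coords_chart[OF w s(1), of L] chart_complete[OF w] by simp
    moreover have "F \<in> flag_topology closure_of schubert_cell w"
      using F by (simp add: schubert_def schubert_cell_def)
    then have "\<forall>T. F \<in> T \<and> openin flag_topology T \<longrightarrow> (\<exists>G. G \<in> schubert_cell w \<and> G \<in> T)"
      unfolding in_closure_of by blast
    ultimately obtain G where G: "G \<in> schubert_cell w" "G \<in> ?U"
      by meson
    then obtain a where "G = chart w (id a)" "\<forall>s. s \<notin> ?I \<longrightarrow> a s = 0"
      unfolding schubert_cell_eq by blast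
    then have a: "G = chart w a" "a s = 0"
      using s(2) by (simp, blast)
    then show False
      using G(2) chart_coords_chart[OF w s(1), of a] by simp
  qed
  then have "chart w L = (chart w (\<lambda>s. if s \<in> ?I then L s else 0) :: 'm flag)"
    by (intro chart_cong[OF w]) simp
  then show "F \<in> schubert_cell w"
    unfolding schubert_cell_eq L by (intro image_eqI[of _ _ "\<lambda>s. if s \<in> ?I then L s else 0"]) simp_all
next
  fix F :: "'m flag"
  assume F: "F \<in> schubert_cell w"
  then have "F \<in> range (chart w)"
    unfolding schubert_cell_eq by auto
  with F show "F \<in> schubert w \<inter> range (chart w)"
    using schubert_cell_subset_schubert by blast
qed

lemma complex_dim_schubert:
  "complex_dim flag_topology (schubert w :: 'm flag set) = inversions (2 * CARD('m)) w"
proof (rule complex_dim_eqI)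
  show "has_complex_dim flag_topology (schubert w :: 'm flag set) (inversions (2 * CARD('m)) w)"
    unfolding has_complex_dim_def
  proof (intro exI[of _ "schubert_cell w :: 'm flag set"] conjI)
    show "openin (subtopology flag_topology (schubert w)) (schubert_cell w :: 'm flag set)"
      unfolding openin_subtopology schubert_Int_chart[symmetric] using openin_chart[OF w] by blast
    show "schubert w \<subseteq> flag_topology closure_of (schubert_cell w :: 'm flag set)"
      by (simp add: schubert_def schubert_cell_def)
    have "subtopology flag_topology (schubert_cell w :: 'm flag set) homeomorphic_space
        complex_space (card (cell_index (2 * CARD('m)) w))"
      unfolding schubert_cell_eq
    proof (rule homeomorphic_chart_graph[OF w])
      show "cell_index (2 * CARD('m)) w \<subseteq> chart_index (2 * CARD('m))"
        by (auto simp: cell_index_def)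
      then show "finite (cell_index (2 * CARD('m)) w)"
        by (rule finite_subset) simp
    qed (auto intro: continuous_on_product_coordinates)
    then show "locally_complex (inversions (2 * CARD('m)) w) (subtopology flag_topology (schubert_cell w :: 'm flag set))"
      unfolding card_cell_index by (rule locally_complex_if_homeomorphic)
  qed
  show "schubert w \<subseteq> topspace (flag_topology :: 'm flag topology)"
    unfolding schubert_def by (rule closure_of_subset_topspace)
  show "schubert w \<noteq> ({} :: 'm flag set)"
    using schubert_cell_base schubert_cell_subset_schubert by blast
qed

text \<open>
  Here the \<open>j\<close>-stability of the even steps of the Iwasawa flag enters: both
  \<open>F p \<inter> E (2k)\<close> and \<open>j (F (n - p)) \<inter> E (2k)\<close> lie in \<open>E (2k)\<close> and meet trivially.
\<close>

lemma rank_condition: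
  assumes meet: "(schubert_cell w :: 'm flag set) \<inter> transversal_flags \<noteq> {}"
    and p: "p \<le> 2 * CARD('m)" and k: "k \<le> CARD('m)"
  shows "prefix_count w p (2 * k) + prefix_count w (2 * CARD('m) - p) (2 * k) \<le> 2 * k"
proof -
  let ?N = "2 * CARD('m)" and ?V = "flag_of_basis (u_vec \<circ> w) :: 'm flag"
  let ?E = "iwasawa_flag (2 * k) :: 'm cvec set"
  obtain X where X: "X \<in> iwasawa_borel" "act X ?V \<in> transversal_flags"
    using meet by (auto simp: schubert_cell_def orbit_def)
  have det: "det X \<noteq> 0" and stab: "act X iwasawa_flag = (iwasawa_flag :: 'm flag)"
    using X(1) by (auto simp: iwasawa_borel_def SL_def)
  have Fc: "act X ?V \<in> complete_flags"
    using X(2) by (simp add: transversal_flags_def)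
  \<comment> \<open>\<open>J p\<close> lists the basis vectors common to V_p and E_{2k},
    \<open>S p\<close> is their span, and its translate \<open>A p\<close> lies both in step p of
    the transversal flag and in E_{2k}.\<close>
  define J where "J p = w ` {i \<in> {1..p}. w i \<le> 2 * k}" for p
  define S where "S p = {v :: 'm cvec. \<forall>j\<in>{1..?N}. j \<notin> J p \<longrightarrow> u_coord j v = 0}" for p
  have cardJ: "card (J p) = prefix_count w p (2 * k)" for p
    unfolding J_def prefix_count_def using permutes_inj[OF w] by (intro card_image) (auto intro: inj_on_subset)
  have JN: "J p \<subseteq> {1..?N}" if "p \<le> ?N" for p
    using that mem unfolding J_def by force
  have S_sub: "vec.subspace (S p)" for p
    by (auto simp: S_def vec.subspace_def)
  have S_dim: "vec.dim (S p) = prefix_count w p (2 * k)" if "p \<le> ?N" for p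
  proof -
    let ?d = "(u_index :: nat \<Rightarrow> 'm + 'm) ` J p"
    have "v \<in> S p \<longleftrightarrow> v \<in> {x. \<forall>i. i \<notin> ?d \<longrightarrow> x $ i = 0}" for v
    proof (intro iffI CollectI allI impI)
      fix i
      assume v: "v \<in> S p" and i: "i \<notin> ?d"
      obtain j where "j \<in> {1..?N}" "i = u_index j"
        using bij_betw_imp_surj_on[OF bij_betw_u_index] by (metis UNIV_I image_iff)
      with v i show "v $ i = 0"
        by (auto simp: S_def u_coord_def)
    next
      assume v: "v \<in> {x. \<forall>i. i \<notin> ?d \<longrightarrow> x $ i = 0}"
      have "u_coord j v = 0" if j: "j \<in> {1..?N}" "j \<notin> J p" for j
      proof -
        have "(u_index j :: 'm + 'm) \<notin> ?d"
          using j JN[OF \<open>p \<le> ?N\<close>] u_index_eq_iff[where 'm = 'm, OF j(1)] by blast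
        then show ?thesis
          using v by (simp add: u_coord_def)
      qed
      then show "v \<in> S p"
        by (simp add: S_def)
    qed
    then have "S p = {x. \<forall>i. i \<notin> ?d \<longrightarrow> x $ i = 0}"
      by (rule Set.set_eqI)
    then have "vec.dim (S p) = card ?d"
      by (simp add: dim_substandard_cart)
    also have "\<dots> = card (J p)"
      by (rule card_image) (rule inj_on_subset[OF bij_betw_imp_inj_on[OF bij_betw_u_index] JN[OF that]])
    finally show ?thesis
      by (simp add: cardJ)
  qed
  have S_E: "S p \<subseteq> ?E" for p
  proof
    fix v
    assume v: "v \<in> S p"
    have "u_coord j v = 0" if "j \<in> {1..?N}" "2 * k < j" for j
    proof -
      have "j \<notin> J p"
        using that(2) by (auto simp: J_def)
      then show ?thesis
        using v that(1) by (simp add: S_def)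
    qed
    then show "v \<in> ?E"
      by (simp add: iwasawa_flag_iff)
  qed
  have S_V: "S p \<subseteq> ?V p" if "p \<le> ?N" for p
  proof
    fix v
    assume v: "v \<in> S p"
    have "(\<Sum>j = 1..?N. u_coord j v *s u_vec j) \<in> ?V p"
    proof (rule vec.subspace_sum)
      show sub: "vec.subspace (?V p)"
        unfolding flag_of_basis_def by (rule vec.subspace_span)
      fix j
      assume j: "j \<in> {1..?N}"
      show "u_coord j v *s u_vec j \<in> ?V p"
      proof (cases "j \<in> J p")
        case True
        then have "u_vec j \<in> ?V p"
          using that by (auto simp: J_def flag_of_basis_def intro!: vec.span_base)
        then show ?thesis
          by (rule vec.subspace_scale[OF sub])
      next
        case False
        then show ?thesis
          using v j vec.subspace_0[OF sub] by (simp add: S_def)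
      qed
    qed
    then show "v \<in> ?V p"
      using u_coord_expand[of v] by simp
  qed
  define A where "A p = (*v) X ` S p" for p
  have A_sub: "vec.subspace (A p)" for p
    unfolding A_def by (rule vec.subspace_image[OF S_sub])
  have A_dim: "vec.dim (A p) = prefix_count w p (2 * k)" if "p \<le> ?N" for p
    unfolding A_def dim_act[OF det] by (rule S_dim[OF that])
  have A_E: "A p \<subseteq> ?E" for p
  proof -
    have "A p \<subseteq> act X iwasawa_flag (2 * k)"
      unfolding A_def act_def using S_E by blast
    then show ?thesis
      by (simp add: stab)
  qed
  have A_V: "A p \<subseteq> act X ?V p" if "p \<le> ?N" for p
    unfolding A_def act_def using S_V[OF that] by blast
  have "A p \<inter> jmap ` A (?N - p) \<subseteq> act X ?V p \<inter> jmap ` act X ?V (?N - p)"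
    using A_V[OF p] A_V[of "?N - p"] by auto
  also have "\<dots> \<subseteq> {0}"
    using X(2) p by (simp add: transversal_flags_def)
  finally have "vec.dim (A p) + vec.dim (jmap ` A (?N - p)) \<le> vec.dim ?E"
    using A_E[of p] A_E[of "?N - p"] jmap_iwasawa_even[of k]
    by (intro dim_add_le_of_Int A_sub subspace_jmap_image complete_flagsD[OF iwasawa_complete]) blast+
  also have "\<dots> = min (2 * k) ?N"
    by (rule complete_flagsD(3)[OF iwasawa_complete])
  also have "\<dots> = 2 * k"
    using k by simp
  finally show ?thesis
    using A_dim[OF p] A_dim[of "?N - p"] by (simp add: dim_jmap_image[OF A_sub])
qed

end

subsection \<open>The isotropic flags in the chart around the base flag\<close>

text \<open>
  The entries of the frame matrix of an isotropic flag in this chart: those on and above the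
  antidiagonal are free parameters, the entry \<open>(r, j)\<close> below it is determined by
  \<open>omega f\<^sub>i f\<^sub>j = 0\<close> with \<open>i = n + 1 - r\<close>.
\<close>

lemma omega_sum_sum:
  "omega (\<Sum>i\<in>A. c i *s x i) (\<Sum>j\<in>B. d j *s y j) = (\<Sum>i\<in>A. c i * (\<Sum>j\<in>B. d j * omega (x i) (y j)))"
proof -
  have right: "omega z (\<Sum>j\<in>B. d j *s y j) = (\<Sum>j\<in>B. d j * omega z (y j))" for z
    by (simp add: omega_sum_right omega_scale_right)
  have left: "omega (\<Sum>i\<in>A. c i *s x i) z = (\<Sum>i\<in>A. c i * omega (x i) z)" for z
    by (simp add: omega_sum_left omega_scale_left)
  show ?thesis
    unfolding left unfolding right ..
qed

text \<open>The value of omega on the base frame vectors at places k and n + 1 - k; the first has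
  odd index exactly for k up to m.\<close>

definition iso_sign :: "nat \<Rightarrow> nat \<Rightarrow> complex" where
  "iso_sign m k = (if k \<le> m then - 1 else 1)"

function iso_entry :: "nat \<Rightarrow> (nat \<times> nat \<Rightarrow> complex) \<Rightarrow> nat \<Rightarrow> nat \<Rightarrow> complex" where
  "iso_entry m a r j =
    (if r < j then 0 else if r = j then 1 else if r + j \<le> 2 * m + 1 then a (r, j)
     else if 2 * m < r then 0
     else - iso_sign m (2 * m + 1 - r) * (\<Sum>k\<in>{2 * m + 2 - r..2 * m + 1 - j}.
       iso_sign m k * iso_entry m a k (2 * m + 1 - r) * iso_entry m a (2 * m + 1 - k) j))"
  by pat_completeness auto
text \<open>The first factor lies in the earlier column 2m + 1 - r < j, the second in column j but
  in a row 2m + 1 - k < r. The zero entries for r > 2m keep the truncated differences from spoiling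
  this.\<close>

termination
  by (relation "measures [\<lambda>(m, a, r, j). j, \<lambda>(m, a, r, j). r]") auto

declare iso_entry.simps [simp del]

definition iso_index :: "nat \<Rightarrow> (nat \<times> nat) set" where
  "iso_index m = {(k, j). 1 \<le> j \<and> j < k \<and> k + j \<le> 2 * m + 1}"

lemma iso_index_subset: "iso_index m \<subseteq> chart_index (2 * m)"
  by (auto simp: iso_index_def chart_index_def)

text \<open>The first column of the larger triangle has 2m + 1 entries, and the rest is the smaller
  triangle shifted along the diagonal: a sum of odd numbers.\<close>

lemma card_iso_index: "card (iso_index m) = m\<^sup>2"
proof (induction m)
  case 0
  have "iso_index 0 = {}"
    by (auto simp: iso_index_def)
  then show ?case
    by simp
next
  case (Suc m)
  let ?f = "\<lambda>(k, j). (k + 1, j + 1)" and ?A = "(\<lambda>k. (k, Suc 0)) ` {2..2 * Suc m}"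
  have "iso_index (Suc m) = ?f ` iso_index m \<union> ?A"
  proof (intro subset_antisym subsetI)
    fix s
    assume "s \<in> iso_index (Suc m)"
    then obtain k j where s: "s = (k, j)" "1 \<le> j" "j < k" "k + j \<le> 2 * Suc m + 1"
      by (auto simp: iso_index_def)
    show "s \<in> ?f ` iso_index m \<union> ?A"
    proof (cases "j = 1")
      case False
      then have "(k - 1, j - 1) \<in> iso_index m" "s = ?f (k - 1, j - 1)"
        using s by (auto simp: iso_index_def)
      then show ?thesis
        by blast
    qed (use s in auto)
  qed (auto simp: iso_index_def)
  moreover have "finite (iso_index m)"
    using iso_index_subset finite_subset by fastforce
  moreover have "?f ` iso_index m \<inter> ?A = {}"
    by (auto simp: iso_index_def)
  moreover have "card (?f ` iso_index m) = card (iso_index m)"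
    by (rule card_image) (auto intro: inj_onI)
  moreover have "card ?A = 2 * m + 1"
    by (subst card_image) (auto intro: inj_onI)
  ultimately show ?case
    using Suc by (simp add: card_Un_disjoint power2_eq_square)
qed

lemma continuous_iso_entry: "continuous_on UNIV (\<lambda>a. iso_entry m a r j)"
proof (induction j arbitrary: r rule: less_induct)
  case (less j)
  note col = less
  show ?case
  proof (induction r rule: less_induct)
    case (less r)
    show ?case
    proof (cases "j < r \<and> 2 * m + 1 < r + j \<and> r \<le> 2 * m")
      case True
      then have eq: "(\<lambda>a. iso_entry m a r j) = (\<lambda>a. - iso_sign m (2 * m + 1 - r) *
          (\<Sum>k\<in>{2 * m + 2 - r..2 * m + 1 - j}.
            iso_sign m k * iso_entry m a k (2 * m + 1 - r) * iso_entry m a (2 * m + 1 - k) j))"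
        by (intro ext) (subst iso_entry.simps, simp)
      show ?thesis
        unfolding eq using True
        by (intro continuous_on_mult continuous_on_const continuous_on_sum col less) auto
    next
      case False
      then consider "r < j" | "r = j" | "j < r" "r + j \<le> 2 * m + 1" | "j < r" "2 * m + 1 < r + j" "2 * m < r"
        by linarith
      then show ?thesis
        by cases (simp_all add: iso_entry.simps continuous_on_product_coordinates)
    qed
  qed
qed

section \<open>The symplectic form on a frame that is unipotent along the base permutation\<close>

context
  fixes hat :: "nat \<Rightarrow> nat \<Rightarrow> complex" and f :: "nat \<Rightarrow> 'm::{finite,linorder} cvec"
  assumes f: "\<And>k j. k \<in> {1..2 * CARD('m)} \<Longrightarrow> j \<in> {1..2 * CARD('m)} \<Longrightarrow>
      u_coord (base_perm CARD('m) k) (f j) = hat k j"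
    and hat_upper: "\<And>k j. k < j \<Longrightarrow> hat k j = 0" and hat_diag: "\<And>j. hat j j = 1"
begin

private lemma expand: "j \<in> {1..2 * CARD('m)} \<Longrightarrow> f j = (\<Sum>k = 1..2 * CARD('m). hat k j *s u_vec (base_perm CARD('m) k))"
proof -
  assume j: "j \<in> {1..2 * CARD('m)}"
  have "f j = (\<Sum>i = 1..2 * CARD('m). u_coord i (f j) *s u_vec i)"
    by (rule u_coord_expand)
  also have "\<dots> = (\<Sum>k = 1..2 * CARD('m). u_coord (base_perm CARD('m) k) (f j) *s u_vec (base_perm CARD('m) k))"
    using sum.permute[OF base_perm_permutes[of "CARD('m)"], of "\<lambda>i. u_coord i (f j) *s u_vec i"]
    by (simp add: o_def)
  also have "\<dots> = (\<Sum>k = 1..2 * CARD('m). hat k j *s u_vec (base_perm CARD('m) k))"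
    by (rule sum.cong) (use f j in auto)
  finally show ?thesis .
qed

private lemma omega_base:
  assumes "k \<in> {1..2 * CARD('m)}" "l \<in> {1..2 * CARD('m)}"
  shows "omega (u_vec (base_perm CARD('m) k) :: 'm cvec) (u_vec (base_perm CARD('m) l)) = (if l = 2 * CARD('m) + 1 - k then iso_sign CARD('m) k else 0)"
proof -
  note w = base_perm_permutes[of "CARD('m)"]
  have "base_perm CARD('m) k \<in> {1..2 * CARD('m)}" "base_perm CARD('m) l \<in> {1..2 * CARD('m)}"
    using assms permutes_in_image[OF w] by blast+
  moreover have "base_perm CARD('m) l = partner (base_perm CARD('m) k) \<longleftrightarrow> l = 2 * CARD('m) + 1 - k"
    using partner_strictly_pairing[OF strictly_pairing_base_perm assms(1)] perm_eq[OF w] by auto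
  moreover have "odd (base_perm CARD('m) k) \<longleftrightarrow> k \<le> CARD('m)"
    using assms(1) by (auto simp: base_perm_def)
  ultimately show ?thesis
    by (simp add: omega_u_vec iso_sign_def)
qed

text \<open>omega couples place k only with place n + 1 - k, and triangularity restricts k to the
  range from i to n + 1 - j.\<close>

private lemma omega_frame:
  assumes i: "i \<in> {1..2 * CARD('m)}" and j: "j \<in> {1..2 * CARD('m)}"
  shows "omega (f i) (f j) = (\<Sum>k = i..2 * CARD('m) + 1 - j. iso_sign CARD('m) k * hat k i * hat (2 * CARD('m) + 1 - k) j)"
proof -
  have "omega (f i) (f j) = (\<Sum>k = 1..2 * CARD('m). hat k i * (\<Sum>l = 1..2 * CARD('m). hat l j * omega (u_vec (base_perm CARD('m) k) :: 'm cvec) (u_vec (base_perm CARD('m) l))))"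
    unfolding expand[OF i] expand[OF j] by (rule omega_sum_sum)
  also have "\<dots> = (\<Sum>k = 1..2 * CARD('m). iso_sign CARD('m) k * hat k i * hat (2 * CARD('m) + 1 - k) j)"
  proof (rule sum.cong[OF refl])
    fix k
    assume k: "k \<in> {1..2 * CARD('m)}"
    have "(\<Sum>l = 1..2 * CARD('m). hat l j * omega (u_vec (base_perm CARD('m) k) :: 'm cvec) (u_vec (base_perm CARD('m) l))) =
        (\<Sum>l = 1..2 * CARD('m). if l = 2 * CARD('m) + 1 - k then hat (2 * CARD('m) + 1 - k) j * iso_sign CARD('m) k else 0)"
      by (rule sum.cong) (use k in \<open>auto simp: omega_base\<close>)
    also have "\<dots> = hat (2 * CARD('m) + 1 - k) j * iso_sign CARD('m) k"
      using k by (subst sum.delta) auto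
    finally show "hat k i * (\<Sum>l = 1..2 * CARD('m). hat l j * omega (u_vec (base_perm CARD('m) k) :: 'm cvec) (u_vec (base_perm CARD('m) l))) =
        iso_sign CARD('m) k * hat k i * hat (2 * CARD('m) + 1 - k) j"
      by (simp add: mult_ac)
  qed
  also have "\<dots> = (\<Sum>k = i..2 * CARD('m) + 1 - j. iso_sign CARD('m) k * hat k i * hat (2 * CARD('m) + 1 - k) j)"
  proof (rule sum.mono_neutral_right)
    show "\<forall>k\<in>{1..2 * CARD('m)} - {i..2 * CARD('m) + 1 - j}. iso_sign CARD('m) k * hat k i * hat (2 * CARD('m) + 1 - k) j = 0"
    proof
      fix k
      assume "k \<in> {1..2 * CARD('m)} - {i..2 * CARD('m) + 1 - j}"
      then have "k < i \<or> 2 * CARD('m) + 1 - k < j"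
        by auto
      then show "iso_sign CARD('m) k * hat k i * hat (2 * CARD('m) + 1 - k) j = 0"
        using hat_upper by auto
    qed
  qed (use i j in auto)
  finally show ?thesis .
qed

text \<open>In the term k = i the unit diagonal entry is a factor, so the entry in row n + 1 - i and
  column j occurs with coefficient 1 or -1 and the equation can be solved for it.\<close>

lemma omega_frame_eq_0_iff:
  assumes "1 \<le> i" "i < j" "i + j \<le> 2 * CARD('m)"
  shows "omega (f i) (f j) = 0 \<longleftrightarrow> hat (2 * CARD('m) + 1 - i) j = - iso_sign CARD('m) i *
    (\<Sum>k = i + 1..2 * CARD('m) + 1 - j. iso_sign CARD('m) k * hat k i * hat (2 * CARD('m) + 1 - k) j)"
proof -
  have "omega (f i) (f j) = (\<Sum>k = i..2 * CARD('m) + 1 - j. iso_sign CARD('m) k * hat k i * hat (2 * CARD('m) + 1 - k) j)"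
    using assms by (intro omega_frame) auto
  also have "\<dots> = iso_sign CARD('m) i * hat (2 * CARD('m) + 1 - i) j +
      (\<Sum>k = i + 1..2 * CARD('m) + 1 - j. iso_sign CARD('m) k * hat k i * hat (2 * CARD('m) + 1 - k) j)"
    using assms by (subst sum.atLeast_Suc_atMost) (auto simp: hat_diag)
  finally have eq: "omega (f i) (f j) = iso_sign CARD('m) i * hat (2 * CARD('m) + 1 - i) j +
      (\<Sum>k = i + 1..2 * CARD('m) + 1 - j. iso_sign CARD('m) k * hat k i * hat (2 * CARD('m) + 1 - k) j)" .
  have solve: "e * h + S = 0 \<longleftrightarrow> h = - e * S" if "e = 1 \<or> e = - 1" for e h S :: complex
    using that by (elim disjE; hypsubst) (auto simp: eq_neg_iff_add_eq_0 add.commute[of "- h"])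
  show ?thesis
    unfolding eq by (rule solve) (simp add: iso_sign_def)
qed

end

text \<open>As omega is alternating, the conditions with i < j suffice. Each determines one entry
  below the antidiagonal, and these solved equations are the recursion of
  \<open>iso_entry\<close>.\<close>

lemma isotropic_chart_iff:
  "chart (base_perm CARD('m)) L \<in> (isotropic_flags :: 'm::{finite,linorder} flag set) \<longleftrightarrow>
    (\<forall>s\<in>chart_index (2 * CARD('m)). L s = iso_entry CARD('m) L (fst s) (snd s))"
proof -
  let ?n = "2 * CARD('m)" and ?w = "base_perm CARD('m)"
  let ?hat = "\<lambda>k j. if k = j then 1 else if j < k then L (k, j) else 0"
  let ?f = "chart_frame ?w L :: nat \<Rightarrow> 'm cvec"
  note w = base_perm_permutes[of "CARD('m)"]
  note eq0 = omega_frame_eq_0_iff[of ?f ?hat, OF u_coord_chart_frame[OF w]]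
  have entry: "iso_entry CARD('m) L (?n + 1 - i) j = - iso_sign CARD('m) i * (\<Sum>k = i + 1..?n + 1 - j.
      iso_sign CARD('m) k * iso_entry CARD('m) L k i * iso_entry CARD('m) L (?n + 1 - k) j)"
    if "1 \<le> i" "i < j" "i + j \<le> ?n" for i j
  proof -
    have *: "\<not> ?n + 1 - i < j" "?n + 1 - i \<noteq> j" "\<not> ?n + 1 - i + j \<le> ?n + 1" "\<not> ?n < ?n + 1 - i"
      "?n + 1 - (?n + 1 - i) = i" "?n + 2 - (?n + 1 - i) = i + 1"
      using that by auto
    show ?thesis
      by (subst iso_entry.simps) (simp only: * if_False)
  qed
  have iso: "chart ?w L \<in> (isotropic_flags :: 'm flag set) \<longleftrightarrow>
      (\<forall>i j. 1 \<le> i \<longrightarrow> i < j \<longrightarrow> i + j \<le> ?n \<longrightarrow> omega (?f i) (?f j) = 0)"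
    unfolding chart_def isotropic_basis_iff[OF det_chart_frame[OF w]]
  proof (intro iffI allI impI ballI)
    fix i j
    assume *: "\<forall>i j. 1 \<le> i \<longrightarrow> i < j \<longrightarrow> i + j \<le> ?n \<longrightarrow> omega (?f i) (?f j) = 0"
      and ij: "i \<in> {1..?n}" "j \<in> {1..?n}" "i + j \<le> ?n"
    consider "i < j" | "i = j" | "j < i"
      by linarith
    then show "omega (?f i) (?f j) = 0"
    proof cases
      case 2
      have "omega (?f i) (?f i) = - omega (?f i) (?f i)"
        by (rule omega_swap)
      then have "2 * omega (?f i) (?f i) = 0"
        unfolding mult_2 by (simp only: eq_neg_iff_add_eq_0)
      then show ?thesis
        using 2 by simp
    next
      case 3
      then have "omega (?f j) (?f i) = 0"
        using * ij by (auto simp: add.commute)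
      then show ?thesis
        using omega_swap[of "?f i" "?f j"] by simp
    qed (use * ij in auto)
  qed auto
  show ?thesis
  proof
    assume "chart ?w L \<in> (isotropic_flags :: 'm flag set)"
    then have om: "omega (?f i) (?f j) = 0" if "1 \<le> i" "i < j" "i + j \<le> ?n" for i j
      using iso that by blast
    \<comment> \<open>Induction over columns and, within a column, over rows, in the order in which
      the recursion refers to entries.\<close>
    have "?hat r j = iso_entry CARD('m) L r j" if "1 \<le> j" "r \<le> ?n" for r j
      using that
    proof (induction j arbitrary: r rule: less_induct)
      case (less j)
      note col = less.IH and j = less.prems(1)
      show ?case
        using less.prems(2)
      proof (induction r rule: less_induct)
        case (less r)
        show ?case
        proof (cases "j < r \<and> ?n + 1 < r + j")
          case False
          then consider "r < j" | "r = j" | "j < r" "r + j \<le> ?n + 1"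
            by linarith
          then show ?thesis
            by cases (simp_all add: iso_entry.simps)
        next
          case True
          define i where "i = ?n + 1 - r"
          have i: "1 \<le> i" "i < j" "i + j \<le> ?n" "r = ?n + 1 - i"
            using True less.prems by (auto simp: i_def)
          have "?hat r j = - iso_sign CARD('m) i *
              (\<Sum>k = i + 1..?n + 1 - j. iso_sign CARD('m) k * ?hat k i * ?hat (?n + 1 - k) j)"
            unfolding i(4) using om[OF i(1-3)] eq0[OF _ _ _ _ i(1-3)] by auto
          also have "\<dots> = - iso_sign CARD('m) i * (\<Sum>k = i + 1..?n + 1 - j.
              iso_sign CARD('m) k * iso_entry CARD('m) L k i * iso_entry CARD('m) L (?n + 1 - k) j)"
          proof (intro arg_cong2[where f = "(*)"] refl sum.cong)
            fix k
            assume k: "k \<in> {i + 1..?n + 1 - j}"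
            show "?hat k i = iso_entry CARD('m) L k i"
              using i j k by (intro col) auto
            show "?hat (?n + 1 - k) j = iso_entry CARD('m) L (?n + 1 - k) j"
              using i j k by (intro less.IH) auto
          qed
          finally show ?thesis
            using entry[OF i(1-3)] i(4) by simp
        qed
      qed
    qed
    then show "\<forall>s\<in>chart_index ?n. L s = iso_entry CARD('m) L (fst s) (snd s)"
      by (fastforce simp: chart_index_def)
  next
    assume L: "\<forall>s\<in>chart_index ?n. L s = iso_entry CARD('m) L (fst s) (snd s)"
    have hat: "?hat r j = iso_entry CARD('m) L r j" if "1 \<le> j" "r \<le> ?n" for r j
    proof (cases "j < r")
      case True
      then have "(r, j) \<in> chart_index ?n"
        using that by (simp add: chart_index_def)
      with L True show ?thesis
        by force
    qed (auto simp: iso_entry.simps)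
    have "omega (?f i) (?f j) = 0" if ij: "1 \<le> i" "i < j" "i + j \<le> ?n" for i j
    proof -
      have "?hat (?n + 1 - i) j = iso_entry CARD('m) L (?n + 1 - i) j"
        using ij by (intro hat) auto
      also have "\<dots> = - iso_sign CARD('m) i *
          (\<Sum>k = i + 1..?n + 1 - j. iso_sign CARD('m) k * ?hat k i * ?hat (?n + 1 - k) j)"
        unfolding entry[OF ij]
      proof (intro arg_cong2[where f = "(*)"] refl sum.cong)
        fix k
        assume k: "k \<in> {i + 1..?n + 1 - j}"
        show "iso_entry CARD('m) L k i = ?hat k i"
          using ij k by (intro hat[symmetric]) auto
        show "iso_entry CARD('m) L (?n + 1 - k) j = ?hat (?n + 1 - k) j"
          using ij k by (intro hat[symmetric]) auto
      qed
      finally show ?thesis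
        using eq0[OF _ _ _ _ ij] by auto
    qed
    then show "chart ?w L \<in> (isotropic_flags :: 'm flag set)"
      using iso by blast
  qed
qed

lemma iso_entry_cong:
  assumes "\<And>s. s \<in> iso_index m \<Longrightarrow> a s = b s"
  shows "1 \<le> j \<Longrightarrow> iso_entry m a r j = iso_entry m b r j"
proof (induction j arbitrary: r rule: less_induct)
  case (less j)
  note col = less.IH and j = less.prems
  show ?case
  proof (induction r rule: less_induct)
    case (less r)
    show ?case
    proof (cases "j < r \<and> 2 * m + 1 < r + j \<and> r \<le> 2 * m")
      case False
      then consider "r < j" | "r = j" | "j < r" "r + j \<le> 2 * m + 1" | "j < r" "2 * m + 1 < r + j" "2 * m < r"
        by linarith
      then show ?thesis
      proof cases
        case 3
        then have "(r, j) \<in> iso_index m"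
          using j by (simp add: iso_index_def)
        with 3 assms show ?thesis
          by (simp add: iso_entry.simps)
      qed (simp_all add: iso_entry.simps)
    next
      case True
      have "(\<Sum>k\<in>{2 * m + 2 - r..2 * m + 1 - j}.
            iso_sign m k * iso_entry m a k (2 * m + 1 - r) * iso_entry m a (2 * m + 1 - k) j) =
          (\<Sum>k\<in>{2 * m + 2 - r..2 * m + 1 - j}.
            iso_sign m k * iso_entry m b k (2 * m + 1 - r) * iso_entry m b (2 * m + 1 - k) j)"
      proof (intro arg_cong2[where f = "(*)"] refl sum.cong)
        fix k
        assume k: "k \<in> {2 * m + 2 - r..2 * m + 1 - j}"
        show "iso_entry m a k (2 * m + 1 - r) = iso_entry m b k (2 * m + 1 - r)"
          using True j by (intro col) auto
        show "iso_entry m a (2 * m + 1 - k) j = iso_entry m b (2 * m + 1 - k) j"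
          using True k by (intro less.IH) auto
      qed
      with True show ?thesis
        by (subst (1 2) iso_entry.simps) simp
    qed
  qed
qed

definition iso_graph :: "nat \<Rightarrow> (nat \<times> nat \<Rightarrow> complex) \<Rightarrow> nat \<times> nat \<Rightarrow> complex" where
  "iso_graph m a s = iso_entry m a (fst s) (snd s)"

lemma iso_graph_free: "s \<in> iso_index m \<Longrightarrow> iso_graph m a s = a s"
  by (auto simp: iso_graph_def iso_index_def iso_entry.simps)

lemma isotropic_Int_chart:
  "isotropic_flags \<inter> range (chart (base_perm CARD('m))) =
    (\<lambda>a. chart (base_perm CARD('m)) (iso_graph CARD('m) a) :: 'm::{finite,linorder} flag) `
      {a. \<forall>s. s \<notin> iso_index CARD('m) \<longrightarrow> a s = 0}"
proof (intro subset_antisym subsetI)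
  let ?w = "base_perm CARD('m)" and ?n = "2 * CARD('m)" and ?I = "iso_index CARD('m)"
  note w = base_perm_permutes[of "CARD('m)"]
  have snd: "1 \<le> snd s" if "s \<in> chart_index ?n" for s
    using that by (auto simp: chart_index_def)
  {
    fix F :: "'m flag"
    assume "F \<in> isotropic_flags \<inter> range (chart ?w)"
    then obtain L where L: "F = chart ?w L" "\<forall>s\<in>chart_index ?n. L s = iso_entry CARD('m) L (fst s) (snd s)"
      using isotropic_chart_iff[where 'm = 'm] by blast
    let ?a = "\<lambda>s. if s \<in> ?I then L s else 0"
    have "chart ?w L = (chart ?w (iso_graph CARD('m) ?a) :: 'm flag)"
    proof (rule chart_cong[OF w])
      fix s
      assume s: "s \<in> chart_index ?n"
      then have "iso_entry CARD('m) L (fst s) (snd s) = iso_graph CARD('m) ?a s"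
        unfolding iso_graph_def by (intro iso_entry_cong snd) simp_all
      with L(2) s show "L s = iso_graph CARD('m) ?a s"
        by simp
    qed
    then show "F \<in> (\<lambda>a. chart ?w (iso_graph CARD('m) a)) ` {a. \<forall>s. s \<notin> ?I \<longrightarrow> a s = 0}"
      using L(1) by (intro image_eqI[of _ _ ?a]) simp_all
  next
    fix F :: "'m flag"
    assume "F \<in> (\<lambda>a. chart ?w (iso_graph CARD('m) a)) ` {a. \<forall>s. s \<notin> ?I \<longrightarrow> a s = 0}"
    then obtain a where a: "F = chart ?w (iso_graph CARD('m) a)"
      by blast
    \<comment> \<open>The recursion reads the free entries alone, and \<open>iso_graph\<close>
      leaves these unchanged.\<close>
    have "iso_graph CARD('m) a s = iso_entry CARD('m) (iso_graph CARD('m) a) (fst s) (snd s)"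
      if "s \<in> chart_index ?n" for s
    proof -
      have "iso_graph CARD('m) a s = iso_entry CARD('m) a (fst s) (snd s)"
        by (simp add: iso_graph_def)
      also have "\<dots> = iso_entry CARD('m) (iso_graph CARD('m) a) (fst s) (snd s)"
        by (rule iso_entry_cong[OF _ snd[OF that]]) (simp add: iso_graph_free)
      finally show ?thesis .
    qed
    then show "F \<in> isotropic_flags \<inter> range (chart ?w)"
      unfolding a using isotropic_chart_iff[where 'm = 'm] by blast
  }
qed

text \<open>For an isotropic flag the quaternionic basis adapted to it is automatically orthogonal.\<close>

lemma isotropic_transitive:
  fixes F :: "'m::{finite,linorder} flag"
  assumes F: "F \<in> isotropic_flags"
  obtains X where "det X \<noteq> 0" "\<And>x y. omega (X *v x) (X *v y) = omega x y" "F = act X base_flag"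
proof -
  let ?n = "2 * CARD('m)"
  have Fc: "F \<in> complete_flags" and iso: "\<And>p x y. p \<le> ?n \<Longrightarrow> x \<in> F p \<Longrightarrow> y \<in> F (?n - p) \<Longrightarrow> omega x y = 0"
    using F by (auto simp: isotropic_flags_def perp_def)
  note sub = complete_flagsD(2)[OF Fc]
  obtain v where v: "quat_adapted F v"
    using quat_adapted_exists[OF Fc] .
  \<comment> \<open>Normalizing factors, real so that they commute with j, chosen to make omega(v_i,
    j(v_i)) = -1 as for the Iwasawa basis.\<close>
  define d where "d i = inverse (sqrt (\<Sum>a\<in>UNIV. (cmod (v i $ a))\<^sup>2))" for i
  let ?v = "\<lambda>i. of_real (d i) *s v i"
  have vi: "v i \<noteq> 0" "v i \<in> F i" "jmap (v i) \<in> F (?n + 1 - i)" if "i \<in> {1..CARD('m)}" for i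
    using v that by (auto simp: quat_adapted_def)
  have norm: "(\<Sum>a\<in>UNIV. (cmod (v i $ a))\<^sup>2) > 0" if "i \<in> {1..CARD('m)}" for i
  proof -
    have "(\<Sum>a\<in>UNIV. (cmod (v i $ a))\<^sup>2) \<noteq> 0"
      using vi(1)[OF that] by (subst sum_nonneg_eq_0_iff) (auto simp: vec_eq_iff)
    then show ?thesis
      by (simp add: order_less_le sum_nonneg)
  qed
  have d: "d i \<noteq> 0" "(d i)\<^sup>2 * (\<Sum>a\<in>UNIV. (cmod (v i $ a))\<^sup>2) = 1" if "i \<in> {1..CARD('m)}" for i
    using norm[OF that] by (simp_all add: d_def power_inverse)
  have "quat_adapted F ?v"
    unfolding quat_adapted_def
    using vi d(1) by (auto simp: jmap_scale intro: vec.subspace_scale[OF sub])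
  note X = quat_adapted_frame[OF subsetD[OF isotropic_subset_transversal F] this]
  let ?q = "quat_frame ?v"
  \<comment> \<open>Both vectors lie in F_m, on which omega vanishes.\<close>
  have vv: "omega (?v a) (?v b) = 0" if "a \<in> {1..CARD('m)}" "b \<in> {1..CARD('m)}" for a b
  proof -
    have "v a \<in> F CARD('m)" "v b \<in> F (?n - CARD('m))"
      using vi(2) that complete_flag_memI[OF Fc] by auto
    then have "omega (v a) (v b) = 0"
      by (intro iso[of "CARD('m)"]) auto
    then show ?thesis
      by (simp add: omega_scale_left omega_scale_right)
  qed
  have vj: "omega (?v a) (jmap (?v b)) = (if a = b then - 1 else 0)"
    if a: "a \<in> {1..CARD('m)}" and b: "b \<in> {1..CARD('m)}" for a b
  proof -
    \<comment> \<open>The vector v_a lies in F_{b-1} and j(v_b) in F_{n+1-b}, steps of complementary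
      dimension.\<close>
    have less: "omega (v a) (jmap (v b)) = 0" if "a < b" "a \<in> {1..CARD('m)}" "b \<in> {1..CARD('m)}" for a b
    proof (rule iso[of "b - 1"])
      show "v a \<in> F (b - 1)"
        using vi(2)[OF that(2)] complete_flag_memI[OF Fc, of a "b - 1"] that(1) by auto
      have "?n - (b - 1) = ?n + 1 - b"
        using that by auto
      then show "jmap (v b) \<in> F (?n - (b - 1))"
        using vi(3)[OF that(3)] by simp
    qed (use that in auto)
    consider "a < b" | "a = b" | "b < a"
      by linarith
    then show ?thesis
    proof cases
      case 1
      then show ?thesis
        using less[OF 1 a b] by (simp add: omega_scale_left omega_scale_right jmap_scale)
    next
      case 2
      have "omega (?v a) (jmap (?v a)) = - of_real ((d a)\<^sup>2 * (\<Sum>r\<in>UNIV. (cmod (v a $ r))\<^sup>2))"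
        by (simp add: omega_scale_left omega_scale_right jmap_scale omega_self_jmap power2_eq_square mult_ac
            del: of_real_sum)
      also have "\<dots> = - 1"
        unfolding d(2)[OF a] by simp
      finally show ?thesis
        using 2 by simp
    next
      case 3
      \<comment> \<open>Reduces to the previous case with the roles exchanged: v_a = j(-j(v_a)), and
        applying j to both arguments conjugates omega.\<close>
      have "omega (v a) (jmap (v b)) = - omega (jmap (v b)) (jmap (- jmap (v a)))"
        by (simp add: omega_swap[of "v a"] jmap_minus)
      also have "\<dots> = cnj (omega (v b) (jmap (v a)))"
        unfolding omega_jmap_jmap by simp
      also have "\<dots> = 0"
        using less[OF 3 b a] by simp
      finally show ?thesis
        using 3 by (simp add: omega_scale_left omega_scale_right jmap_scale)
    qed
  qed
  have q: "omega (?q i) (?q j) = omega (u_vec i :: 'm cvec) (u_vec j)"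
    if i: "i \<in> {1..?n}" and j: "j \<in> {1..?n}" for i j
  proof -
    define a b where "a = (i + 1) div 2" and "b = (j + 1) div 2"
    have ab: "a \<in> {1..CARD('m)}" "b \<in> {1..CARD('m)}"
      using i j by (auto simp: a_def b_def)
    have qi: "?q i = (if odd i then ?v a else jmap (?v a))" and qj: "?q j = (if odd j then ?v b else jmap (?v b))"
      by (auto simp: quat_frame_def a_def b_def elim!: evenE)
    have part: "j = partner i \<longleftrightarrow> a = b \<and> (odd i \<longleftrightarrow> even j)"
      using i j unfolding partner_def a_def b_def by (auto; presburger)
    have jj: "omega (jmap (?v a)) (jmap (?v b)) = 0"
      unfolding omega_jmap_jmap by (simp only: vv[OF ab] complex_cnj_zero)
    have jv: "omega (jmap (?v a)) (?v b) = (if a = b then 1 else 0)"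
      using vj[OF ab(2,1)] omega_swap[of "jmap (?v a)" "?v b"] by auto
    show ?thesis
      unfolding omega_u_vec[OF i j] qi qj part using vv[OF ab] vj[OF ab] jj jv by auto
  qed
  have "omega (frame_matrix ?q *v x) (frame_matrix ?q *v y) = omega x y" for x y :: "'m cvec"
  proof -
    have "omega (frame_matrix ?q *v x) (frame_matrix ?q *v y) =
        (\<Sum>i = 1..?n. u_coord i x * (\<Sum>j = 1..?n. u_coord j y * omega (?q i) (?q j)))"
      unfolding frame_matrix_mult by (rule omega_sum_sum)
    also have "\<dots> = (\<Sum>i = 1..?n. u_coord i x * (\<Sum>j = 1..?n. u_coord j y * omega (u_vec i :: 'm cvec) (u_vec j)))"
      by (intro sum.cong refl arg_cong2[where f = "(*)"] q)
    also have "\<dots> = omega (\<Sum>i = 1..?n. u_coord i x *s (u_vec i :: 'm cvec)) (\<Sum>j = 1..?n. u_coord j y *s u_vec j)"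
      by (rule omega_sum_sum[symmetric])
    finally show ?thesis
      by (simp only: u_coord_expand[symmetric])
  qed
  then show ?thesis
    using X by (intro that[of "frame_matrix ?q"]) auto
qed

lemma symplectic_act_isotropic:
  fixes F :: "'m::finite flag"
  assumes X: "det X \<noteq> 0" "\<And>x y. omega (X *v x) (X *v y) = omega x y" and F: "F \<in> isotropic_flags"
  shows "act X F \<in> isotropic_flags"
proof -
  have "act X F p \<subseteq> perp (act X F (2 * CARD('m) - p))" if "p \<le> 2 * CARD('m)" for p
    using F that X(2) by (fastforce simp: isotropic_flags_def act_def perp_def)
  then show ?thesis
    using act_complete[OF X(1)] F by (simp add: isotropic_flags_def)
qed

text \<open>Matrices preserving omega move the chart piece around the base flag over all isotropic
  flags; its free parameters are indexed by \<open>iso_index\<close>.\<close>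

lemma complex_dim_isotropic:
  "complex_dim flag_topology (isotropic_flags :: 'm::{finite,linorder} flag set) = CARD('m)\<^sup>2"
proof (rule complex_dim_eqI)
  let ?w = "base_perm CARD('m)" and ?I = "iso_index CARD('m)"
  note w = base_perm_permutes[of "CARD('m)"]
  let ?C = "isotropic_flags \<inter> range (chart ?w) :: 'm flag set"
  have "finite ?I"
    using iso_index_subset by (rule finite_subset) simp
  then have hom: "subtopology flag_topology ?C homeomorphic_space complex_space (CARD('m)\<^sup>2)"
    unfolding isotropic_Int_chart card_iso_index[symmetric]
    by (intro homeomorphic_chart_graph[OF w] iso_index_subset iso_graph_free)
      (simp_all add: iso_graph_def continuous_iso_entry)
  show iso: "isotropic_flags \<subseteq> topspace (flag_topology :: 'm flag topology)"
    by (auto simp: isotropic_flags_def)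
  show "has_complex_dim flag_topology (isotropic_flags :: 'm flag set) (CARD('m)\<^sup>2)"
  proof (rule has_complex_dim_homogeneous[OF _ _ _ hom])
    show "isotropic_flags \<subseteq> (complete_flags :: 'm flag set)"
      using iso by simp
    show "openin (subtopology flag_topology isotropic_flags) ?C"
      using openin_chart[OF w] openin_subtopology_Int2 by blast
    show "base_flag \<in> ?C"
      using base_flag_isotropic chart_zero[of ?w] unfolding base_flag_def by (metis IntI rangeI)
    fix F :: "'m flag"
    assume "F \<in> isotropic_flags"
    then obtain X where X: "det X \<noteq> 0" "\<And>x y. omega (X *v x) (X *v y) = omega x y" "F = act X base_flag"
      using isotropic_transitive by blast
    obtain Y where Y: "X ** Y = mat 1" "Y ** X = mat 1" "det Y \<noteq> 0"
      using matrix_inverse_exists[OF X(1)] .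
    have "omega (Y *v x) (Y *v y) = omega x y" for x y
      using X(2)[of "Y *v x" "Y *v y"] Y(1) by (simp add: matrix_vector_mul_assoc)
    then show "\<exists>X Y. X ** Y = mat 1 \<and> Y ** X = mat 1 \<and> act X ` isotropic_flags \<subseteq> isotropic_flags \<and>
        act Y ` isotropic_flags \<subseteq> isotropic_flags \<and> F = act X base_flag"
      using X Y symplectic_act_isotropic by blast
  qed
  show "isotropic_flags \<noteq> ({} :: 'm flag set)"
    using base_flag_isotropic by blast
qed

theorem theorem23:
  fixes D :: "'m::{finite,linorder} flag set" and w :: "nat \<Rightarrow> nat"
  assumes "open_quat_orbit D"
    and "w permutes {1..2 * CARD('m)}"
  shows "(schubert w \<in> complementary_schubert (base_cycle D) \<longleftrightarrow> strictly_pairing CARD('m) w) \<and>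
    (schubert w \<in> complementary_schubert (base_cycle D) \<longrightarrow>
       spacing CARD('m) w \<and>
       inversions (2 * CARD('m)) w = CARD('m)\<^sup>2 - CARD('m))"
proof -
  note w = assms(2)
  have D: "D = transversal_flags" and op: "openin flag_topology D"
    using open_quat_orbit_eq[OF assms(1)] assms(1) by (auto simp: open_quat_orbit_def)
  have cycle: "base_cycle D = isotropic_flags"
    unfolding D by (rule base_cycle_transversal)
  \<comment> \<open>Complementary dimension: m(2m - 1) - m^2 = m^2 - m.\<close>
  have arith: "inversions (2 * CARD('m)) w + CARD('m)\<^sup>2 = CARD('m) * (2 * CARD('m) - 1) \<longleftrightarrow>
      inversions (2 * CARD('m)) w = CARD('m)\<^sup>2 - CARD('m)"
    by (cases "CARD('m)") (auto simp: power2_eq_square algebra_simps)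
  have compl: "schubert w \<in> complementary_schubert (base_cycle D) \<longleftrightarrow>
      inversions (2 * CARD('m)) w = CARD('m)\<^sup>2 - CARD('m) \<and> schubert w \<inter> (isotropic_flags :: 'm flag set) \<noteq> {}"
    unfolding complementary_schubert_def cycle complex_dim_isotropic complex_dim_flags
    using w complex_dim_schubert[OF w] arith by auto
  have iff: "schubert w \<in> complementary_schubert (base_cycle D) \<longleftrightarrow> strictly_pairing CARD('m) w"
  proof
    assume "schubert w \<in> complementary_schubert (base_cycle D)"
    then have inv: "inversions (2 * CARD('m)) w = CARD('m)\<^sup>2 - CARD('m)"
      and "schubert w \<inter> (isotropic_flags :: 'm flag set) \<noteq> {}"
      unfolding compl by blast+
    then obtain F :: "'m flag" where F: "F \<in> schubert w" "F \<in> D"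
      unfolding D using isotropic_subset_transversal by blast
    then have "F \<in> flag_topology closure_of schubert_cell w"
      by (simp add: schubert_def schubert_cell_def)
    then obtain G where "G \<in> schubert_cell w" "G \<in> D"
      using F(2) op unfolding in_closure_of by blast
    then have "schubert_cell w \<inter> (transversal_flags :: 'm flag set) \<noteq> {}"
      unfolding D by blast
    then show "strictly_pairing CARD('m) w"
      using rank_condition[OF w] inv by (intro inversions_ge_if_symmetric_ranks(2)[OF w]) auto
  next
    assume sp: "strictly_pairing CARD('m) w"
    \<comment> \<open>V_w itself is a point of the intersection.\<close>
    have "flag_of_basis (u_vec \<circ> w) \<in> schubert w \<inter> (isotropic_flags :: 'm flag set)"
      using strictly_pairing_isotropic[OF w sp] schubert_cell_base[OF w] schubert_cell_subset_schubert[OF w] by blast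
    then show "schubert w \<in> complementary_schubert (base_cycle D)"
      unfolding compl using inversions_strictly_pairing[OF w sp] by blast
  qed
  moreover have "spacing CARD('m) w" if "strictly_pairing CARD('m) w"
    using that by (auto simp: strictly_pairing_def spacing_def)
  ultimately show ?thesis
    using inversions_strictly_pairing[OF w] by blast
qed

end
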